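(* Let $u$ be the exact solution of the nonlinear variable-exponent diffusion-wave problem described in the context, and let $u^n_{i,j}=u(x_i,y_j,t_n)$ be its coarse-grid values, which solve the discrete equation with truncation error given in the context. Let $[U_H]_{i,j}^n$ be the solution of the coarse-grid compact difference system $$c_{0}[\mathcal{A}_{H}\delta_{t}U_{H}]_{i,j}^{1}-\lambda_{1,1}[\Lambda_{H} U_{H}]_{i,j}^{1}=\lambda_{1,1}\mathcal{A}_{H}f([U_{H}]_{i,j}^{1})+[\mathcal{A}_{H}b]_{i,j}^{1},\quad (i,j)\in\omega_{H},$$ $$c_{0}[\mathcal{A}_{H}\delta_{t}U_{H}]_{i,j}^{n}+\sum_{k=1}^{n-1}\tilde{w}_{n-k}[\mathcal{A}_{H}\delta_{t}U_{H}]_{i,j}^{k}-\mathfrak{I}_{\bar{\alpha}}^{n}[\Lambda_{H} U_H]_{i,j}^{n}=\frac{\lambda_{n,n}}{2}\mathcal{A}_{H}f([U_{H}]_{i,j}^{n})+\sum_{k=1}^{n-1}\widetilde{\lambda}_{n,k}\mathcal{A}_{H}f([U_{H}]_{i,j}^{k})+[\mathcal{A}_{H}b]_{i,j}^{n}$$ for $(i,j)\in\omega_H$, $2\le n\le N$, with $[U_H]^0_{i,j}=u_0(x_i,y_j)$ and $[\partial_tU_H]^0_{i,j}=\bar u_0(x_i,y_j)$ for $(i,j)\in\omega_H$, and $[U_H]^n_{i,j}=0$ for $(i,j)\in\partial\omega_H$, $0\le n\le N$. Under the regularity assumptions (A1)–(A2) listed in the context, if the step sizes $\tau$, $H_x$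 and $H_y$ are sufficiently small, then $$\|u^{n}-U_{H}^{n}\|_{H}\le Q\left(\tau^{2}+H_x^4+H_y^4\right),\qquad 1\le n\le N.$$ Here $Q$ is some constant depending on $T,\bar\alpha,Q_g,Q_f$ and $Q_L$, with $Q_L=\sqrt{(r_x-l_x)(r_y-l_y)}$.
   Context: **Problem.** $\Omega=(l_x,r_x)\times(l_y,r_y)$, $T>0$, $1<\alpha(t)<2$, and $${}^{c}\partial_t^{\alpha(t)}u-\Delta u=f(u)\ \text{in }\Omega\times(0,T],\quad u(\cdot,0)=u_0,\ \partial_tu(\cdot,0)=\bar u_0\ \text{in }\Omega,\quad u=0\ \text{on }\partial\Omega\times[0,T],$$ where ${}^{c}\partial_t^{\alpha(t)}u(\cdot,t)=\int_0^tk(t-s)\,\partial_s^2u(\cdot,s)\,ds$ with $k(t)=\frac{t^{1-\alpha(t)}}{\Gamma(2-\alpha(t))}$. Standing assumptions: $f\in C^2(\mathbb R)$ with $|f'|\le Q_f$; $\alpha$ is three times differentiable with $|\alpha'|+|\alpha''|+|\alpha'''|\le Q_\alpha$ and $\alpha'(0)=0$, where $Q_f,Q_\alpha$ are positive constants. Throughout, $Q$ denotes a generic constant whose value may vary in different contexts. **Equivalent form.** Put $\alpha_0=\alpha(0)$, $\bar\alpha=\alpha_0-1\in(0,1)$, $\beta_\mu(t)=t^{\mu-1}/\Gamma(\mu)$ and $g(t)=(\beta_{\alpha_0-1}*k)(t)=\int_0^t\frac{(t-s)^{\alpha_0-2}}{\Gamma(\alpha_0-1)}\frac{s^{1-\alpha(s)}}{\Gamma(2-\alpha(s))}ds$,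 with $g(0)=1$. The problem is equivalent to $$\partial_tu+\int_0^tg'(t-s)\partial_su\,ds-\int_0^t\beta_{\bar\alpha}(t-s)\Delta u\,ds=\int_0^t\beta_{\bar\alpha}(t-s)f(u)\,ds+g(t)\bar u_0$$ with the same initial and boundary conditions. $Q_g$ denotes a constant with $|g|\le Q_g$, $|g'|\le Q_g$ on $[0,T]$ and $|g''(t)|\le Q_g(|\ln t|+1)$ on $(0,T]$. **Regularity assumptions.** (A1) $\partial_tu,\ \partial_t\partial_x^2u,\ \partial_t\partial_y^2u,\ \partial_x^6u,\ \partial_y^6u$ are continuous in $\bar\Omega\times[0,T]$, and there is a positive constant $Q$ such that $|\partial_tu|\le Qt^{\alpha_0-1}$, $|\partial_\chi^6u|\le Q$, $|\partial_t\partial_\chi^2u|\le Qt^{\alpha_0-1}$ ($\chi=x,y$) on $\bar\Omega\times(0,T]$. (A2) $\partial_t^2u,\ \partial_t^3u,\ \partial_t^2\partial_x^2u,\ \partial_t^2\partial_y^2u$ are continuous in $\bar\Omega\times(0,T]$, and there is a positive constant $Q$ such that $|\partial_t^2u|\le Qt^{\alpha_0-2}$, $|\partial_t^3u|\le Qt^{\alpha_0-3}$, $|\partial_t^2\partial_\chi^2u|\le Qt^{\alpha_0-2}$ ($\chi=x,y$) on $\bar\Omega\times(0,T]$. **Coarse grid.** $H_x=(r_x-l_x)/M_{H,x}$, $H_y=(r_y-l_y)/M_{H,y}$ with positive integers $M_{H,x},M_{H,y}$; $x_i=l_x+iH_x$, $y_j=l_y+jH_y$; $\omega_H=\{(i,j):1\le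 i\le M_{H,x}-1,\,1\le j\le M_{H,y}-1\}$, $\bar\omega_H=\{(i,j):0\le i\le M_{H,x},\,0\le j\le M_{H,y}\}$, $\partial\omega_H=\bar\omega_H\setminus\omega_H$. $\mathcal A_{H,x}v_{i,j}=\frac{v_{i-1,j}+10v_{i,j}+v_{i+1,j}}{12}$ for $1\le i\le M_{H,x}-1$ and $=v_{i,j}$ for $i\in\{0,M_{H,x}\}$; $\mathcal A_{H,y}$ analogously in $j$; $\mathcal A_H=\mathcal A_{H,x}\mathcal A_{H,y}$; $\delta^2_{H,x}v_{i,j}=\frac{v_{i+1,j}-2v_{i,j}+v_{i-1,j}}{H_x^2}$, $\delta^2_{H,y}$ analogously; $\Lambda_H=\mathcal A_{H,y}\delta^2_{H,x}+\mathcal A_{H,x}\delta^2_{H,y}$. $\|v\|_H=\big(H_xH_y\sum_{(i,j)\in\omega_H}v_{i,j}^2\big)^{1/2}$. **Time discretization.** $\tau=T/N$ with $N$ a positive integer, $t_n=n\tau$; $v^{n-\frac12}=\frac12(v^n+v^{n-1})$, $\delta_tv^n=(v^n-v^{n-1})/\tau$. $w_k=g(t_{k+1})-g(t_k)$, $\tilde w_0=\frac{w_0}2$, $\tilde w_k=\frac12(w_k+w_{k-1})$ for $k\ge1$, $c_0=1+\frac{w_0}2$. $\lambda_{n,j}=\frac1\tau\int_{t_{n-1}}^{t_n}\int_{t_{j-1}}^{\min\{t,t_j\}}\beta_{\bar\alpha}(t-s)\,ds\,dt$ for $1\le j\le n$; $\mathfrak I^n_{\bar\alpha}v^n=\lambda_{n,1}v^1+\sum_{j=2}^n\lambda_{n,j}v^{j-\frac12}$;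 $\widetilde\lambda_{n,1}=\lambda_{n,1}+\frac{\lambda_{n,2}}2$, $\widetilde\lambda_{n,k}=\frac12(\lambda_{n,k+1}+\lambda_{n,k})$ for $2\le k\le n-1$. $b^n_{i,j}=\frac1\tau\int_{t_{n-1}}^{t_n}g(t)\,\bar u_0(x_i,y_j)\,dt$. **Discrete equation satisfied by the exact solution.** With $f^n_{i,j}=f(u^n_{i,j})$, $$[\mathcal{A}_{H}\delta_{t}u]_{i,j}^{n}+\sum_{k=1}^{n}\tilde{w}_{n-k}[\mathcal{A}_{H}\delta_{t}u]_{i,j}^{k}-\mathfrak{I}_{\bar{\alpha}}^{n}[\Lambda_{H} u]_{i,j}^{n}=\mathfrak{I}_{\bar{\alpha}}^{n}[\mathcal{A}_{H}f]_{i,j}^{n}+[\mathcal{A}_{H}b]_{i,j}^{n}+(R)_{i,j}^n,\quad (i,j)\in\omega_H,\ 1\le n\le N,$$ where $(R)^n_{i,j}$ is the local truncation error.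
   Formalization: The constant Q and the smallness thresholds may also depend on the constant in (A1)–(A2) and on a bound for |f''| on the range of u; with only the listed constants the claim fails on scaling u (f = 0). The initial velocity is taken continuous on the closed rectangle. *)

theory Defs
  imports "HOL-Analysis.Analysis"
begin

section \<open>Derivatives on a closed domain\<close>

text \<open>All derivatives are taken relative to a set \<open>S\<close> (a closed interval in every use below), so that
  they are one-sided at its end points and ordinary derivatives in its interior.
  \<open>times_diff k S A f\<close>: the derivatives of \<open>f\<close> of order \<open>1, \<dots>, k\<close> relative to \<open>S\<close> exist
  at every point of the relatively open subset \<open>A\<close> of \<open>S\<close>.\<close>

definition deriv_in :: "real set \<Rightarrow> nat \<Rightarrow> (real \<Rightarrow> real) \<Rightarrow> real \<Rightarrow> real" where
  "deriv_in S k f = ((\<lambda>h x. vector_derivative h (at x within S)) ^^ k) f"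

definition times_diff :: "nat \<Rightarrow> real set \<Rightarrow> real set \<Rightarrow> (real \<Rightarrow> real) \<Rightarrow> bool" where
  "times_diff k S A f \<longleftrightarrow> (\<forall>j<k. \<forall>x\<in>A. deriv_in S j f differentiable (at x within S))"

type_synonym spacetime_fun = "real \<Rightarrow> real \<Rightarrow> real \<Rightarrow> real"

definition Dx :: "real set \<Rightarrow> nat \<Rightarrow> spacetime_fun \<Rightarrow> spacetime_fun" where
  "Dx S k u = (\<lambda>x y t. deriv_in S k (\<lambda>\<xi>. u \<xi> y t) x)"

definition Dy :: "real set \<Rightarrow> nat \<Rightarrow> spacetime_fun \<Rightarrow> spacetime_fun" where
  "Dy S k u = (\<lambda>x y t. deriv_in S k (\<lambda>\<eta>. u x \<eta> t) y)"

definition Dt :: "real \<Rightarrow> nat \<Rightarrow> spacetime_fun \<Rightarrow> spacetime_fun" where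
  "Dt T k u = (\<lambda>x y. deriv_in {0..T} k (u x y))"

definition cont_on :: "(real \<times> real \<times> real) set \<Rightarrow> spacetime_fun \<Rightarrow> bool" where
  "cont_on D v \<longleftrightarrow> continuous_on D (\<lambda>(x, y, t). v x y t)"


section \<open>The continuous problem\<close>

definition exponent_conditions :: "real \<Rightarrow> real \<Rightarrow> (real \<Rightarrow> real) \<Rightarrow> bool" where
  "exponent_conditions T Q\<alpha> \<alpha> \<longleftrightarrow>
     0 < Q\<alpha> \<and>
     (\<forall>t\<in>{0..T}. 1 < \<alpha> t \<and> \<alpha> t < 2) \<and>
     times_diff 3 {0..T} {0..T} \<alpha> \<and>
     (\<forall>t\<in>{0..T}. \<bar>deriv_in {0..T} 1 \<alpha> t\<bar> + \<bar>deriv_in {0..T} 2 \<alpha> t\<bar> + \<bar>deriv_in {0..T} 3 \<alpha> t\<bar> \<le> Q\<alpha>) \<and>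
     deriv_in {0..T} 1 \<alpha> 0 = 0"

definition nonlinearity_conditions :: "real \<Rightarrow> (real \<Rightarrow> real) \<Rightarrow> bool" where
  "nonlinearity_conditions Qf f \<longleftrightarrow>
     (\<forall>x. f differentiable (at x)) \<and> (\<forall>x. deriv f differentiable (at x)) \<and>
     continuous_on UNIV (deriv (deriv f)) \<and> (\<forall>x. \<bar>deriv f x\<bar> \<le> Qf)"

definition vo_kernel :: "(real \<Rightarrow> real) \<Rightarrow> real \<Rightarrow> real" where
  "vo_kernel \<alpha> t = t powr (1 - \<alpha> t) / Gamma (2 - \<alpha> t)"

definition beta_kernel :: "real \<Rightarrow> real \<Rightarrow> real" where
  "beta_kernel \<mu> t = t powr (\<mu> - 1) / Gamma \<mu>"

definition g_fun :: "(real \<Rightarrow> real) \<Rightarrow> real \<Rightarrow> real" where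
  "g_fun \<alpha> t = (if t = 0 then 1
     else integral {0..t} (\<lambda>s. beta_kernel (\<alpha> 0 - 1) (t - s) * vo_kernel \<alpha> s))"

text \<open>The meaning of the constant \<open>Q\<^sub>g\<close>. The differentiability clauses only make \<open>g'\<close> and \<open>g''\<close>
  meaningful.\<close>

definition g_bounds :: "real \<Rightarrow> (real \<Rightarrow> real) \<Rightarrow> real \<Rightarrow> bool" where
  "g_bounds T \<alpha> Qg \<longleftrightarrow>
     times_diff 1 {0..T} {0..T} (g_fun \<alpha>) \<and> times_diff 2 {0..T} {0<..T} (g_fun \<alpha>) \<and>
     (\<forall>t\<in>{0..T}. \<bar>g_fun \<alpha> t\<bar> \<le> Qg \<and> \<bar>deriv_in {0..T} 1 (g_fun \<alpha>) t\<bar> \<le> Qg) \<and>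
     (\<forall>t\<in>{0<..T}. \<bar>deriv_in {0..T} 2 (g_fun \<alpha>) t\<bar> \<le> Qg * (\<bar>ln t\<bar> + 1))"

definition caputo_vo :: "real \<Rightarrow> (real \<Rightarrow> real) \<Rightarrow> spacetime_fun \<Rightarrow> spacetime_fun" where
  "caputo_vo T \<alpha> u x y t = integral {0..t} (\<lambda>s. vo_kernel \<alpha> (t - s) * Dt T 2 u x y s)"

text \<open>The initial velocity \<open>v0\<close> enters the difference scheme through its values on the
  closed rectangle, while the initial condition prescribes it on the open one only; it is therefore
  taken to be continuous up to the boundary. Existence of the derivatives of \<open>u\<close> is part of
  \<open>regularity_A1\<close> and \<open>regularity_A2\<close>.\<close>

definition exact_solution ::
  "real \<Rightarrow> real \<Rightarrow> real \<Rightarrow> real \<Rightarrow> real \<Rightarrow> (real \<Rightarrow> real) \<Rightarrow> (real \<Rightarrow> real) \<Rightarrow>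
   (real \<Rightarrow> real \<Rightarrow> real) \<Rightarrow> (real \<Rightarrow> real \<Rightarrow> real) \<Rightarrow> spacetime_fun \<Rightarrow> bool" where
  "exact_solution lx rx ly ry T \<alpha> f u0 v0 u \<longleftrightarrow>
     (\<forall>x\<in>{lx<..<rx}. \<forall>y\<in>{ly<..<ry}. \<forall>t\<in>{0<..T}.
        caputo_vo T \<alpha> u x y t - (Dx {lx..rx} 2 u x y t + Dy {ly..ry} 2 u x y t) = f (u x y t)) \<and>
     (\<forall>x\<in>{lx<..<rx}. \<forall>y\<in>{ly<..<ry}. u x y 0 = u0 x y \<and> Dt T 1 u x y 0 = v0 x y) \<and>
     (\<forall>(x, y) \<in> ({lx..rx} \<times> {ly..ry}) - ({lx<..<rx} \<times> {ly<..<ry}). \<forall>t\<in>{0..T}. u x y t = 0) \<and>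
     continuous_on ({lx..rx} \<times> {ly..ry}) (\<lambda>(x, y). v0 x y)"

definition regularity_A1 ::
  "real \<Rightarrow> real \<Rightarrow> real \<Rightarrow> real \<Rightarrow> real \<Rightarrow> real \<Rightarrow> real \<Rightarrow> spacetime_fun \<Rightarrow> bool" where
  "regularity_A1 lx rx ly ry T \<alpha>0 Qu u \<longleftrightarrow>
    (let X = {lx..rx}; Y = {ly..ry}; J = {0..T}; D = X \<times> Y \<times> J in
     (\<forall>y\<in>Y. \<forall>t\<in>J. times_diff 6 X X (\<lambda>x. u x y t)) \<and>
     (\<forall>x\<in>X. \<forall>t\<in>J. times_diff 6 Y Y (\<lambda>y. u x y t)) \<and>
     (\<forall>x\<in>X. \<forall>y\<in>Y. times_diff 1 J J (u x y) \<and>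
        times_diff 1 J J (Dx X 2 u x y) \<and> times_diff 1 J J (Dy Y 2 u x y)) \<and>
     cont_on D (Dt T 1 u) \<and> cont_on D (Dt T 1 (Dx X 2 u)) \<and> cont_on D (Dt T 1 (Dy Y 2 u)) \<and>
     cont_on D (Dx X 6 u) \<and> cont_on D (Dy Y 6 u) \<and>
     (\<forall>x\<in>X. \<forall>y\<in>Y. \<forall>t\<in>{0<..T}.
        \<bar>Dt T 1 u x y t\<bar> \<le> Qu * t powr (\<alpha>0 - 1) \<and>
        \<bar>Dx X 6 u x y t\<bar> \<le> Qu \<and> \<bar>Dy Y 6 u x y t\<bar> \<le> Qu \<and>
        \<bar>Dt T 1 (Dx X 2 u) x y t\<bar> \<le> Qu * t powr (\<alpha>0 - 1) \<and>
        \<bar>Dt T 1 (Dy Y 2 u) x y t\<bar> \<le> Qu * t powr (\<alpha>0 - 1)))"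

definition regularity_A2 ::
  "real \<Rightarrow> real \<Rightarrow> real \<Rightarrow> real \<Rightarrow> real \<Rightarrow> real \<Rightarrow> real \<Rightarrow> spacetime_fun \<Rightarrow> bool" where
  "regularity_A2 lx rx ly ry T \<alpha>0 Qu u \<longleftrightarrow>
    (let X = {lx..rx}; Y = {ly..ry}; J = {0..T}; J' = {0<..T}; D = X \<times> Y \<times> J' in
     (\<forall>x\<in>X. \<forall>y\<in>Y. times_diff 3 J J' (u x y) \<and>
        times_diff 2 J J' (Dx X 2 u x y) \<and> times_diff 2 J J' (Dy Y 2 u x y)) \<and>
     cont_on D (Dt T 2 u) \<and> cont_on D (Dt T 3 u) \<and>
     cont_on D (Dt T 2 (Dx X 2 u)) \<and> cont_on D (Dt T 2 (Dy Y 2 u)) \<and>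
     (\<forall>x\<in>X. \<forall>y\<in>Y. \<forall>t\<in>J'.
        \<bar>Dt T 2 u x y t\<bar> \<le> Qu * t powr (\<alpha>0 - 2) \<and>
        \<bar>Dt T 3 u x y t\<bar> \<le> Qu * t powr (\<alpha>0 - 3) \<and>
        \<bar>Dt T 2 (Dx X 2 u) x y t\<bar> \<le> Qu * t powr (\<alpha>0 - 2) \<and>
        \<bar>Dt T 2 (Dy Y 2 u) x y t\<bar> \<le> Qu * t powr (\<alpha>0 - 2)))"


section \<open>Spatial grid operators\<close>

text \<open>A grid function assigns \<open>v i j\<close> to the node \<open>(x\<^sub>i, y\<^sub>j)\<close>; only indices with
  \<open>i \<le> Mx\<close>, \<open>j \<le> My\<close> matter.\<close>

type_synonym gridfun = "nat \<Rightarrow> nat \<Rightarrow> real"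

definition grid_int :: "nat \<Rightarrow> nat \<Rightarrow> (nat \<times> nat) set" where
  "grid_int Mx My = {0<..<Mx} \<times> {0<..<My}"

definition grid_bd :: "nat \<Rightarrow> nat \<Rightarrow> (nat \<times> nat) set" where
  "grid_bd Mx My = ({0..Mx} \<times> {0..My}) - grid_int Mx My"

definition Ax :: "nat \<Rightarrow> gridfun \<Rightarrow> gridfun" where
  "Ax Mx v = (\<lambda>i j. if 0 < i \<and> i < Mx then (v (i - 1) j + 10 * v i j + v (i + 1) j) / 12 else v i j)"

definition Ay :: "nat \<Rightarrow> gridfun \<Rightarrow> gridfun" where
  "Ay My v = (\<lambda>i j. if 0 < j \<and> j < My then (v i (j - 1) + 10 * v i j + v i (j + 1)) / 12 else v i j)"

definition A_op :: "nat \<Rightarrow> nat \<Rightarrow> gridfun \<Rightarrow> gridfun" where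
  "A_op Mx My v = Ax Mx (Ay My v)"

definition delta2x :: "real \<Rightarrow> gridfun \<Rightarrow> gridfun" where
  "delta2x Hx v = (\<lambda>i j. (v (i + 1) j - 2 * v i j + v (i - 1) j) / Hx\<^sup>2)"

definition delta2y :: "real \<Rightarrow> gridfun \<Rightarrow> gridfun" where
  "delta2y Hy v = (\<lambda>i j. (v i (j + 1) - 2 * v i j + v i (j - 1)) / Hy\<^sup>2)"

definition Lambda_op :: "nat \<Rightarrow> nat \<Rightarrow> real \<Rightarrow> real \<Rightarrow> gridfun \<Rightarrow> gridfun" where
  "Lambda_op Mx My Hx Hy v = (\<lambda>i j. Ay My (delta2x Hx v) i j + Ax Mx (delta2y Hy v) i j)"

definition grid_norm :: "nat \<Rightarrow> nat \<Rightarrow> real \<Rightarrow> real \<Rightarrow> gridfun \<Rightarrow> real" where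
  "grid_norm Mx My Hx Hy v = sqrt (Hx * Hy * (\<Sum>(i, j)\<in>grid_int Mx My. (v i j)\<^sup>2))"


section \<open>Time discretization\<close>

definition w_coef :: "(real \<Rightarrow> real) \<Rightarrow> real \<Rightarrow> nat \<Rightarrow> real" where
  "w_coef \<alpha> \<tau> k = g_fun \<alpha> (real (k + 1) * \<tau>) - g_fun \<alpha> (real k * \<tau>)"

definition wt_coef :: "(real \<Rightarrow> real) \<Rightarrow> real \<Rightarrow> nat \<Rightarrow> real" where
  "wt_coef \<alpha> \<tau> k = (if k = 0 then w_coef \<alpha> \<tau> 0 / 2 else (w_coef \<alpha> \<tau> k + w_coef \<alpha> \<tau> (k - 1)) / 2)"

definition c0_coef :: "(real \<Rightarrow> real) \<Rightarrow> real \<Rightarrow> real" where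
  "c0_coef \<alpha> \<tau> = 1 + w_coef \<alpha> \<tau> 0 / 2"

definition lambda_coef :: "real \<Rightarrow> real \<Rightarrow> nat \<Rightarrow> nat \<Rightarrow> real" where
  "lambda_coef abar \<tau> n j =
     1 / \<tau> * integral {real (n - 1) * \<tau>..real n * \<tau>}
       (\<lambda>t. integral {real (j - 1) * \<tau>..min t (real j * \<tau>)} (\<lambda>s. beta_kernel abar (t - s)))"

definition lambdat_coef :: "real \<Rightarrow> real \<Rightarrow> nat \<Rightarrow> nat \<Rightarrow> real" where
  "lambdat_coef abar \<tau> n k =
     (if k = 1 then lambda_coef abar \<tau> n 1 + lambda_coef abar \<tau> n 2 / 2
      else (lambda_coef abar \<tau> n (k + 1) + lambda_coef abar \<tau> n k) / 2)"

definition PI_rule :: "real \<Rightarrow> real \<Rightarrow> nat \<Rightarrow> (nat \<Rightarrow> real) \<Rightarrow> real" where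
  "PI_rule abar \<tau> n v =
     lambda_coef abar \<tau> n 1 * v 1 + (\<Sum>j=2..n. lambda_coef abar \<tau> n j * ((v j + v (j - 1)) / 2))"

definition delta_t :: "real \<Rightarrow> (nat \<Rightarrow> gridfun) \<Rightarrow> nat \<Rightarrow> gridfun" where
  "delta_t \<tau> v n = (\<lambda>i j. (v n i j - v (n - 1) i j) / \<tau>)"

text \<open>\<open>U n\<close> is the coarse-grid solution at time level \<open>n\<close>; the grid function \<open>dU0\<close> is the datum
  \<open>[\<partial>\<^sub>tU\<^sub>H]\<^sup>0\<close>, which is prescribed but does not occur in the difference equations.\<close>

definition coarse_solution ::
  "real \<Rightarrow> real \<Rightarrow> real \<Rightarrow> real \<Rightarrow> real \<Rightarrow> (real \<Rightarrow> real) \<Rightarrow> (real \<Rightarrow> real) \<Rightarrow>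
   (real \<Rightarrow> real \<Rightarrow> real) \<Rightarrow> (real \<Rightarrow> real \<Rightarrow> real) \<Rightarrow>
   nat \<Rightarrow> nat \<Rightarrow> nat \<Rightarrow> (nat \<Rightarrow> gridfun) \<Rightarrow> gridfun \<Rightarrow> bool" where
  "coarse_solution lx rx ly ry T \<alpha> f u0 v0 N Mx My U dU0 \<longleftrightarrow>
    (let \<tau> = T / real N; Hx = (rx - lx) / real Mx; Hy = (ry - ly) / real My;
         abar = \<alpha> 0 - 1;
         X = (\<lambda>i. lx + real i * Hx); Y = (\<lambda>j. ly + real j * Hy);
         A = A_op Mx My; L = Lambda_op Mx My Hx Hy;
         b = (\<lambda>n i j. 1 / \<tau> * integral {real (n - 1) * \<tau>..real n * \<tau>} (\<lambda>t. g_fun \<alpha> t * v0 (X i) (Y j)));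
         fU = (\<lambda>n i j. f (U n i j)) in
     (\<forall>(i, j)\<in>grid_int Mx My.
        c0_coef \<alpha> \<tau> * A (delta_t \<tau> U 1) i j - lambda_coef abar \<tau> 1 1 * L (U 1) i j
        = lambda_coef abar \<tau> 1 1 * A (fU 1) i j + A (b 1) i j) \<and>
     (\<forall>n\<in>{2..N}. \<forall>(i, j)\<in>grid_int Mx My.
        c0_coef \<alpha> \<tau> * A (delta_t \<tau> U n) i j
          + (\<Sum>k=1..n - 1. wt_coef \<alpha> \<tau> (n - k) * A (delta_t \<tau> U k) i j)
          - PI_rule abar \<tau> n (\<lambda>m. L (U m) i j)
        = lambda_coef abar \<tau> n n / 2 * A (fU n) i j
          + (\<Sum>k=1..n - 1. lambdat_coef abar \<tau> n k * A (fU k) i j)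
          + A (b n) i j) \<and>
     (\<forall>(i, j)\<in>grid_int Mx My. U 0 i j = u0 (X i) (Y j) \<and> dU0 i j = v0 (X i) (Y j)) \<and>
     (\<forall>n\<in>{0..N}. \<forall>(i, j)\<in>grid_bd Mx My. U n i j = 0))"

end

theory Submission
  imports Defs
begin

text \<open>
  The grid error \<open>e\<^sup>n = u\<^sup>n - U\<^sup>n\<close> vanishes at \<open>n = 0\<close> and on the boundary and satisfies
  the difference equations up to a residual, so the estimate is stability of the scheme plus consistency.

  Stability (\<open>discrete_stability\<close>). The error equation is tested with \<open>e\<^sup>1\<close> in the first step and with
  the mean of \<open>e\<^sup>n\<close> and \<open>e\<^sup>n\<^sup>-\<^sup>1\<close> in every later one. These are the values at which the product integration
  rule freezes its argument, so the diffusion term becomes a convolution quadratic form. Its weights are, up to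
  a factor, the second differences of \<open>\<bar>m\<bar>\<close> to the power \<open>\<alpha>\<^sub>0\<close>. They form a nonnegative, decreasing, convex
  sequence, and such a sequence generates a positive semidefinite Toeplitz matrix (\<open>toeplitz_convex_psd\<close>).
  Since \<open>-\<Lambda>\<close> is a sum of squares of linear functionals, the whole diffusion term has the good sign and is dropped
  (\<open>Lambda_op_positive_type\<close>). The compact average \<open>A\<close> is symmetric and lies between \<open>4/9\<close> and \<open>1\<close>. The memory term is
  summed by parts in time; the new coefficients are second differences of \<open>g\<close>, and they add up to \<open>O(\<tau>)\<close> because
  \<open>g'\<close> has bounded variation. What is left is estimated by the running maximum of the norms of the errors, and Gronwall's
  inequality gives a bound by the sum of the norms of the residuals over all time levels.

  Consistency. The bound on \<open>\<partial>\<^sub>tu\<close> forces \<open>\<partial>\<^sub>tu = 0\<close> at \<open>t = 0\<close>; hence the initial velocity is zero and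
  the terms \<open>b\<^sup>n\<close> vanish. Convolving the equation with a primitive of the fractional kernel gives, for the kernel
  \<open>\<beta>\<close> of order \<open>\<alpha>\<^sub>0\<close> and the source \<open>F = \<Delta>u + f(u)\<close>, the identity \<open>g * \<partial>\<^sub>tu = \<beta> * F\<close> (\<open>caputo_integrated\<close>).
  It contains no singular kernel, and by continuity it holds at every node of the closed
  grid (\<open>integrated_equation\<close>); the boundary nodes matter because \<open>A\<close> averages over them. The increment of the identity over a
  time step is then compared with the scheme cell by cell. The derivatives \<open>\<partial>\<^sub>t\<^sup>2u\<close> and \<open>g''\<close> are singular at
  \<open>0\<close> but integrable, so only the variation of \<open>\<partial>\<^sub>tu\<close>, of the time derivative of \<open>F\<close>, of \<open>g'\<close> and of the kernel enters:
  every error is \<open>\<tau>\<^sup>2\<close> times a product of the variation of a kernel over one cell and the variation of the data over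
  another (\<open>memory_consistency\<close>, \<open>source_consistency\<close>), and summing over all time levels leaves \<open>\<tau>\<^sup>2\<close> times a product of
  total variations (\<open>discrete_convolution_sum_le\<close>). On the newest cell the size of \<open>g'\<close> takes the place of its variation. In space, a Taylor expansion of order six shows that \<open>A \<Delta>u - \<Lambda>u\<close> is of
  fourth order (\<open>compact_operator_consistency\<close>).
\<close>

section \<open>Positivity of the product-integration weights\<close>

text \<open>Summation by parts, twice, from the right end \<open>K\<close>: a nonnegative decreasing convex sequence is a combination with
  nonnegative coefficients of a constant and of the sequences \<open>max 0 (L - m)\<close>. The subtraction of natural numbers is the truncation at \<open>0\<close>.\<close>

lemma convex_sequence_expansion:
  fixes a :: "nat \<Rightarrow> real"
  assumes "m \<le> K"
  shows "a m = a K + real (K - m) * (a K - a (Suc K))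
    + (\<Sum>i<K. (a i - 2 * a (Suc i) + a (Suc (Suc i))) * real (Suc i - m))"
  using assms
proof (induction K rule: dec_induct)
  case base
  have "(\<Sum>i<m. (a i - 2 * a (Suc i) + a (Suc (Suc i))) * real (Suc i - m)) = 0"
    by (intro sum.neutral) auto
  then show ?case by simp
next
  case (step K)
  then obtain d where "K = m + d" using le_Suc_ex by blast
  then show ?case using step(3) by (simp add: Suc_diff_le algebra_simps)
qed

text \<open>The number \<open>max 0 (L - \<bar>i - j\<bar>)\<close> counts the windows of length \<open>L\<close> that contain both \<open>i\<close> and \<open>j\<close>, so the form is
  the sum over all windows of the square of the sum of \<open>z\<close> over the window. For natural numbers \<open>(i - j) + (j - i)\<close> is the distance.\<close>

lemma triangle_kernel_psd:
  fixes z :: "nat \<Rightarrow> real"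
  shows "0 \<le> (\<Sum>i<N. \<Sum>j<N. real (L - ((i - j) + (j - i))) * z i * z j)"
proof -
  define c where "c = (\<lambda>i q. of_bool (i \<le> q \<and> q < i + L) :: real)"
  have count: "(\<Sum>q<N+L. c i q * c j q) = real (L - ((i - j) + (j - i)))" if "i < N" "j < N" for i j
  proof -
    have "(\<Sum>q<N+L. c i q * c j q) = (\<Sum>q<N+L. of_bool (q \<in> {max i j..<min i j + L}))"
      by (intro sum.cong) (auto simp: c_def)
    also have "\<dots> = real (card ({..<N+L} \<inter> {max i j..<min i j + L}))"
      by (subst sum_of_bool_eq) (auto intro!: arg_cong[where f = card])
    also have "{..<N+L} \<inter> {max i j..<min i j + L} = {max i j..<min i j + L}"
      using that by auto
    also have "card {max i j..<min i j + L} = min i j + L - max i j" by simp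
    also have "min i j + L - max i j = L - ((i - j) + (j - i))" by (auto simp: min_def max_def)
    finally show ?thesis .
  qed
  have "(\<Sum>i<N. \<Sum>j<N. real (L - ((i - j) + (j - i))) * z i * z j)
      = (\<Sum>i<N. \<Sum>j<N. \<Sum>q<N+L. (c i q * z i) * (c j q * z j))"
    by (intro sum.cong refl) (simp add: count[symmetric] sum_distrib_right sum_distrib_left mult_ac)
  also have "\<dots> = (\<Sum>i<N. \<Sum>q<N+L. \<Sum>j<N. (c i q * z i) * (c j q * z j))"
    by (intro sum.cong refl sum.swap)
  also have "\<dots> = (\<Sum>q<N+L. \<Sum>i<N. \<Sum>j<N. (c i q * z i) * (c j q * z j))"
    by (rule sum.swap)
  also have "\<dots> = (\<Sum>q<N+L. (\<Sum>i<N. c i q * z i)\<^sup>2)"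
    by (simp add: power2_eq_square sum_product)
  finally show ?thesis by (simp add: sum_nonneg)
qed

text \<open>The discrete form of Polya's criterion: by the expansion above, the matrix is a nonnegative combination of matrices of the
  triangle type.\<close>

lemma toeplitz_convex_psd:
  fixes a z :: "nat \<Rightarrow> real"
  assumes nonneg: "\<And>m. 0 \<le> a m" and decr: "\<And>m. a (Suc m) \<le> a m"
    and conv: "\<And>m. 0 \<le> a m - 2 * a (Suc m) + a (Suc (Suc m))"
  shows "0 \<le> (\<Sum>i<N. \<Sum>j<N. a ((i - j) + (j - i)) * z i * z j)"
proof -
  define d where "d = (\<lambda>i j::nat. (i - j) + (j - i))"
  define c where "c = (\<lambda>i. a i - 2 * a (Suc i) + a (Suc (Suc i)))"
  have "a (d i j) * z i * z j = a N * (z i * z j)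
      + (a N - a (Suc N)) * (real (N - d i j) * z i * z j)
      + (\<Sum>l<N. c l * (real (Suc l - d i j) * z i * z j))" if "i < N" "j < N" for i j
  proof -
    have "d i j \<le> N" using that by (auto simp: d_def)
    from convex_sequence_expansion[OF this, of a]
    have *: "a (d i j) = a N + (a N - a (Suc N)) * real (N - d i j)
        + (\<Sum>l<N. c l * real (Suc l - d i j))" by (simp add: c_def mult.commute)
    show ?thesis
      by (subst *) (simp add: algebra_simps sum_distrib_left)
  qed
  then have "(\<Sum>i<N. \<Sum>j<N. a (d i j) * z i * z j)
     = (\<Sum>i<N. \<Sum>j<N. a N * (z i * z j)
      + (a N - a (Suc N)) * (real (N - d i j) * z i * z j)
      + (\<Sum>l<N. c l * (real (Suc l - d i j) * z i * z j)))"
    by (intro sum.cong refl) auto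
  also have "\<dots> = a N * (\<Sum>i<N. \<Sum>j<N. z i * z j)
     + (a N - a (Suc N)) * (\<Sum>i<N. \<Sum>j<N. real (N - d i j) * z i * z j)
     + (\<Sum>i<N. \<Sum>j<N. \<Sum>l<N. c l * (real (Suc l - d i j) * z i * z j))"
    by (simp add: sum.distrib sum_distrib_left)
  also have "(\<Sum>i<N. \<Sum>j<N. \<Sum>l<N. c l * (real (Suc l - d i j) * z i * z j))
     = (\<Sum>i<N. \<Sum>l<N. \<Sum>j<N. c l * (real (Suc l - d i j) * z i * z j))"
    by (intro sum.cong refl sum.swap)
  also have "\<dots> = (\<Sum>l<N. \<Sum>i<N. \<Sum>j<N. c l * (real (Suc l - d i j) * z i * z j))"
    by (rule sum.swap)
  also have "\<dots> = (\<Sum>l<N. c l * (\<Sum>i<N. \<Sum>j<N. real (Suc l - d i j) * z i * z j))"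
    by (simp add: sum_distrib_left)
  also have "(\<Sum>i<N. \<Sum>j<N. z i * z j) = (\<Sum>i<N. z i)\<^sup>2"
    by (simp add: power2_eq_square sum_product)
  finally have eq: "(\<Sum>i<N. \<Sum>j<N. a (d i j) * z i * z j)
     = a N * (\<Sum>i<N. z i)\<^sup>2
     + (a N - a (Suc N)) * (\<Sum>i<N. \<Sum>j<N. real (N - d i j) * z i * z j)
     + (\<Sum>l<N. c l * (\<Sum>i<N. \<Sum>j<N. real (Suc l - d i j) * z i * z j))" .
  have "0 \<le> (\<Sum>l<N. c l * (\<Sum>i<N. \<Sum>j<N. real (Suc l - d i j) * z i * z j))"
    unfolding d_def using conv
    by (intro sum_nonneg mult_nonneg_nonneg[OF _ triangle_kernel_psd]) (simp add: c_def)
  moreover have "0 \<le> (a N - a (Suc N)) * (\<Sum>i<N. \<Sum>j<N. real (N - d i j) * z i * z j)"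
    unfolding d_def using decr by (intro mult_nonneg_nonneg[OF _ triangle_kernel_psd]) simp
  ultimately have "0 \<le> (\<Sum>i<N. \<Sum>j<N. a (d i j) * z i * z j)"
    unfolding eq using nonneg[of N] by simp
  then show ?thesis by (simp add: d_def)
qed

lemma mean_value_real:
  fixes f f' :: "real \<Rightarrow> real"
  assumes "a < b" "continuous_on {a..b} f"
    and der: "\<And>s. a < s \<Longrightarrow> s < b \<Longrightarrow> (f has_real_derivative f' s) (at s)"
  obtains z where "a < z" "z < b" "f b - f a = (b - a) * f' z"
proof -
  from MVT[OF assms(1,2)] der real_differentiable_def
  obtain l z where "a < z" "z < b" "(f has_real_derivative l) (at z)" "f b - f a = (b - a) * l"
    by meson
  with der DERIV_unique that show thesis by metis
qed

lemma continuous_on_powr_const: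
  fixes h :: "'a::topological_space \<Rightarrow> real"
  assumes "0 < q" "continuous_on S h" "\<And>s. s \<in> S \<Longrightarrow> 0 \<le> h s"
  shows "continuous_on S (\<lambda>s. h s powr q)"
  using assms by (intro continuous_on_powr') auto

lemmas powr_cont_intros = continuous_on_powr_const continuous_on_add continuous_on_diff
  continuous_on_mult continuous_on_minus continuous_on_const continuous_on_id

lemma second_difference_nonneg:
  fixes f f' :: "real \<Rightarrow> real"
  assumes cont: "continuous_on {x..x+2} f"
    and der: "\<And>s. x < s \<Longrightarrow> s < x + 2 \<Longrightarrow> (f has_real_derivative f' s) (at s)"
    and mono: "\<And>r s. x < r \<Longrightarrow> r \<le> s \<Longrightarrow> s < x + 2 \<Longrightarrow> f' r \<le> f' s"
  shows "0 \<le> f (x + 2) - 2 * f (x + 1) + f x"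
proof -
  obtain r where r: "x < r" "r < x + 1" "f (x + 1) - f x = (x + 1 - x) * f' r"
    by (rule mean_value_real[of x "x+1" f f'])
      (use der in \<open>auto intro: continuous_on_subset[OF cont]\<close>)
  obtain s where s: "x + 1 < s" "s < x + 2" "f (x + 2) - f (x + 1) = (x + 2 - (x + 1)) * f' s"
    by (rule mean_value_real[of "x+1" "x+2" f f'])
      (use der in \<open>auto intro: continuous_on_subset[OF cont]\<close>)
  have "f' r \<le> f' s" using r s by (intro mono) auto
  with r s show ?thesis by simp
qed

text \<open>The second central differences at \<open>m\<close> of the even function \<open>\<bar>x\<bar>\<close> to the power \<open>q\<close>. The even extension makes the value at
  \<open>m = 0\<close> equal to \<open>2\<close>, which is what convexity at the index \<open>0\<close> requires.\<close>

definition power_lag :: "real \<Rightarrow> nat \<Rightarrow> real" where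
  "power_lag q m = (real m + 1) powr q - 2 * real m powr q + \<bar>real m - 1\<bar> powr q"

context
  fixes p :: real
  assumes p: "0 < p" "p < 1"
begin

text \<open>For \<open>0 < p < 1\<close> the powers \<open>p - 1\<close>, \<open>p\<close> and \<open>1 + p\<close> are successive derivatives of each other up to constants and alternate between
  convex and concave. Lifting the sign of a second difference through these integrations gives the monotonicity and
  the convexity of the sequence of second differences of the power \<open>1 + p\<close>.\<close>

lemma powr_second_difference_p_minus_1:
  assumes "0 < x" shows "0 \<le> (x + 2) powr (p-1) - 2 * (x + 1) powr (p-1) + x powr (p-1)"
proof (rule second_difference_nonneg[where f' = "\<lambda>s. (p-1) * s powr (p-2)"])
  show "continuous_on {x..x + 2} (\<lambda>x. x powr (p-1))"
    using assms by (intro continuous_intros) auto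
  show "((\<lambda>x. x powr (p-1)) has_real_derivative (p-1) * s powr (p-2)) (at s)" if "x < s" for s
    using assms that by (auto intro!: derivative_eq_intros)
  show "(p-1) * r powr (p-2) \<le> (p-1) * s powr (p-2)" if "x < r" "r \<le> s" for r s
    using assms that p by (intro mult_left_mono_neg powr_mono2') auto
qed

lemma powr_second_difference_p:
  assumes "0 \<le> x" shows "(x + 2) powr p - 2 * (x + 1) powr p + x powr p \<le> 0"
proof -
  have "0 \<le> - ((x + 2) powr p) - 2 * (- ((x + 1) powr p)) + (- (x powr p))"
  proof (rule second_difference_nonneg[where f' = "\<lambda>s. - (p * s powr (p-1))"])
    show "continuous_on {x..x + 2} (\<lambda>x. - (x powr p))"
      using assms p by (intro powr_cont_intros) auto
    show "((\<lambda>x. - (x powr p)) has_real_derivative - (p * s powr (p-1))) (at s)" if "x < s" for s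
      using assms that by (auto intro!: derivative_eq_intros)
    show "- (p * r powr (p-1)) \<le> - (p * s powr (p-1))" if "x < r" "r \<le> s" for r s
      using assms that p by (simp add: powr_mono2')
  qed
  then show ?thesis by simp
qed

lemma powr_second_difference_p_mono:
  assumes "0 \<le> x" "x \<le> y"
  shows "(x + 2) powr p - 2 * (x + 1) powr p + x powr p
       \<le> (y + 2) powr p - 2 * (y + 1) powr p + y powr p" (is "?U x \<le> ?U y")
proof (cases "x = y")
  case False
  obtain z where z: "x < z" "z < y" "?U y - ?U x = (y - x) *
      (p * (z + 2) powr (p-1) - 2 * (p * (z + 1) powr (p-1)) + p * z powr (p-1))"
  proof (rule mean_value_real[of x y ?U])
    show "x < y" using False assms by simp
    show "continuous_on {x..y} ?U" using p assms by (intro powr_cont_intros) auto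
    show "(?U has_real_derivative p * (s + 2) powr (p-1) - 2 * (p * (s + 1) powr (p-1)) + p * s powr (p-1)) (at s)"
      if "x < s" for s
      using that assms by (auto intro!: derivative_eq_intros)
  qed
  have "0 \<le> p * ((z + 2) powr (p-1) - 2 * (z + 1) powr (p-1) + z powr (p-1))"
    using p assms z by (intro mult_nonneg_nonneg powr_second_difference_p_minus_1) auto
  then have "0 \<le> (y - x) * (p * (z + 2) powr (p-1) - 2 * (p * (z + 1) powr (p-1)) + p * z powr (p-1))"
    using assms by (intro mult_nonneg_nonneg) (auto simp: algebra_simps)
  with z(3) show ?thesis by linarith
qed auto

lemma powr_second_difference_q_derivative:
  assumes "0 < s"
  shows "((\<lambda>x. (x + 2) powr (1+p) - 2 * (x + 1) powr (1+p) + x powr (1+p)) has_real_derivative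
          (1+p) * ((s + 2) powr p - 2 * (s + 1) powr p + s powr p)) (at s)"
  using assms by (auto intro!: derivative_eq_intros simp: algebra_simps)

lemma powr_second_difference_q_nonneg:
  assumes "0 \<le> x" shows "0 \<le> (x + 2) powr (1+p) - 2 * (x + 1) powr (1+p) + x powr (1+p)"
proof (rule second_difference_nonneg[where f' = "\<lambda>s. (1+p) * s powr p"])
  show "continuous_on {x..x + 2} (\<lambda>x. x powr (1+p))"
    using assms p by (intro powr_cont_intros) auto
  show "((\<lambda>x. x powr (1+p)) has_real_derivative (1+p) * s powr p) (at s)" if "x < s" for s
    using assms that by (auto intro!: derivative_eq_intros)
  show "(1+p) * r powr p \<le> (1+p) * s powr p" if "x < r" "r \<le> s" for r s
    using assms that p by (intro mult_left_mono powr_mono2) auto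
qed

lemma powr_second_difference_q_antimono:
  assumes "0 \<le> x"
  shows "(x + 3) powr (1+p) - 2 * (x + 2) powr (1+p) + (x + 1) powr (1+p)
       \<le> (x + 2) powr (1+p) - 2 * (x + 1) powr (1+p) + x powr (1+p)"
proof -
  let ?S = "\<lambda>x. (x + 2) powr (1+p) - 2 * (x + 1) powr (1+p) + x powr (1+p)"
  obtain z where z: "x < z" "z < x + 1" "?S (x + 1) - ?S x = (x + 1 - x) *
      ((1+p) * ((z + 2) powr p - 2 * (z + 1) powr p + z powr p))"
    by (rule mean_value_real[of x "x+1" ?S, OF _ _ powr_second_difference_q_derivative])
       (use p assms in \<open>auto intro!: powr_cont_intros\<close>)
  have "(1+p) * ((z + 2) powr p - 2 * (z + 1) powr p + z powr p) \<le> 0"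
    using powr_second_difference_p[of z] z assms p by (intro mult_nonneg_nonpos) auto
  with z(3) show ?thesis by (simp add: add.commute add.left_commute)
qed

lemma powr_fourth_difference_nonneg:
  assumes "0 \<le> x"
  shows "0 \<le> ((x + 4) powr (1+p) - 2 * (x + 3) powr (1+p) + (x + 2) powr (1+p))
    - 2 * ((x + 3) powr (1+p) - 2 * (x + 2) powr (1+p) + (x + 1) powr (1+p))
    + ((x + 2) powr (1+p) - 2 * (x + 1) powr (1+p) + x powr (1+p))"
proof -
  let ?S = "\<lambda>x. (x + 2) powr (1+p) - 2 * (x + 1) powr (1+p) + x powr (1+p)"
  have "0 \<le> ?S (x + 2) - 2 * ?S (x + 1) + ?S x"
  proof (rule second_difference_nonneg[OF _ powr_second_difference_q_derivative])
    show "continuous_on {x..x + 2} ?S"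
      using assms p by (intro powr_cont_intros) auto
  qed (use assms p powr_second_difference_p_mono in auto)
  then show ?thesis by (simp add: add.commute add.left_commute)
qed

text \<open>Convexity of \<open>power_lag\<close> at the index \<open>0\<close>, where the even extension is not smooth. With \<open>q\<close> for \<open>1 + p\<close>, the left-hand side vanishes at
  \<open>q = 2\<close>, and it decreases up to there because \<open>3\<^sup>9 \<le> 2\<^sup>1\<^sup>6\<close>.\<close>

lemma three_powr_ineq: "0 \<le> 3 powr (1+p) - 4 * 2 powr (1+p) + (7::real)"
proof -
  let ?G = "\<lambda>q::real. 3 powr q - 4 * 2 powr q"
  obtain z where z: "1 + p < z" "z < 2"
      "?G 2 - ?G (1+p) = (2 - (1+p)) * (ln 3 * 3 powr z - 4 * (ln 2 * 2 powr z))"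
    by (rule mean_value_real[of "1+p" 2 ?G "\<lambda>z. ln 3 * 3 powr z - 4 * (ln 2 * 2 powr z)"])
       (use p in \<open>auto intro!: continuous_intros derivative_eq_intros\<close>)[3]
  have "9 * ln 3 \<le> 16 * ln (2::real)"
  proof -
    have "9 * ln 3 = ln ((3::real) ^ 9)" by (subst ln_realpow) auto
    also have "\<dots> \<le> ln (2 ^ 16)" by (subst ln_le_cancel_iff) auto
    also have "\<dots> = 16 * ln 2" by (subst ln_realpow) auto
    finally show ?thesis .
  qed
  have "(3/2) powr z \<le> (3/2) powr (2::real)" using z by (intro powr_mono) auto
  also have "\<dots> = 9/4" by (simp add: power2_eq_square)
  finally have "(3/2) powr z \<le> 9/4" .
  then have "3 powr z \<le> 9/4 * 2 powr z"
    by (simp add: powr_divide divide_simps)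
  then have "ln 3 * 3 powr z \<le> ln 3 * (9/4 * 2 powr z)" by (intro mult_left_mono) auto
  also have "\<dots> = (9 * ln 3) * (2 powr z / 4)" by simp
  also have "\<dots> \<le> (16 * ln 2) * (2 powr z / 4)"
    using \<open>9 * ln 3 \<le> 16 * ln 2\<close> by (intro mult_right_mono) auto
  finally have "ln 3 * 3 powr z - 4 * (ln 2 * 2 powr z) \<le> 0" by simp
  then have "?G 2 - ?G (1+p) \<le> 0"
    unfolding z(3) using p by (intro mult_nonneg_nonpos) auto
  then show ?thesis by simp
qed

lemma power_lag_Suc:
  "power_lag (1+p) (Suc m) = (real m + 2) powr (1+p) - 2 * (real m + 1) powr (1+p) + real m powr (1+p)"
  by (simp add: power_lag_def add_ac)

lemma power_lag_0: "power_lag (1+p) 0 = 2"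
  by (simp add: power_lag_def)

lemma power_lag_nonneg: "0 \<le> power_lag (1+p) m"
  using powr_second_difference_q_nonneg by (cases m) (simp_all add: power_lag_0 power_lag_Suc)

lemma power_lag_decreasing: "power_lag (1+p) (Suc m) \<le> power_lag (1+p) m"
proof (cases m)
  case 0
  have "2 powr (1+p) \<le> 2 powr (2::real)" using p by (intro powr_mono) auto
  then show ?thesis using p by (simp add: 0 power_lag_Suc[of 0, simplified] power_lag_0)
next
  case (Suc k)
  then show ?thesis using powr_second_difference_q_antimono[of "real k"]
    by (simp add: power_lag_Suc add_ac)
qed

lemma power_lag_convex:
  "0 \<le> power_lag (1+p) m - 2 * power_lag (1+p) (Suc m) + power_lag (1+p) (Suc (Suc m))"
proof (cases m)
  case 0
  then show ?thesis using p three_powr_ineq by (simp add: power_lag_Suc power_lag_0 add_ac)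
next
  case (Suc k)
  then show ?thesis using powr_fourth_difference_nonneg[of "real k"]
    by (simp add: power_lag_Suc add_ac)
qed

end

lemma lower_triangular_to_symmetric:
  fixes a z :: "nat \<Rightarrow> real"
  shows "(\<Sum>i<N. \<Sum>j<N. a ((i - j) + (j - i)) * z i * z j)
       = 2 * (\<Sum>i<N. \<Sum>j\<le>i. (if i = j then a 0 / 2 else a (i - j)) * z j * z i)"
proof (induction N)
  case (Suc N)
  have "(\<Sum>i<N. a ((i - N) + (N - i)) * z i * z N) = (\<Sum>j<N. a (N - j) * z j * z N)"
    by (intro sum.cong) auto
  moreover have "(\<Sum>j<N. a ((N - j) + (j - N)) * z N * z j) = (\<Sum>j<N. a (N - j) * z j * z N)"
    by (intro sum.cong) auto
  moreover have "(\<Sum>j\<le>N. (if N = j then a 0 / 2 else a (N - j)) * z j * z N)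
     = a 0 / 2 * z N * z N + (\<Sum>j<N. a (N - j) * z j * z N)"
    by (simp add: lessThan_Suc_atMost[symmetric])
  ultimately show ?case using Suc
    by (simp add: sum.distrib algebra_simps)
qed simp

section \<open>The fractional kernel\<close>

lemma beta_kernel_0 [simp]: "beta_kernel \<mu> 0 = 0"
  by (simp add: beta_kernel_def)

lemma beta_kernel_nonneg: "0 < \<mu> \<Longrightarrow> 0 \<le> beta_kernel \<mu> t"
  by (simp add: beta_kernel_def Gamma_real_pos less_imp_le)

lemma beta_kernel_mono:
  assumes "1 \<le> \<mu>" "0 \<le> s" "s \<le> t" shows "beta_kernel \<mu> s \<le> beta_kernel \<mu> t"
  unfolding beta_kernel_def
  using assms by (intro divide_right_mono powr_mono2) (auto simp: Gamma_real_pos less_imp_le)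

lemma beta_kernel_continuous:
  assumes "1 < \<mu>" "continuous_on S h" "\<And>s. s \<in> S \<Longrightarrow> 0 \<le> h s"
  shows "continuous_on S (\<lambda>s. beta_kernel \<mu> (h s))"
  unfolding beta_kernel_def divide_inverse
  using assms by (intro continuous_on_mult continuous_on_powr_const continuous_on_const) auto

lemma beta_kernel_derivative:
  assumes "0 < \<mu>" "0 < t"
  shows "(beta_kernel (1+\<mu>) has_real_derivative beta_kernel \<mu> t) (at t)"
proof -
  have "Gamma (1+\<mu>) = \<mu> * Gamma \<mu>" using Gamma_plus1[of \<mu>] assms by (auto simp: add.commute nonpos_Ints_def)
  then show ?thesis
    unfolding beta_kernel_def using assms
    by (auto intro!: derivative_eq_intros simp: Gamma_eq_zero_iff nonpos_Ints_def)
qed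

lemma beta_kernel_integral_reflected:
  assumes "0 < \<mu>" "a \<le> b" "b \<le> t"
  shows "((\<lambda>s. beta_kernel \<mu> (t - s)) has_integral beta_kernel (1+\<mu>) (t - a) - beta_kernel (1+\<mu>) (t - b)) {a..b}"
proof -
  have "((\<lambda>s. beta_kernel \<mu> (t - s)) has_integral
      (- beta_kernel (1+\<mu>) (t - b)) - (- beta_kernel (1+\<mu>) (t - a))) {a..b}"
  proof (rule fundamental_theorem_of_calculus_interior[OF \<open>a \<le> b\<close>])
    show "continuous_on {a..b} (\<lambda>s. - beta_kernel (1+\<mu>) (t - s))"
      using assms by (intro continuous_intros beta_kernel_continuous) auto
    fix s assume "s \<in> {a<..<b}"
    then have "((\<lambda>s. beta_kernel (1+\<mu>) (t - s)) has_real_derivative beta_kernel \<mu> (t - s) * (-1)) (at s)"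
      using assms by (intro DERIV_chain2[OF beta_kernel_derivative]) (auto intro!: derivative_eq_intros)
    then have "((\<lambda>s. - beta_kernel (1+\<mu>) (t - s)) has_real_derivative beta_kernel \<mu> (t - s)) (at s)"
      by (auto dest: DERIV_minus)
    then show "((\<lambda>s. - beta_kernel (1+\<mu>) (t - s)) has_vector_derivative beta_kernel \<mu> (t - s)) (at s)"
      by (simp add: has_real_derivative_iff_has_vector_derivative)
  qed
  then show ?thesis by simp
qed

lemma beta_kernel_integral:
  assumes "0 < \<mu>" "c \<le> a" "a \<le> b"
  shows "((\<lambda>t. beta_kernel \<mu> (t - c)) has_integral beta_kernel (1+\<mu>) (b - c) - beta_kernel (1+\<mu>) (a - c)) {a..b}"
proof (rule fundamental_theorem_of_calculus_interior[OF \<open>a \<le> b\<close>])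
  show "continuous_on {a..b} (\<lambda>s. beta_kernel (1+\<mu>) (s - c))"
    using assms by (intro continuous_intros beta_kernel_continuous) auto
  fix s assume "s \<in> {a<..<b}"
  then have "((\<lambda>s. beta_kernel (1+\<mu>) (s - c)) has_real_derivative beta_kernel \<mu> (s - c) * 1) (at s)"
    using assms by (intro DERIV_chain2[OF beta_kernel_derivative]) (auto intro!: derivative_eq_intros)
  then show "((\<lambda>s. beta_kernel (1+\<mu>) (s - c)) has_vector_derivative beta_kernel \<mu> (s - c)) (at s)"
    by (simp add: has_real_derivative_iff_has_vector_derivative)
qed

text \<open>The second central difference of the second primitive of the kernel, continued by \<open>0\<close> to negative arguments: for \<open>m = 0\<close> the
  truncated \<open>m - 1\<close> and the value \<open>0\<close> of the kernel at \<open>0\<close> give the continuation.\<close>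

definition lag_weight :: "real \<Rightarrow> real \<Rightarrow> nat \<Rightarrow> real" where
  "lag_weight p \<tau> m = beta_kernel (2+p) (real (Suc m) * \<tau>) - 2 * beta_kernel (2+p) (real m * \<tau>)
     + beta_kernel (2+p) (real (m - 1) * \<tau>)"

text \<open>Each of the two integrations raises the order of the kernel by one, so the weights depend on \<open>n - j\<close> only.\<close>

lemma lambda_coef_eq_lag_weight:
  assumes "0 < p" "0 < \<tau>" "1 \<le> j" "j \<le> n"
  shows "\<tau> * lambda_coef p \<tau> n j = lag_weight p \<tau> (n - j)"
proof -
  define a b where "a = real (j - 1) * \<tau>" and "b = real j * \<tau>"
  define c d where "c = real (n - 1) * \<tau>" and "d = real n * \<tau>"
  have le: "a \<le> b" "a \<le> c" "c \<le> d"
    using assms unfolding a_def b_def c_def d_def by (auto intro!: mult_right_mono)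
  have one: "2 + p = 1 + (1 + p)" by simp
  have inner: "integral {a..min t b} (\<lambda>s. beta_kernel p (t - s))
      = beta_kernel (1+p) (t - a) - beta_kernel (1+p) (t - min t b)" if "t \<in> {c..d}" for t
    using that le assms by (intro integral_unique beta_kernel_integral_reflected) auto
  have "((\<lambda>t. beta_kernel (1+p) (t - a) - beta_kernel (1+p) (t - min t b)) has_integral lag_weight p \<tau> (n - j)) {c..d}"
  proof (cases "j = n")
    case True
    then have "((\<lambda>t. beta_kernel (1+p) (t - a)) has_integral lag_weight p \<tau> (n - j)) {c..d}"
      using beta_kernel_integral[of "1+p" a c d] le assms
      by (simp add: lag_weight_def a_def c_def d_def one of_nat_diff algebra_simps)
    then show ?thesis
      by (rule has_integral_eq[rotated]) (use True in \<open>auto simp: b_def d_def min_def\<close>)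
  next
    case False
    then have n: "n = Suc (n - 1)" "j \<le> n - 1" using assms by auto
    then have bc: "b \<le> c" using assms by (auto simp: b_def c_def intro!: mult_right_mono)
    have "((\<lambda>t. beta_kernel (1+p) (t - a) - beta_kernel (1+p) (t - b)) has_integral lag_weight p \<tau> (n - j)) {c..d}"
      using has_integral_diff[OF beta_kernel_integral[of "1+p" a c d] beta_kernel_integral[of "1+p" b c d]]
        le assms bc n
      by (simp add: lag_weight_def a_def b_def c_def d_def one of_nat_diff algebra_simps)
    then show ?thesis
      by (rule has_integral_eq[rotated]) (use bc in \<open>auto simp: min_absorb2\<close>)
  qed
  then have "integral {c..d} (\<lambda>t. beta_kernel (1+p) (t - a) - beta_kernel (1+p) (t - min t b)) = lag_weight p \<tau> (n - j)"
    by (rule integral_unique)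
  moreover have "lambda_coef p \<tau> n j = 1 / \<tau> * integral {c..d} (\<lambda>t. beta_kernel (1+p) (t - a) - beta_kernel (1+p) (t - min t b))"
    unfolding lambda_coef_def a_def[symmetric] b_def[symmetric] c_def[symmetric] d_def[symmetric]
    by (intro arg_cong[where f = "\<lambda>x. 1 / \<tau> * x"] integral_cong inner)
  ultimately show ?thesis using assms by simp
qed

text \<open>The factor \<open>1/2\<close> on the diagonal appears because the integration domain \<open>s \<le> t\<close> covers only half of a diagonal cell.\<close>

lemma lag_weight_eq_power_lag:
  assumes "0 < p" "0 < \<tau>"
  shows "lag_weight p \<tau> m
    = \<tau> powr (1+p) / Gamma (2+p) * (if m = 0 then power_lag (1+p) 0 / 2 else power_lag (1+p) m)"
proof (cases m)
  case 0
  then show ?thesis by (simp add: lag_weight_def beta_kernel_def power_lag_def)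
next
  case (Suc k)
  have B: "beta_kernel (2+p) (real l * \<tau>) = \<tau> powr (1+p) / Gamma (2+p) * real l powr (1+p)" for l
    using assms by (simp add: beta_kernel_def powr_mult add.commute)
  have "\<bar>real m - 1\<bar> = real k" "m - 1 = k" "m \<noteq> 0" "real (Suc m) = real m + 1" by (auto simp: Suc)
  then show ?thesis
    unfolding lag_weight_def power_lag_def B by (simp add: right_diff_distrib distrib_left add.commute)
qed

lemma lag_weight_nonneg: "0 < p \<Longrightarrow> p < 1 \<Longrightarrow> 0 < \<tau> \<Longrightarrow> 0 \<le> lag_weight p \<tau> m"
  using power_lag_nonneg[of p] by (auto simp: lag_weight_eq_power_lag Gamma_real_pos less_imp_le)

lemma lag_weight_sum: "(\<Sum>m<k. lag_weight p \<tau> m) = beta_kernel (2+p) (real k * \<tau>) - beta_kernel (2+p) (real (k-1) * \<tau>)"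
  by (induction k) (auto simp: lag_weight_def)

lemma lag_weight_sum_le:
  assumes "0 < p" "0 < \<tau>" "real k * \<tau> \<le> T"
  shows "(\<Sum>m<k. lag_weight p \<tau> m) \<le> \<tau> * beta_kernel (1+p) T"
proof (cases k)
  case 0
  then show ?thesis using assms beta_kernel_nonneg[of "1+p" T] by simp
next
  case (Suc l)
  let ?B = "beta_kernel (2+p)"
  have one: "2 + p = 1 + (1 + p)" by simp
  have k: "real k * \<tau> = real l * \<tau> + \<tau>" by (simp add: Suc algebra_simps)
  have l: "0 \<le> real l * \<tau>" using assms by simp
  obtain z where z: "real l * \<tau> < z" "z < real k * \<tau>"
      "?B (real k * \<tau>) - ?B (real l * \<tau>) = (real k * \<tau> - real l * \<tau>) * beta_kernel (1+p) z"
  proof (rule mean_value_real[of "real l * \<tau>" "real k * \<tau>" ?B])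
    show "real l * \<tau> < real k * \<tau>" using k assms by simp
    show "continuous_on {real l * \<tau>..real k * \<tau>} ?B"
      using assms l by (intro beta_kernel_continuous continuous_intros) (auto intro: order_trans[OF l])
    show "(?B has_real_derivative beta_kernel (1+p) s) (at s)" if "real l * \<tau> < s" for s
    proof -
      have "0 < s" using le_less_trans[OF l that] .
      then show ?thesis unfolding one using assms(1) by (intro beta_kernel_derivative) auto
    qed
  qed
  have "beta_kernel (1+p) z \<le> beta_kernel (1+p) T"
    using z le_less_trans[OF l z(1)] assms by (intro beta_kernel_mono) auto
  then have "\<tau> * beta_kernel (1+p) z \<le> \<tau> * beta_kernel (1+p) T" using assms by simp
  with z(3) k show ?thesis unfolding lag_weight_sum by (simp add: Suc)
qed

text \<open>The halved diagonal is exactly what turns the lower triangular form into half of the symmetric Toeplitz form.\<close>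

lemma lag_weight_positive_type:
  assumes p: "0 < p" "p < 1" and \<tau>: "0 < \<tau>"
  shows "0 \<le> (\<Sum>n=1..m. \<Sum>j=1..n. lag_weight p \<tau> (n - j) * z j * z n)"
proof -
  define C where "C = \<tau> powr (1+p) / Gamma (2+p)"
  have C: "0 \<le> C" using p by (simp add: C_def Gamma_real_pos less_imp_le)
  define y where "y = (\<lambda>i. z (Suc i))"
  have "(\<Sum>n=1..m. \<Sum>j=1..n. lag_weight p \<tau> (n - j) * z j * z n)
      = (\<Sum>n<m. \<Sum>j\<le>n. lag_weight p \<tau> (n - j) * y j * y n)"
  proof -
    have "(\<Sum>j=1..Suc n. lag_weight p \<tau> (Suc n - j) * z j * z (Suc n))
        = (\<Sum>j\<le>n. lag_weight p \<tau> (n - j) * y j * y n)" for n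
      unfolding y_def One_nat_def sum.shift_bounds_cl_Suc_ivl by (simp add: atMost_atLeast0)
    moreover have "{1..m} = Suc ` {..<m}" by (simp add: lessThan_atLeast0 image_Suc_atLeastLessThan atLeastLessThanSuc_atLeastAtMost)
    ultimately show ?thesis by (simp add: sum.reindex)
  qed
  also have "\<dots> = C * (\<Sum>n<m. \<Sum>j\<le>n. (if n = j then power_lag (1+p) 0 / 2 else power_lag (1+p) (n - j)) * y j * y n)"
    unfolding sum_distrib_left using p \<tau>
    by (intro sum.cong refl) (auto simp: lag_weight_eq_power_lag C_def)
  also have "\<dots> = C / 2 * (\<Sum>i<m. \<Sum>j<m. power_lag (1+p) ((i - j) + (j - i)) * y i * y j)"
    by (subst lower_triangular_to_symmetric) simp
  also have "\<dots> \<ge> 0"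
    using C p by (intro mult_nonneg_nonneg toeplitz_convex_psd power_lag_nonneg power_lag_decreasing power_lag_convex) auto
  finally show ?thesis .
qed

section \<open>The compact difference operators on the grid\<close>

definition vanishes_on_bd :: "nat \<Rightarrow> nat \<Rightarrow> gridfun \<Rightarrow> bool" where
  "vanishes_on_bd Mx My v \<longleftrightarrow> (\<forall>(i, j)\<in>grid_bd Mx My. v i j = 0)"

definition grid_ip :: "nat \<Rightarrow> nat \<Rightarrow> gridfun \<Rightarrow> gridfun \<Rightarrow> real" where
  "grid_ip Mx My v w = (\<Sum>i\<in>{0<..<Mx}. \<Sum>j\<in>{0<..<My}. v i j * w i j)"

text \<open>The discrete norm without the factor \<open>sqrt (Hx * Hy)\<close>, which cancels in the energy argument.\<close>

definition grid_l2 :: "nat \<Rightarrow> nat \<Rightarrow> gridfun \<Rightarrow> real" where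
  "grid_l2 Mx My v = L2_set (\<lambda>(i, j). v i j) (grid_int Mx My)"

lemma vanishes_on_bdD:
  assumes "vanishes_on_bd Mx My v"
  shows "j \<le> My \<Longrightarrow> v 0 j = 0" "j \<le> My \<Longrightarrow> v Mx j = 0" "i \<le> Mx \<Longrightarrow> v i 0 = 0" "i \<le> Mx \<Longrightarrow> v i My = 0"
  using assms by (auto simp: vanishes_on_bd_def grid_bd_def grid_int_def)

lemma sum_shift_periodic:
  fixes h :: "nat \<Rightarrow> real"
  assumes "h 0 = h M" shows "(\<Sum>i<M. h (Suc i)) = (\<Sum>i<M. h i)"
  using sum.lessThan_Suc_shift[of h M] assms by simp

lemma sum_interior:
  fixes h :: "nat \<Rightarrow> real"
  assumes "h 0 = 0" shows "(\<Sum>i\<in>{0<..<M}. h i) = (\<Sum>i<M. h i)"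
  by (rule sum.mono_neutral_left) (use assms gr0I in auto)

text \<open>Writing \<open>10 = 8 + 2\<close> and giving one half of the \<open>2\<close> to each neighbour turns the three-point average into a form that is
  visibly symmetric and positive.\<close>

lemma compact_average_form:
  fixes v w :: "nat \<Rightarrow> real"
  assumes "v 0 = 0" "v M = 0" "w 0 = 0" "w M = 0"
  shows "(\<Sum>i\<in>{0<..<M}. (v (i - 1) + 10 * v i + v (i + 1)) / 12 * w i)
    = 2/3 * (\<Sum>i\<in>{0<..<M}. v i * w i) + 1/12 * (\<Sum>i<M. (v i + v (i + 1)) * (w i + w (i + 1)))"
proof -
  have "(\<Sum>i<M. v (Suc i) * w (Suc i)) = (\<Sum>i<M. v i * w i)"
    using sum_shift_periodic[of "\<lambda>i. v i * w i" M] assms by simp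
  moreover have "(\<Sum>i<M. v i * w (Suc i)) = (\<Sum>i<M. v (i - 1) * w i)"
    using sum_shift_periodic[of "\<lambda>i. v (i - 1) * w i" M] assms by simp
  ultimately show ?thesis
    using assms by (simp add: sum_interior sum.distrib distrib_left distrib_right add_divide_distrib
        sum_divide_distrib[symmetric] sum_distrib_left[symmetric] mult.assoc)
qed

lemma second_difference_form:
  fixes v w :: "nat \<Rightarrow> real"
  assumes "v 0 = 0" "v M = 0" "w 0 = 0" "w M = 0"
  shows "(\<Sum>i\<in>{0<..<M}. (v (i + 1) - 2 * v i + v (i - 1)) * w i)
    = - (\<Sum>i<M. (v (i + 1) - v i) * (w (i + 1) - w i))"
proof -
  have "(\<Sum>i<M. v (Suc i) * w (Suc i)) = (\<Sum>i<M. v i * w i)"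
    using sum_shift_periodic[of "\<lambda>i. v i * w i" M] assms by simp
  moreover have "(\<Sum>i<M. v i * w (Suc i)) = (\<Sum>i<M. v (i - 1) * w i)"
    using sum_shift_periodic[of "\<lambda>i. v (i - 1) * w i" M] assms by simp
  ultimately show ?thesis
    using assms by (simp add: sum_interior sum.distrib sum_subtractf distrib_left distrib_right
        left_diff_distrib right_diff_distrib sum_distrib_left[symmetric] mult.assoc)
qed

text \<open>Jensen's inequality for the average, followed by summation; the weights that reach a given node add up to at most one.\<close>

lemma compact_average_square:
  fixes v :: "nat \<Rightarrow> real"
  assumes "v 0 = 0" "v M = 0"
  shows "(\<Sum>i\<in>{0<..<M}. ((v (i - 1) + 10 * v i + v (i + 1)) / 12)\<^sup>2) \<le> (\<Sum>i\<in>{0<..<M}. (v i)\<^sup>2)"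
proof -
  define q where "q = (\<lambda>i. (v i)\<^sup>2)"
  have q0: "q 0 = 0" "q M = 0" using assms by (auto simp: q_def)
  have 1: "(\<Sum>i\<in>{0<..<M}. q (i - 1)) \<le> (\<Sum>i<M. q i)"
  proof -
    have "(\<Sum>i\<in>{0<..<M}. q (i - 1)) \<le> (\<Sum>i\<in>Suc ` {..<M}. q (i - 1))"
    proof (rule sum_mono2)
      show "{0<..<M} \<subseteq> Suc ` {..<M}" using gr0_conv_Suc by fastforce
    qed (auto simp: q_def)
    also have "\<dots> = (\<Sum>i<M. q i)" by (simp add: sum.reindex)
    finally show ?thesis .
  qed
  have 2: "(\<Sum>i\<in>{0<..<M}. q (i + 1)) \<le> (\<Sum>i<M. q i)"
  proof -
    have "(\<Sum>i\<in>{0<..<M}. q (i + 1)) \<le> (\<Sum>i<M. q (Suc i))"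
      by (auto intro!: sum_mono2 simp: q_def)
    also have "\<dots> = (\<Sum>i<M. q i)" using q0 by (intro sum_shift_periodic) auto
    finally show ?thesis .
  qed
  have "((a + 10 * b + c) / 12)\<^sup>2 \<le> (a\<^sup>2 + 10 * b\<^sup>2 + c\<^sup>2) / 12" for a b c :: real
  proof -
    have "(a\<^sup>2 + 10 * b\<^sup>2 + c\<^sup>2) / 12 - ((a + 10 * b + c) / 12)\<^sup>2 = (10 * (a - b)\<^sup>2 + (a - c)\<^sup>2 + 10 * (b - c)\<^sup>2) / 144"
      by (simp add: power2_eq_square field_simps)
    also have "\<dots> \<ge> 0" by simp
    finally show ?thesis by simp
  qed
  then have "(\<Sum>i\<in>{0<..<M}. ((v (i - 1) + 10 * v i + v (i + 1)) / 12)\<^sup>2)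
      \<le> (\<Sum>i\<in>{0<..<M}. (q (i - 1) + 10 * q i + q (i + 1)) / 12)"
    unfolding q_def by (intro sum_mono) auto
  also have "\<dots> = ((\<Sum>i\<in>{0<..<M}. q (i - 1)) + 10 * (\<Sum>i\<in>{0<..<M}. q i) + (\<Sum>i\<in>{0<..<M}. q (i + 1))) / 12"
    by (simp add: sum.distrib sum_distrib_left sum_divide_distrib add_divide_distrib)
  also have "\<dots> \<le> (\<Sum>i\<in>{0<..<M}. q i)"
    using 1 2 q0 by (simp add: sum_interior)
  finally show ?thesis by (simp add: q_def)
qed

lemma grid_ip_swap: "grid_ip Mx My v w = (\<Sum>j\<in>{0<..<My}. \<Sum>i\<in>{0<..<Mx}. v i j * w i j)"
  unfolding grid_ip_def by (rule sum.swap)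

lemma grid_ip_pairs: "grid_ip Mx My v w = (\<Sum>(i, j)\<in>grid_int Mx My. v i j * w i j)"
  by (simp add: grid_ip_def grid_int_def sum.cartesian_product)

lemma grid_l2_square: "(grid_l2 Mx My v)\<^sup>2 = grid_ip Mx My v v"
  by (simp add: grid_l2_def L2_set_def grid_ip_pairs case_prod_unfold sum_nonneg power2_eq_square)

lemma grid_l2_nonneg: "0 \<le> grid_l2 Mx My v"
  by (simp add: grid_l2_def)

lemma grid_norm_eq_l2: "0 \<le> Hx \<Longrightarrow> 0 \<le> Hy \<Longrightarrow> grid_norm Mx My Hx Hy v = sqrt (Hx * Hy) * grid_l2 Mx My v"
  by (simp add: grid_norm_def grid_l2_def L2_set_def case_prod_unfold real_sqrt_mult)

lemma grid_ip_cauchy_schwarz: "\<bar>grid_ip Mx My v w\<bar> \<le> grid_l2 Mx My v * grid_l2 Mx My w"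
proof -
  have "\<bar>grid_ip Mx My v w\<bar> \<le> (\<Sum>p\<in>grid_int Mx My. \<bar>(\<lambda>(i, j). v i j) p\<bar> * \<bar>(\<lambda>(i, j). w i j) p\<bar>)"
    unfolding grid_ip_pairs by (rule order_trans[OF sum_abs]) (simp add: case_prod_unfold abs_mult)
  also have "\<dots> \<le> grid_l2 Mx My v * grid_l2 Mx My w"
    unfolding grid_l2_def by (rule L2_set_mult_ineq)
  finally show ?thesis .
qed

lemma grid_l2_triangle: "grid_l2 Mx My (\<lambda>i j. v i j + w i j) \<le> grid_l2 Mx My v + grid_l2 Mx My w"
  unfolding grid_l2_def
  using L2_set_triangle_ineq[of "\<lambda>(i, j). v i j" "\<lambda>(i, j). w i j" "grid_int Mx My"]
  by (simp add: case_prod_unfold)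

lemma grid_l2_scale: "grid_l2 Mx My (\<lambda>i j. c * v i j) = \<bar>c\<bar> * grid_l2 Mx My v"
  unfolding grid_l2_def L2_set_def
  by (simp add: case_prod_unfold power_mult_distrib sum_distrib_left[symmetric] real_sqrt_mult)

lemma grid_l2_mono:
  assumes "\<And>i j. (i, j) \<in> grid_int Mx My \<Longrightarrow> \<bar>v i j\<bar> \<le> \<bar>w i j\<bar>"
  shows "grid_l2 Mx My v \<le> grid_l2 Mx My w"
  unfolding grid_l2_def L2_set_def using assms
  by (intro real_sqrt_le_mono sum_mono) (auto simp: abs_le_square_iff)

lemma Ay_vanishes:
  assumes "vanishes_on_bd Mx My v" "j \<le> My"
  shows "Ay My v 0 j = 0" "Ay My v Mx j = 0"
  using assms by (auto simp: Ay_def vanishes_on_bdD)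

text \<open>The product of the one-dimensional identities in \<open>x\<close> and \<open>y\<close>; the coefficients are the products of \<open>2/3\<close> and \<open>1/12\<close>. Symmetry
  and coercivity of \<open>A\<close> are read off.\<close>

lemma A_op_form:
  assumes v: "vanishes_on_bd Mx My v" and w: "vanishes_on_bd Mx My w"
  shows "grid_ip Mx My (A_op Mx My v) w = 4/9 * grid_ip Mx My v w
    + 1/18 * (\<Sum>i\<in>{0<..<Mx}. \<Sum>j<My. (v i j + v i (j+1)) * (w i j + w i (j+1)))
    + 1/18 * (\<Sum>i<Mx. \<Sum>j\<in>{0<..<My}. (v i j + v (i+1) j) * (w i j + w (i+1) j))
    + 1/144 * (\<Sum>i<Mx. \<Sum>j<My. ((v i j + v (i+1) j) + (v i (j+1) + v (i+1) (j+1)))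
        * ((w i j + w (i+1) j) + (w i (j+1) + w (i+1) (j+1))))"
proof -
  have y: "(\<Sum>j\<in>{0<..<My}. Ay My v i j * w i j)
     = 2/3 * (\<Sum>j\<in>{0<..<My}. v i j * w i j) + 1/12 * (\<Sum>j<My. (v i j + v i (j+1)) * (w i j + w i (j+1)))"
    if "i \<in> {0<..<Mx}" for i
    using compact_average_form[of "v i" My "w i"] vanishes_on_bdD[OF v] vanishes_on_bdD[OF w] that
    by (simp add: Ay_def)
  have y2: "(\<Sum>j\<in>{0<..<My}. (Ay My v i j + Ay My v (i+1) j) * (w i j + w (i+1) j))
     = 2/3 * (\<Sum>j\<in>{0<..<My}. (v i j + v (i+1) j) * (w i j + w (i+1) j))
      + 1/12 * (\<Sum>j<My. ((v i j + v (i+1) j) + (v i (j+1) + v (i+1) (j+1)))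
        * ((w i j + w (i+1) j) + (w i (j+1) + w (i+1) (j+1))))"
    if "i < Mx" for i
  proof -
    have "(\<Sum>j\<in>{0<..<My}. (Ay My v i j + Ay My v (i+1) j) * (w i j + w (i+1) j))
      = (\<Sum>j\<in>{0<..<My}. ((v i (j - 1) + v (i+1) (j - 1)) + 10 * (v i j + v (i+1) j) + (v i (j + 1) + v (i+1) (j + 1))) / 12
          * (w i j + w (i+1) j))"
      by (intro sum.cong refl arg_cong2[where f = "(*)"]) (simp add: Ay_def field_simps)
    then show ?thesis
      using compact_average_form[of "\<lambda>j. v i j + v (i+1) j" My "\<lambda>j. w i j + w (i+1) j"]
        vanishes_on_bdD[OF v] vanishes_on_bdD[OF w] that
      by simp
  qed
  have "grid_ip Mx My (A_op Mx My v) w = (\<Sum>j\<in>{0<..<My}. \<Sum>i\<in>{0<..<Mx}.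
      (Ay My v (i - 1) j + 10 * Ay My v i j + Ay My v (i + 1) j) / 12 * w i j)"
    unfolding grid_ip_swap A_op_def by (intro sum.cong refl) (simp add: Ax_def)
  also have "\<dots> = (\<Sum>j\<in>{0<..<My}. 2/3 * (\<Sum>i\<in>{0<..<Mx}. Ay My v i j * w i j)
      + 1/12 * (\<Sum>i<Mx. (Ay My v i j + Ay My v (i+1) j) * (w i j + w (i+1) j)))"
    by (intro sum.cong refl compact_average_form) (auto simp: Ay_vanishes[OF v] vanishes_on_bdD[OF w])
  also have "\<dots> = 2/3 * (\<Sum>i\<in>{0<..<Mx}. \<Sum>j\<in>{0<..<My}. Ay My v i j * w i j)
      + 1/12 * (\<Sum>i<Mx. \<Sum>j\<in>{0<..<My}. (Ay My v i j + Ay My v (i+1) j) * (w i j + w (i+1) j))"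
    by (simp add: sum.distrib sum_distrib_left sum.swap[of _ "{0<..<My}"])
  also have "(\<Sum>i\<in>{0<..<Mx}. \<Sum>j\<in>{0<..<My}. Ay My v i j * w i j) = 2/3 * grid_ip Mx My v w
      + 1/12 * (\<Sum>i\<in>{0<..<Mx}. \<Sum>j<My. (v i j + v i (j+1)) * (w i j + w i (j+1)))"
    by (simp add: y grid_ip_def sum.distrib sum_distrib_left)
  also have "(\<Sum>i<Mx. \<Sum>j\<in>{0<..<My}. (Ay My v i j + Ay My v (i+1) j) * (w i j + w (i+1) j))
      = 2/3 * (\<Sum>i<Mx. \<Sum>j\<in>{0<..<My}. (v i j + v (i+1) j) * (w i j + w (i+1) j))
      + 1/12 * (\<Sum>i<Mx. \<Sum>j<My. ((v i j + v (i+1) j) + (v i (j+1) + v (i+1) (j+1)))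
        * ((w i j + w (i+1) j) + (w i (j+1) + w (i+1) (j+1))))"
    using y2 by (simp add: sum.distrib sum_distrib_left)
  finally show ?thesis by (simp add: add_divide_distrib)
qed

lemma A_op_symmetric:
  assumes "vanishes_on_bd Mx My v" "vanishes_on_bd Mx My w"
  shows "grid_ip Mx My (A_op Mx My v) w = grid_ip Mx My (A_op Mx My w) v"
  unfolding A_op_form[OF assms] A_op_form[OF assms(2,1)] by (simp add: grid_ip_def mult.commute)

lemma A_op_coercive:
  assumes "vanishes_on_bd Mx My v"
  shows "4/9 * (grid_l2 Mx My v)\<^sup>2 \<le> grid_ip Mx My (A_op Mx My v) v"
  unfolding A_op_form[OF assms assms] grid_l2_square by (simp add: sum_nonneg)

lemma A_op_bounded:
  assumes v: "vanishes_on_bd Mx My v"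
  shows "grid_l2 Mx My (A_op Mx My v) \<le> grid_l2 Mx My v"
proof (rule power2_le_imp_le[OF _ grid_l2_nonneg])
  have "(grid_l2 Mx My (A_op Mx My v))\<^sup>2 = (\<Sum>j\<in>{0<..<My}. \<Sum>i\<in>{0<..<Mx}.
      ((Ay My v (i - 1) j + 10 * Ay My v i j + Ay My v (i + 1) j) / 12)\<^sup>2)"
    unfolding grid_l2_square grid_ip_swap A_op_def
    by (intro sum.cong refl) (simp add: Ax_def power2_eq_square)
  also have "\<dots> \<le> (\<Sum>j\<in>{0<..<My}. \<Sum>i\<in>{0<..<Mx}. (Ay My v i j)\<^sup>2)"
    by (intro sum_mono compact_average_square) (auto simp: Ay_vanishes[OF v])
  also have "\<dots> = (\<Sum>i\<in>{0<..<Mx}. \<Sum>j\<in>{0<..<My}. ((v i (j - 1) + 10 * v i j + v i (j + 1)) / 12)\<^sup>2)"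
    by (subst sum.swap) (simp add: Ay_def)
  also have "\<dots> \<le> (\<Sum>i\<in>{0<..<Mx}. \<Sum>j\<in>{0<..<My}. (v i j)\<^sup>2)"
    by (intro sum_mono compact_average_square) (auto simp: vanishes_on_bdD[OF v])
  finally show "(grid_l2 Mx My (A_op Mx My v))\<^sup>2 \<le> (grid_l2 Mx My v)\<^sup>2"
    unfolding grid_l2_square[of Mx My v] by (simp add: grid_ip_def power2_eq_square)
qed

lemma Ay_delta2x_commute:
  "Ay My (delta2x Hx v) i j = 1 / Hx\<^sup>2 * (Ay My v (i + 1) j - 2 * Ay My v i j + Ay My v (i - 1) j)"
  by (simp add: Ay_def delta2x_def add_divide_distrib diff_divide_distrib distrib_left)

text \<open>Summation by parts in \<open>x\<close>, then the identity for the average in \<open>y\<close> applied to the differences: minus this operator is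
  a sum of squares of linear functionals.\<close>

lemma Ay_delta2x_form:
  assumes v: "vanishes_on_bd Mx My v" and w: "vanishes_on_bd Mx My w"
  shows "grid_ip Mx My (Ay My (delta2x Hx v)) w = - (1 / Hx\<^sup>2 *
    (2/3 * (\<Sum>i<Mx. \<Sum>j\<in>{0<..<My}. (v (i+1) j - v i j) * (w (i+1) j - w i j))
    + 1/12 * (\<Sum>i<Mx. \<Sum>j<My. ((v (i+1) j - v i j) + (v (i+1) (j+1) - v i (j+1)))
        * ((w (i+1) j - w i j) + (w (i+1) (j+1) - w i (j+1))))))"
proof -
  have "grid_ip Mx My (Ay My (delta2x Hx v)) w = 1 / Hx\<^sup>2 * (\<Sum>j\<in>{0<..<My}. \<Sum>i\<in>{0<..<Mx}.
      (Ay My v (i + 1) j - 2 * Ay My v i j + Ay My v (i - 1) j) * w i j)"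
    unfolding grid_ip_swap sum_distrib_left
    by (intro sum.cong refl) (simp add: Ay_delta2x_commute)
  also have "(\<Sum>j\<in>{0<..<My}. \<Sum>i\<in>{0<..<Mx}.
      (Ay My v (i + 1) j - 2 * Ay My v i j + Ay My v (i - 1) j) * w i j)
    = (\<Sum>j\<in>{0<..<My}. - (\<Sum>i<Mx. (Ay My v (i+1) j - Ay My v i j) * (w (i+1) j - w i j)))"
    by (intro sum.cong refl second_difference_form) (auto simp: Ay_vanishes[OF v] vanishes_on_bdD[OF w])
  also have "\<dots> = - (\<Sum>i<Mx. \<Sum>j\<in>{0<..<My}. (Ay My v (i+1) j - Ay My v i j) * (w (i+1) j - w i j))"
    by (simp add: sum_negf sum.swap[of _ "{0<..<My}"])
  also have "(\<Sum>i<Mx. \<Sum>j\<in>{0<..<My}. (Ay My v (i+1) j - Ay My v i j) * (w (i+1) j - w i j))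
    = (\<Sum>i<Mx. 2/3 * (\<Sum>j\<in>{0<..<My}. (v (i+1) j - v i j) * (w (i+1) j - w i j))
      + 1/12 * (\<Sum>j<My. ((v (i+1) j - v i j) + (v (i+1) (j+1) - v i (j+1)))
        * ((w (i+1) j - w i j) + (w (i+1) (j+1) - w i (j+1)))))"
  proof (rule sum.cong[OF refl])
    fix i assume "i \<in> {..<Mx}"
    have "(\<Sum>j\<in>{0<..<My}. (Ay My v (i+1) j - Ay My v i j) * (w (i+1) j - w i j))
      = (\<Sum>j\<in>{0<..<My}. ((v (i+1) (j - 1) - v i (j - 1)) + 10 * (v (i+1) j - v i j) + (v (i+1) (j + 1) - v i (j + 1))) / 12
          * (w (i+1) j - w i j))"
      by (intro sum.cong refl arg_cong2[where f = "(*)"]) (simp add: Ay_def field_simps)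
    then show "(\<Sum>j\<in>{0<..<My}. (Ay My v (i+1) j - Ay My v i j) * (w (i+1) j - w i j)) =
      2/3 * (\<Sum>j\<in>{0<..<My}. (v (i+1) j - v i j) * (w (i+1) j - w i j))
      + 1/12 * (\<Sum>j<My. ((v (i+1) j - v i j) + (v (i+1) (j+1) - v i (j+1)))
        * ((w (i+1) j - w i j) + (w (i+1) (j+1) - w i (j+1))))"
      using compact_average_form[of "\<lambda>j. v (i+1) j - v i j" My "\<lambda>j. w (i+1) j - w i j"]
        vanishes_on_bdD[OF v] vanishes_on_bdD[OF w] \<open>i \<in> {..<Mx}\<close>
      by simp
  qed
  finally show ?thesis by (simp only: sum.distrib sum_distrib_left mult_minus_right)
qed

lemma Ax_delta2y_transpose:
  "grid_ip Mx My (Ax Mx (delta2y Hy v)) w = grid_ip My Mx (Ay Mx (delta2x Hy (\<lambda>j i. v i j))) (\<lambda>j i. w i j)"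
  unfolding grid_ip_def[of My] grid_ip_swap[of Mx]
  by (intro sum.cong refl) (simp add: Ax_def Ay_def delta2x_def delta2y_def)

lemma vanishes_on_bd_transpose: "vanishes_on_bd Mx My v \<Longrightarrow> vanishes_on_bd My Mx (\<lambda>j i. v i j)"
  by (auto simp: vanishes_on_bd_def grid_bd_def grid_int_def)

text \<open>The notion is stated for forms on a set \<open>V\<close> of grid functions, since \<open>-\<Lambda>\<close> is a sum of squares only for functions vanishing on the
  boundary; it is stable under sums and nonnegative multiples.\<close>

definition positive_type :: "real \<Rightarrow> real \<Rightarrow> gridfun set \<Rightarrow> (gridfun \<Rightarrow> gridfun \<Rightarrow> real) \<Rightarrow> bool" where
  "positive_type p \<tau> V B \<longleftrightarrow> (\<forall>m \<phi>. (\<forall>n. \<phi> n \<in> V) \<longrightarrow>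
     0 \<le> (\<Sum>n=1..m. \<Sum>j=1..n. lag_weight p \<tau> (n - j) * B (\<phi> j) (\<phi> n)))"

lemma positive_type_product:
  assumes "0 < p" "p < 1" "0 < \<tau>"
  shows "positive_type p \<tau> V (\<lambda>v w. l v * l w)"
  unfolding positive_type_def
  using lag_weight_positive_type[OF assms, of "\<lambda>n. l (_ n)"] by (auto simp: mult.assoc)

lemma positive_type_add:
  "positive_type p \<tau> V B \<Longrightarrow> positive_type p \<tau> V C \<Longrightarrow> positive_type p \<tau> V (\<lambda>v w. B v w + C v w)"
  unfolding positive_type_def by (auto simp: distrib_left sum.distrib intro!: add_nonneg_nonneg)

lemma positive_type_scale:
  assumes "positive_type p \<tau> V B" "0 \<le> c" shows "positive_type p \<tau> V (\<lambda>v w. c * B v w)"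
proof -
  have "(\<Sum>n=1..m. \<Sum>j=1..n. lag_weight p \<tau> (n - j) * (c * B (\<phi> j) (\<phi> n)))
     = c * (\<Sum>n=1..m. \<Sum>j=1..n. lag_weight p \<tau> (n - j) * B (\<phi> j) (\<phi> n))" for m \<phi>
    by (simp add: sum_distrib_left mult_ac)
  with assms show ?thesis by (simp add: positive_type_def)
qed

lemma positive_type_sum:
  assumes "\<And>x. x \<in> I \<Longrightarrow> positive_type p \<tau> V (B x)"
  shows "positive_type p \<tau> V (\<lambda>v w. \<Sum>x\<in>I. B x v w)"
proof -
  have "positive_type p \<tau> V (\<lambda>v w. 0)" by (simp add: positive_type_def)
  then show ?thesis using assms
    by (induction I rule: infinite_finite_induct) (auto intro!: positive_type_add)
qed

lemma positive_type_cong: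
  assumes "positive_type p \<tau> V B" "\<And>v w. v \<in> V \<Longrightarrow> w \<in> V \<Longrightarrow> B v w = C v w"
  shows "positive_type p \<tau> V C"
  using assms by (simp add: positive_type_def)

lemma Lambda_op_positive_type:
  assumes "0 < p" "p < 1" "0 < \<tau>"
  shows "positive_type p \<tau> {v. vanishes_on_bd Mx My v} (\<lambda>v w. - grid_ip Mx My (Lambda_op Mx My Hx Hy v) w)"
proof -
  note forms = positive_type_scale positive_type_add positive_type_sum
    positive_type_product[OF assms, where V = "{v. vanishes_on_bd Mx My v}"]
  have x: "positive_type p \<tau> {v. vanishes_on_bd Mx My v} (\<lambda>v w. - grid_ip Mx My (Ay My (delta2x Hx v)) w)"
    by (rule positive_type_cong[where B = "\<lambda>v w. 1 / Hx\<^sup>2 *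
    (2/3 * (\<Sum>i<Mx. \<Sum>j\<in>{0<..<My}. (v (i+1) j - v i j) * (w (i+1) j - w i j))
    + 1/12 * (\<Sum>i<Mx. \<Sum>j<My. ((v (i+1) j - v i j) + (v (i+1) (j+1) - v i (j+1)))
        * ((w (i+1) j - w i j) + (w (i+1) (j+1) - w i (j+1)))))"], intro forms)
      (auto simp: Ay_delta2x_form)
  have y: "positive_type p \<tau> {v. vanishes_on_bd Mx My v} (\<lambda>v w. - grid_ip Mx My (Ax Mx (delta2y Hy v)) w)"
    unfolding Ax_delta2y_transpose
    by (rule positive_type_cong[where B = "\<lambda>v w. 1 / Hy\<^sup>2 *
    (2/3 * (\<Sum>i<My. \<Sum>j\<in>{0<..<Mx}. (v j (i+1) - v j i) * (w j (i+1) - w j i))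
    + 1/12 * (\<Sum>i<My. \<Sum>j<Mx. ((v j (i+1) - v j i) + (v (j+1) (i+1) - v (j+1) i))
        * ((w j (i+1) - w j i) + (w (j+1) (i+1) - w (j+1) i))))"], intro forms)
      (auto simp: Ay_delta2x_form vanishes_on_bd_transpose)
  have "grid_ip Mx My (Lambda_op Mx My Hx Hy v) w
      = grid_ip Mx My (Ay My (delta2x Hx v)) w + grid_ip Mx My (Ax Mx (delta2y Hy v)) w" for v w
    by (simp add: grid_ip_def Lambda_op_def distrib_right sum.distrib)
  with positive_type_add[OF x y] show ?thesis by simp
qed

section \<open>Discrete energy estimate\<close>

lemma discrete_gronwall:
  fixes X :: "nat \<Rightarrow> real"
  assumes a: "0 \<le> a" and step: "\<And>m. m \<le> N \<Longrightarrow> X m \<le> a * (\<Sum>n<m. X n) + b" and "m \<le> N"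
  shows "X m \<le> b * (1 + a) ^ m"
  using \<open>m \<le> N\<close>
proof (induction m rule: less_induct)
  case (less m)
  have geom: "a * (\<Sum>n<m. (1 + a) ^ n) = (1 + a) ^ m - 1"
    by (induction m) (auto simp: algebra_simps)
  have "X m \<le> a * (\<Sum>n<m. X n) + b" using less.prems by (rule step)
  also have "\<dots> \<le> a * (\<Sum>n<m. b * (1 + a) ^ n) + b"
    using less a by (intro add_right_mono mult_left_mono sum_mono) auto
  also have "\<dots> = b * (a * (\<Sum>n<m. (1 + a) ^ n)) + b" by (simp add: sum_distrib_left mult_ac)
  also have "\<dots> = b * (1 + a) ^ m" unfolding geom by (simp add: algebra_simps)
  finally show ?case .
qed

text \<open>Moves the difference from the data \<open>y\<close> to the convolution weights \<open>c\<close>.\<close>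

lemma convolution_summation_by_parts:
  fixes c y :: "nat \<Rightarrow> real"
  assumes "y 0 = 0"
  shows "(\<Sum>k=1..n. c (n - k) * (y k - y (k - 1)))
    = (\<Sum>k=1..n. (if k = n then c 0 else c (n - k) - c (n - k - 1)) * y k)"
proof (cases n)
  case (Suc m)
  have "(\<Sum>k=1..Suc m. c (Suc m - k) * y (k - 1)) = (\<Sum>k=0..m. c (m - k) * y k)"
    using sum.shift_bounds_cl_Suc_ivl[of "\<lambda>k. c (Suc m - k) * y (k - 1)" 0 m] by simp
  also have "\<dots> = (\<Sum>k=1..m. c (m - k) * y k)"
    using assms by (simp add: sum.atLeast_Suc_atMost)
  finally have shift: "(\<Sum>k=1..Suc m. c (Suc m - k) * y (k - 1)) = (\<Sum>k=1..m. c (m - k) * y k)" .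
  have "(\<Sum>k=1..Suc m. c (Suc m - k) * (y k - y (k - 1)))
      = c 0 * y (Suc m) + (\<Sum>k=1..m. c (Suc m - k) * y k) - (\<Sum>k=1..m. c (m - k) * y k)"
    unfolding right_diff_distrib sum_subtractf shift by simp
  also have "\<dots> = c 0 * y (Suc m) + (\<Sum>k=1..m. (c (Suc m - k) - c (Suc m - k - 1)) * y k)"
    by (simp add: left_diff_distrib sum_subtractf)
  also have "\<dots> = (\<Sum>k=1..Suc m. (if k = Suc m then c 0 else c (Suc m - k) - c (Suc m - k - 1)) * y k)"
    by simp
  finally show ?thesis by (simp add: Suc)
qed simp

text \<open>The values at which the product integration rule freezes its argument on the successive time
  cells.\<close>

definition cell_value :: "(nat \<Rightarrow> gridfun) \<Rightarrow> nat \<Rightarrow> gridfun" where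
  "cell_value v n = (\<lambda>i j. if n = 1 then v 1 i j else (v n i j + v (n - 1) i j) / 2)"

lemma grid_ip_add: "grid_ip Mx My (\<lambda>i j. v i j + w i j) z = grid_ip Mx My v z + grid_ip Mx My w z"
  by (simp add: grid_ip_def distrib_right sum.distrib)

lemma grid_ip_diff: "grid_ip Mx My (\<lambda>i j. v i j - w i j) z = grid_ip Mx My v z - grid_ip Mx My w z"
  by (simp add: grid_ip_def left_diff_distrib sum_subtractf)

lemma grid_ip_sum:
  "grid_ip Mx My (\<lambda>i j. \<Sum>k\<in>I. c k * v k i j) z = (\<Sum>k\<in>I. c k * grid_ip Mx My (v k) z)"
proof -
  have "grid_ip Mx My (\<lambda>i j. \<Sum>k\<in>I. c k * v k i j) z
      = (\<Sum>q\<in>grid_int Mx My. \<Sum>k\<in>I. c k * (v k (fst q) (snd q) * z (fst q) (snd q)))"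
    by (simp add: grid_ip_pairs case_prod_unfold sum_distrib_right mult.assoc)
  also have "\<dots> = (\<Sum>k\<in>I. c k * grid_ip Mx My (v k) z)"
    by (subst sum.swap) (simp add: grid_ip_pairs case_prod_unfold sum_distrib_left)
  finally show ?thesis .
qed

lemma grid_ip_cong:
  "(\<And>i j. (i, j) \<in> grid_int Mx My \<Longrightarrow> v i j = w i j) \<Longrightarrow> grid_ip Mx My v z = grid_ip Mx My w z"
  by (auto simp: grid_ip_pairs intro!: sum.cong)

lemma grid_l2_cell_value:
  assumes "1 \<le> n" "\<And>k. k \<le> n \<Longrightarrow> grid_l2 Mx My (v k) \<le> X"
  shows "grid_l2 Mx My (cell_value v n) \<le> X"
proof (cases "n = 1")
  case True
  then show ?thesis using assms(2)[of 1] by (simp add: cell_value_def)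
next
  case False
  have "grid_l2 Mx My (cell_value v n) = grid_l2 Mx My (\<lambda>i j. 1/2 * v n i j + 1/2 * v (n - 1) i j)"
    using False by (simp add: cell_value_def add_divide_distrib)
  also have "\<dots> \<le> grid_l2 Mx My (\<lambda>i j. 1/2 * v n i j) + grid_l2 Mx My (\<lambda>i j. 1/2 * v (n - 1) i j)"
    by (rule grid_l2_triangle)
  also have "\<dots> = 1/2 * grid_l2 Mx My (v n) + 1/2 * grid_l2 Mx My (v (n - 1))"
    by (simp add: grid_l2_scale del: times_divide_eq_left)
  finally show ?thesis using assms(2)[of n] assms(2)[of "n - 1"] by simp
qed

lemma vanishes_cell_value: "(\<And>n. vanishes_on_bd Mx My (v n)) \<Longrightarrow> vanishes_on_bd Mx My (cell_value v n)"
  unfolding vanishes_on_bd_def cell_value_def case_prod_beta by auto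

lemma A_op_zero: "A_op Mx My (\<lambda>i j. 0) = (\<lambda>i j. 0)"
  by (simp add: fun_eq_iff A_op_def Ax_def Ay_def)

text \<open>The energy estimate. Testing with \<open>cell_value e n\<close> makes the time difference telescope, because \<open>A\<close> is symmetric, and gives the diffusion
  term a sign after summation over \<open>n\<close>. Everything else is bounded by products of norms, and every norm up to level \<open>n\<close> by the running maximum
  \<open>X n\<close>. One factor \<open>X\<close> cancels at a level where the maximum is attained, and Gronwall's inequality applies to \<open>X\<close>. The constant \<open>9\<close> is
  \<open>2 * (9/2)\<close>: the factor \<open>9/2\<close> inverts the coercivity constant \<open>2/9\<close>, and the factor \<open>2\<close> comes from absorbing the term at the
  current level for small \<open>\<tau>\<close>.\<close>

lemma discrete_stability:
  fixes e d R :: "nat \<Rightarrow> gridfun" and c \<gamma> \<rho> :: "nat \<Rightarrow> real"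
  assumes p: "0 < p" "p < 1" and \<tau>: "0 < \<tau>"
    and e0: "e 0 = (\<lambda>i j. 0)" and e_bd: "\<And>n. vanishes_on_bd Mx My (e n)"
    and d_bd: "\<And>n. vanishes_on_bd Mx My (d n)"
    and d_le: "\<And>n i j. (i, j) \<in> grid_int Mx My \<Longrightarrow> \<bar>d n i j\<bar> \<le> Qf * \<bar>e n i j\<bar>" and Qf: "0 \<le> Qf"
    and eq: "\<And>n i j. 1 \<le> n \<Longrightarrow> n \<le> N \<Longrightarrow> (i, j) \<in> grid_int Mx My \<Longrightarrow>
      (A_op Mx My (e n) i j - A_op Mx My (e (n - 1)) i j)
      + (\<Sum>k=1..n. c (n - k) * (A_op Mx My (e k) i j - A_op Mx My (e (k - 1)) i j))
      = (\<Sum>j'=1..n. lag_weight p \<tau> (n - j') * Lambda_op Mx My Hx Hy (cell_value e j') i j)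
      + (\<Sum>j'=1..n. lag_weight p \<tau> (n - j') * A_op Mx My (cell_value d j') i j) + R n i j"
    and \<gamma>: "\<bar>c 0\<bar> \<le> \<gamma> 0" "\<And>m. Suc m < N \<Longrightarrow> \<bar>c (Suc m) - c m\<bar> \<le> \<gamma> (Suc m)" "\<And>m. 0 \<le> \<gamma> m" "(\<Sum>m<N. \<gamma> m) \<le> \<tau> * C1"
    and lag: "(\<Sum>m<N. lag_weight p \<tau> m) \<le> \<tau> * C2"
    and R: "\<And>n. 1 \<le> n \<Longrightarrow> n \<le> N \<Longrightarrow> grid_l2 Mx My (R n) \<le> \<rho> n" "\<And>n. 0 \<le> \<rho> n" "(\<Sum>n=1..N. \<rho> n) \<le> \<rho>'"
    and small: "9 * (C1 + Qf * C2) * \<tau> \<le> 1" and C: "0 \<le> C1 + Qf * C2"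
    and "m \<le> N"
  shows "grid_l2 Mx My (e m) \<le> 9 * \<rho>' * (1 + 9 * (C1 + Qf * C2) * \<tau>) ^ m"
proof -
  let ?ip = "grid_ip Mx My" and ?A = "A_op Mx My" and ?L = "Lambda_op Mx My Hx Hy"
  define x where "x = (\<lambda>n. grid_l2 Mx My (e n))"
  define X where "X = (\<lambda>n. Max (x ` {..n}))"
  define z where "z = cell_value e"
  define E where "E = (\<lambda>n. ?ip (?A (e n)) (e n))"
  define C where "C = C1 + Qf * C2"
  have x0: "0 \<le> x n" for n by (simp add: x_def grid_l2_nonneg)
  have xX: "x k \<le> X n" if "k \<le> n" for k n unfolding X_def using that by (intro Max_ge) auto
  have X0: "0 \<le> X n" for n using x0[of n] xX[of n n] by simp
  have X_mono: "X k \<le> X n" if "k \<le> n" for k n unfolding X_def using that by (intro Max_mono) auto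
  have zX: "grid_l2 Mx My (z n) \<le> X n" if "1 \<le> n" for n
    unfolding z_def using that xX by (intro grid_l2_cell_value) (auto simp: x_def)
  have z_bd: "vanishes_on_bd Mx My (z n)" for n unfolding z_def by (rule vanishes_cell_value[OF e_bd])
  have E_nonneg: "0 \<le> E n" for n unfolding E_def using A_op_coercive[OF e_bd[of n]]
    by (smt (verit) zero_le_power2 mult_nonneg_nonneg divide_nonneg_nonneg)
  have E0: "E 0 = 0" by (simp add: E_def e0 A_op_zero grid_ip_def)

  have d_l2: "grid_l2 Mx My (cell_value d n) \<le> Qf * X n" if "1 \<le> n" for n
  proof (rule grid_l2_cell_value[OF that])
    fix k assume "k \<le> n"
    have "grid_l2 Mx My (d k) \<le> grid_l2 Mx My (\<lambda>i j. Qf * e k i j)"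
      using d_le Qf by (intro grid_l2_mono) (auto simp: abs_mult)
    also have "\<dots> = Qf * x k" using Qf by (simp add: grid_l2_scale x_def)
    also have "\<dots> \<le> Qf * X n" using Qf xX[OF \<open>k \<le> n\<close>] by (intro mult_left_mono) auto
    finally show "grid_l2 Mx My (d k) \<le> Qf * X n" .
  qed
  have ip_A: "\<bar>?ip (?A v) w\<bar> \<le> a * b"
    if "vanishes_on_bd Mx My v" "grid_l2 Mx My v \<le> a" "grid_l2 Mx My w \<le> b" for v w a b
  proof -
    have "\<bar>?ip (?A v) w\<bar> \<le> grid_l2 Mx My (?A v) * grid_l2 Mx My w" by (rule grid_ip_cauchy_schwarz)
    also have "\<dots> \<le> a * b"
      using A_op_bounded[OF that(1)] that grid_l2_nonneg order_trans
      by (intro mult_mono) (blast intro: order_trans)+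
    finally show ?thesis .
  qed

  have level: "(E n - E (n - 1)) / 2 \<le> (\<Sum>j=1..n. lag_weight p \<tau> (n - j) * ?ip (?L (z j)) (z n))
      + (C * \<tau> * X n + \<rho> n) * X n" if n: "1 \<le> n" "n \<le> N" for n
  proof -
    \<comment> \<open>In the first step \<open>e 0 = 0\<close> and the test function is \<open>e 1\<close>, so one half of the energy is given away.\<close>
    have time: "(E n - E (n - 1)) / 2 \<le> ?ip (?A (e n)) (z n) - ?ip (?A (e (n - 1))) (z n)"
    proof (cases "n = 1")
      case True
      then show ?thesis using E_nonneg[of 1]
        by (simp add: z_def cell_value_def E_def e0 A_op_zero grid_ip_def)
    next
      case False
      have z_eq: "z n = (\<lambda>i j. 1/2 * (e n i j + e (n - 1) i j))" using False by (simp add: z_def cell_value_def)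
      have "?ip v (z n) = (?ip v (e n) + ?ip v (e (n - 1))) / 2" for v
        unfolding z_eq by (simp add: grid_ip_def sum.distrib sum_divide_distrib add_divide_distrib distrib_left)
      then show ?thesis using A_op_symmetric[OF e_bd[of n] e_bd[of "n - 1"]]
        by (simp add: E_def field_simps)
    qed
    have "\<bar>\<Sum>k=1..n. c (n - k) * (?ip (?A (e k)) (z n) - ?ip (?A (e (k - 1))) (z n))\<bar>
        = \<bar>\<Sum>k=1..n. (if k = n then c 0 else c (n - k) - c (n - k - 1)) * ?ip (?A (e k)) (z n)\<bar>"
      by (subst convolution_summation_by_parts) (simp_all add: e0 A_op_zero grid_ip_def)
    also have "\<dots> \<le> (\<Sum>k=1..n. \<gamma> (n - k) * (X n * X n))"
    proof (rule order_trans[OF sum_abs], rule sum_mono)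
      fix k assume k: "k \<in> {1..n}"
      have "\<bar>if k = n then c 0 else c (n - k) - c (n - k - 1)\<bar> \<le> \<gamma> (n - k)"
        using \<gamma>(1) \<gamma>(2)[of "n - k - 1"] k n by (cases "k = n") (auto simp: Suc_diff_Suc)
      moreover have "\<bar>?ip (?A (e k)) (z n)\<bar> \<le> X n * X n"
        using xX[of k n] k n zX by (intro ip_A e_bd) (auto simp: x_def)
      ultimately show "\<bar>(if k = n then c 0 else c (n - k) - c (n - k - 1)) * ?ip (?A (e k)) (z n)\<bar> \<le> \<gamma> (n - k) * (X n * X n)"
        unfolding abs_mult using \<gamma>(3) by (intro mult_mono) auto
    qed
    also have "\<dots> = (\<Sum>m<n. \<gamma> m) * (X n * X n)"
      unfolding sum_distrib_right
      by (rule sum.reindex_bij_witness[of _ "\<lambda>m. n - m" "\<lambda>k. n - k"]) auto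
    also have "\<dots> \<le> \<tau> * C1 * (X n * X n)"
    proof (rule mult_right_mono)
      have "(\<Sum>m<n. \<gamma> m) \<le> (\<Sum>m<N. \<gamma> m)" using n \<gamma>(3) by (intro sum_mono2) auto
      with \<gamma>(4) show "(\<Sum>m<n. \<gamma> m) \<le> \<tau> * C1" by simp
    qed simp
    finally have memory: "\<bar>\<Sum>k=1..n. c (n - k) * (?ip (?A (e k)) (z n) - ?ip (?A (e (k - 1))) (z n))\<bar> \<le> \<tau> * C1 * (X n * X n)" .
    have "\<bar>\<Sum>j=1..n. lag_weight p \<tau> (n - j) * ?ip (?A (cell_value d j)) (z n)\<bar>
        \<le> (\<Sum>j=1..n. lag_weight p \<tau> (n - j) * (Qf * X n * X n))"
    proof (rule order_trans[OF sum_abs], rule sum_mono)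
      fix j assume j: "j \<in> {1..n}"
      have "Qf * X j \<le> Qf * X n" using j X_mono Qf by (intro mult_left_mono) auto
      then have "\<bar>?ip (?A (cell_value d j)) (z n)\<bar> \<le> Qf * X n * X n"
        using j n zX d_l2[of j] by (intro ip_A vanishes_cell_value d_bd) auto
      then show "\<bar>lag_weight p \<tau> (n - j) * ?ip (?A (cell_value d j)) (z n)\<bar> \<le> lag_weight p \<tau> (n - j) * (Qf * X n * X n)"
        unfolding abs_mult using lag_weight_nonneg[OF p \<tau>] by (simp add: mult_left_mono)
    qed
    also have "\<dots> = (\<Sum>m<n. lag_weight p \<tau> m) * (Qf * X n * X n)"
      unfolding sum_distrib_right
      by (rule sum.reindex_bij_witness[of _ "\<lambda>m. n - m" "\<lambda>k. n - k"]) auto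
    also have "\<dots> \<le> \<tau> * C2 * (Qf * X n * X n)"
    proof (rule mult_right_mono)
      have "(\<Sum>m<n. lag_weight p \<tau> m) \<le> (\<Sum>m<N. lag_weight p \<tau> m)"
        using n lag_weight_nonneg[OF p \<tau>] by (intro sum_mono2) auto
      with lag show "(\<Sum>m<n. lag_weight p \<tau> m) \<le> \<tau> * C2" by simp
    qed (use Qf X0 in simp)
    finally have source: "\<bar>\<Sum>j=1..n. lag_weight p \<tau> (n - j) * ?ip (?A (cell_value d j)) (z n)\<bar> \<le> \<tau> * C2 * (Qf * X n * X n)" .
    have "\<bar>?ip (R n) (z n)\<bar> \<le> grid_l2 Mx My (R n) * grid_l2 Mx My (z n)" by (rule grid_ip_cauchy_schwarz)
    also have "\<dots> \<le> \<rho> n * X n" using R n zX by (intro mult_mono) (auto simp: grid_l2_nonneg)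
    finally have residual: "\<bar>?ip (R n) (z n)\<bar> \<le> \<rho> n * X n" .
    have "?ip (\<lambda>i j. (?A (e n) i j - ?A (e (n - 1)) i j)
        + (\<Sum>k=1..n. c (n - k) * (?A (e k) i j - ?A (e (k - 1)) i j))) (z n)
      = ?ip (\<lambda>i j. (\<Sum>j'=1..n. lag_weight p \<tau> (n - j') * ?L (z j') i j)
        + (\<Sum>j'=1..n. lag_weight p \<tau> (n - j') * ?A (cell_value d j') i j) + R n i j) (z n)"
      unfolding z_def using eq[OF n] by (intro grid_ip_cong) simp
    then have "?ip (?A (e n)) (z n) - ?ip (?A (e (n - 1))) (z n)
        + (\<Sum>k=1..n. c (n - k) * (?ip (?A (e k)) (z n) - ?ip (?A (e (k - 1))) (z n)))
      = (\<Sum>j=1..n. lag_weight p \<tau> (n - j) * ?ip (?L (z j)) (z n))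
        + (\<Sum>j=1..n. lag_weight p \<tau> (n - j) * ?ip (?A (cell_value d j)) (z n)) + ?ip (R n) (z n)"
      by (simp add: grid_ip_add grid_ip_diff grid_ip_sum[where v = "\<lambda>k i j. ?A (e k) i j - ?A (e (k - 1)) i j"] grid_ip_sum)
    then have "(E n - E (n - 1)) / 2 \<le> (\<Sum>j=1..n. lag_weight p \<tau> (n - j) * ?ip (?L (z j)) (z n))
        + (\<tau> * C1 * (X n * X n) + \<tau> * C2 * (Qf * X n * X n) + \<rho> n * X n)"
      using time memory source residual by linarith
    then show ?thesis by (simp add: C_def algebra_simps)
  qed

  have energy: "2/9 * (x k)\<^sup>2 \<le> X k * (C * \<tau> * (\<Sum>n=1..k. X n) + \<rho>')" if "k \<le> N" for k
  proof -
    have "2/9 * (x k)\<^sup>2 \<le> E k / 2" unfolding E_def x_def using A_op_coercive[OF e_bd[of k]] by simp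
    also have "E k / 2 = (\<Sum>n=1..k. (E n - E (n - 1)) / 2)"
      by (induction k) (auto simp: E0 field_simps)
    also have "\<dots> \<le> (\<Sum>n=1..k. (\<Sum>j=1..n. lag_weight p \<tau> (n - j) * ?ip (?L (z j)) (z n)) + (C * \<tau> * X n + \<rho> n) * X n)"
      using that by (intro sum_mono level) auto
    also have "\<dots> = - (\<Sum>n=1..k. \<Sum>j=1..n. lag_weight p \<tau> (n - j) * - ?ip (?L (z j)) (z n)) + (\<Sum>n=1..k. (C * \<tau> * X n + \<rho> n) * X n)"
      by (simp add: sum.distrib sum_negf)
    also have "\<dots> \<le> (\<Sum>n=1..k. (C * \<tau> * X n + \<rho> n) * X n)"
      using Lambda_op_positive_type[OF p \<tau>, of Mx My Hx Hy] z_bd by (simp add: positive_type_def)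
    also have "\<dots> \<le> (\<Sum>n=1..k. (C * \<tau> * X n + \<rho> n) * X k)"
      using X_mono X0 R(2) C \<tau> by (intro sum_mono mult_left_mono add_nonneg_nonneg mult_nonneg_nonneg) (auto simp: C_def)
    also have "\<dots> = X k * (C * \<tau> * (\<Sum>n=1..k. X n) + (\<Sum>n=1..k. \<rho> n))"
      by (simp add: sum.distrib sum_distrib_left sum_distrib_right algebra_simps)
    also have "\<dots> \<le> X k * (C * \<tau> * (\<Sum>n=1..k. X n) + \<rho>')"
    proof (rule mult_left_mono[OF add_left_mono X0])
      have "(\<Sum>n=1..k. \<rho> n) \<le> (\<Sum>n=1..N. \<rho> n)" using that R(2) by (intro sum_mono2) auto
      with R(3) show "(\<Sum>n=1..k. \<rho> n) \<le> \<rho>'" by simp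
    qed
    finally show ?thesis .
  qed

  have \<rho>': "0 \<le> \<rho>'" using R(2,3) by (meson order_trans sum_nonneg)
  have "X k \<le> 9 * C * \<tau> * (\<Sum>n<k. X n) + 9 * \<rho>'" if "k \<le> N" for k
  proof (cases "X k = 0")
    case True
    then show ?thesis using C \<tau> \<rho>' X0 by (simp add: C_def sum_nonneg)
  next
    case False
    then have Xpos: "0 < X k" using X0[of k] by simp
    \<comment> \<open>The energy estimate is used at a level where the maximum is attained.\<close>
    have "X k \<in> x ` {..k}" unfolding X_def by (intro Max_in) auto
    then obtain l where l: "l \<le> k" "X k = x l" by auto
    have "2/9 * (X k * X k) \<le> X l * (C * \<tau> * (\<Sum>n=1..l. X n) + \<rho>')"
      using energy[of l] l that by (simp add: power2_eq_square)
    also have "\<dots> \<le> X k * (C * \<tau> * (\<Sum>n\<le>k. X n) + \<rho>')"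
    proof (rule mult_mono[OF X_mono[OF l(1)] _ X0])
      have C\<tau>: "0 \<le> C * \<tau>" using C \<tau> by (simp add: C_def)
      have "(\<Sum>n=1..l. X n) \<le> (\<Sum>n\<le>k. X n)" using l X0 by (intro sum_mono2) auto
      with C\<tau> show "C * \<tau> * (\<Sum>n=1..l. X n) + \<rho>' \<le> C * \<tau> * (\<Sum>n\<le>k. X n) + \<rho>'"
        by (intro add_right_mono mult_left_mono)
      have "0 \<le> (\<Sum>n=1..l. X n)" using X0 by (simp add: sum_nonneg)
      with C\<tau> show "0 \<le> C * \<tau> * (\<Sum>n=1..l. X n) + \<rho>'" using \<rho>' by simp
    qed
    finally have "X k * (2/9 * X k) \<le> X k * (C * \<tau> * (\<Sum>n\<le>k. X n) + \<rho>')" by (simp add: mult_ac)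
    then have "2/9 * X k \<le> C * \<tau> * (\<Sum>n\<le>k. X n) + \<rho>'" using Xpos by simp
    also have "(\<Sum>n\<le>k. X n) = (\<Sum>n<k. X n) + X k" by (simp add: lessThan_Suc_atMost[symmetric])
    finally have "2 * X k \<le> 9 * C * \<tau> * (\<Sum>n<k. X n) + (9 * C * \<tau>) * X k + 9 * \<rho>'"
      by (simp add: algebra_simps)
    moreover have "(9 * C * \<tau>) * X k \<le> 1 * X k" using small X0 by (intro mult_right_mono) (auto simp: C_def)
    ultimately show ?thesis by linarith
  qed
  then have "X m \<le> 9 * \<rho>' * (1 + 9 * C * \<tau>) ^ m"
    using C \<tau> \<open>m \<le> N\<close> by (intro discrete_gronwall[of _ N]) (auto simp: C_def)
  then show ?thesis using xX[of m m] by (simp add: x_def C_def)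
qed

section \<open>The integrated form of the equation\<close>

lemma powr_dominated_set_integrable:
  fixes f :: "real \<Rightarrow> real"
  assumes cont: "continuous_on {0<..t} f" and q: "-1 < q" and t: "0 \<le> t"
    and bound: "\<And>x. 0 < x \<Longrightarrow> x \<le> t \<Longrightarrow> \<bar>f x\<bar> \<le> C * x powr q"
  shows "set_integrable lborel {0..t} f"
proof -
  have "(\<lambda>x. \<bar>C\<bar> * x powr q) integrable_on {0..t}"
    using integrable_on_powr_from_0[OF q t] by (intro integrable_on_mult_right)
  then have "(\<lambda>x. \<bar>C\<bar> * x powr q) absolutely_integrable_on {0..t}"
    by (intro nonnegative_absolutely_integrable_1) auto
  moreover have "(\<lambda>x. indicator {0..t} x *\<^sub>R (\<bar>C\<bar> * x powr q)) \<in> borel_measurable lborel"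
    by measurable
  ultimately have dom: "integrable lborel (\<lambda>x. indicator {0..t} x *\<^sub>R (\<bar>C\<bar> * x powr q))"
    unfolding set_integrable_def using integrable_completion by blast
  have "(\<lambda>x. indicator {0<..t} x *\<^sub>R f x) \<in> borel_measurable borel"
    using cont by (intro borel_measurable_continuous_on_indicator) auto
  then have "(\<lambda>x. indicator {0<..t} x *\<^sub>R f x + indicator {0} x *\<^sub>R f 0) \<in> borel_measurable borel"
    by (intro borel_measurable_add borel_measurable_scaleR[of _ _ "\<lambda>x. f 0"] borel_measurable_indicator) auto
  also have "(\<lambda>x. indicator {0<..t} x *\<^sub>R f x + indicator {0} x *\<^sub>R f 0) = (\<lambda>x. indicator {0..t} x *\<^sub>R f x)"
    using t by (auto simp: indicator_def fun_eq_iff)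
  finally have meas: "(\<lambda>x. indicator {0..t} x *\<^sub>R f x) \<in> borel_measurable borel" .
  have "AE x in lborel. norm (indicator {0..t} x *\<^sub>R f x) \<le> norm (indicator {0..t} x *\<^sub>R (\<bar>C\<bar> * x powr q))"
    using AE_lborel_singleton[of "0::real"]
  proof eventually_elim
    case (elim x)
    have "\<bar>f x\<bar> \<le> \<bar>C\<bar> * x powr q" if "0 < x" "x \<le> t"
      using bound[OF that] by (smt (verit) mult_right_mono powr_ge_zero abs_ge_self)
    then show ?case using elim by (auto simp: indicator_def abs_mult)
  qed
  with meas show ?thesis
    unfolding set_integrable_def by (intro Bochner_Integration.integrable_bound[OF dom]) auto
qed

text \<open>Fubini's theorem for \<open>a * (b * c) = (a * b) * c\<close> with a bounded \<open>a\<close> and integrable \<open>b\<close>, \<open>c\<close>. The inner convolution \<open>b * c\<close> exists only for almost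
  all \<open>s\<close>; at the other points the integral has a default value, which does not affect the outer integral.\<close>

lemma convolution_associative:
  fixes a b c :: "real \<Rightarrow> real"
  assumes t: "0 \<le> t" and a: "continuous_on {0..t} a"
    and b: "set_integrable lborel {0..t} b" and c: "set_integrable lborel {0..t} c"
  shows "((\<lambda>s. a (t - s) * integral {0..s} (\<lambda>r. b (s - r) * c r)) has_integral
      integral {0..t} (\<lambda>r. integral {0..t - r} (\<lambda>s. a (t - r - s) * b s) * c r)) {0..t}"
proof -
  define A where "A = (\<lambda>x. indicator {0..t} x *\<^sub>R a x)"
  define B where "B = (\<lambda>x. indicator {0..t} x *\<^sub>R b x)"
  define K where "K = (\<lambda>x. indicator {0..t} x *\<^sub>R c x)"
  have B: "integrable lborel B" and K: "integrable lborel K"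
    using b c by (auto simp: B_def K_def set_integrable_def)
  have [measurable]: "A \<in> borel_measurable borel" "B \<in> borel_measurable borel" "K \<in> borel_measurable borel"
    using borel_measurable_continuous_on_indicator[OF _ a] borel_measurable_integrable[OF B]
      borel_measurable_integrable[OF K] by (auto simp: A_def)
  obtain M where M: "\<And>x. x \<in> {0..t} \<Longrightarrow> \<bar>a x\<bar> \<le> M"
    using compact_imp_bounded[OF compact_continuous_image[OF a compact_Icc]]
    unfolding bounded_iff by (metis imageI real_norm_def)
  have M0: "0 \<le> M" using M[of 0] t by (auto intro: order_trans[OF abs_ge_zero])
  have AM: "\<bar>A x\<bar> \<le> M" for x using M M0 by (auto simp: A_def indicator_def)
  define H where "H = (\<lambda>(r, s). A (t - s) * B (s - r) * K r)"
  have H_meas [measurable]: "H \<in> borel_measurable (lborel \<Otimes>\<^sub>M lborel)"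
    unfolding H_def by measurable
  have B_shift: "integrable lborel (\<lambda>s. B (s - r))" for r
    using lborel_integrable_real_affine[OF B, of 1 "- r"] by (simp add: add.commute)
  have B_shift_int: "(\<integral>s. \<bar>B (s - r)\<bar> \<partial>lborel) = (\<integral>s. \<bar>B s\<bar> \<partial>lborel)" for r
    using lborel_integral_real_affine[of 1 "\<lambda>s. \<bar>B s\<bar>" "- r"] by (simp add: add.commute)
  have H_le: "\<bar>H (r, s)\<bar> \<le> M * \<bar>K r\<bar> * \<bar>B (s - r)\<bar>" for r s
    using mult_right_mono[OF AM[of "t - s"], of "\<bar>K r\<bar> * \<bar>B (s - r)\<bar>"] by (simp add: H_def abs_mult mult_ac)
  have dom: "integrable lborel (\<lambda>s. M * \<bar>K r\<bar> * \<bar>B (s - r)\<bar>)" for r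
    using B_shift by (intro integrable_mult_right integrable_abs)
  have H_int_s: "integrable lborel (\<lambda>s. H (r, s))" for r
    by (rule Bochner_Integration.integrable_bound[OF dom[of r]])
       (use H_le M0 in \<open>auto simp: abs_mult\<close>)
  have H_int: "integrable (lborel \<Otimes>\<^sub>M lborel) H"
  proof (rule lborel_pair.Fubini_integrable[OF H_meas])
    show "AE r in lborel. integrable lborel (\<lambda>s. H (r, s))" using H_int_s by simp
    have bound: "norm (\<integral>s. norm (H (r, s)) \<partial>lborel) \<le> norm (M * (\<integral>s. \<bar>B s\<bar> \<partial>lborel) * K r)" for r
    proof -
      have "(\<integral>s. norm (H (r, s)) \<partial>lborel) \<le> (\<integral>s. M * \<bar>K r\<bar> * \<bar>B (s - r)\<bar> \<partial>lborel)"
        using H_int_s[of r] dom[of r] H_le by (intro integral_mono) auto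
      also have "\<dots> = M * \<bar>K r\<bar> * (\<integral>s. \<bar>B s\<bar> \<partial>lborel)" using B_shift_int[of r] by simp
      finally show ?thesis using M0 by (simp add: abs_mult mult_ac)
    qed
    show "integrable lborel (\<lambda>r. \<integral>s. norm (H (r, s)) \<partial>lborel)"
    proof (rule Bochner_Integration.integrable_bound)
      show "integrable lborel (\<lambda>r. M * (\<integral>s. \<bar>B s\<bar> \<partial>lborel) * K r)"
        using K by (rule integrable_mult_right)
      show "(\<lambda>r. \<integral>s. norm (H (r, s)) \<partial>lborel) \<in> borel_measurable lborel" by measurable
    qed (use bound in simp)
  qed
  define L where "L = (\<lambda>s. a (t - s) * integral {0..s} (\<lambda>r. b (s - r) * c r))"
  define R where "R = (\<lambda>r. integral {0..t - r} (\<lambda>s. a (t - r - s) * b s) * c r)"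
  have left: "(\<integral>r. H (r, s) \<partial>lborel) = L s"
    if int: "integrable lborel (\<lambda>r. H (r, s))" and s: "s \<in> {0..t}" for s
  proof (cases "A (t - s) = 0")
    case True
    then show ?thesis using s by (simp add: H_def L_def A_def)
  next
    case False
    have eq: "B (s - r) * K r = indicator {0..s} r *\<^sub>R (b (s - r) * c r)" for r
      using s by (auto simp: B_def K_def indicator_def)
    have "integrable lborel (\<lambda>r. 1 / A (t - s) * H (r, s))" using int by (rule integrable_mult_right)
    then have "set_integrable lborel {0..s} (\<lambda>r. b (s - r) * c r)"
      using False unfolding set_integrable_def eq[symmetric] by (simp add: H_def mult.assoc)
    from set_borel_integral_eq_integral(2)[OF this]
    have "(\<integral>r. B (s - r) * K r \<partial>lborel) = integral {0..s} (\<lambda>r. b (s - r) * c r)"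
      by (simp add: set_lebesgue_integral_def eq)
    then show ?thesis using s by (simp add: H_def L_def A_def mult.assoc)
  qed
  have right: "(\<integral>s. H (r, s) \<partial>lborel) = R r" if r: "r \<in> {0..t}" for r
  proof -
    have "(\<integral>s. H (r, s) \<partial>lborel) = (\<integral>x. H (r, r + 1 * x) \<partial>lborel)"
      by (subst lborel_integral_real_affine[where c = 1 and t = r]) auto
    also have "\<dots> = (\<integral>x. A (t - r - x) * B x * K r \<partial>lborel)"
      by (simp add: H_def algebra_simps)
    also have "\<dots> = (\<integral>x. A (t - r - x) * B x \<partial>lborel) * c r"
      using r by (simp add: K_def)
    also have "(\<integral>x. A (t - r - x) * B x \<partial>lborel) = integral {0..t - r} (\<lambda>s. a (t - r - s) * b s)"
    proof -
      have eq: "A (t - r - x) * B x = indicator {0..t - r} x *\<^sub>R (a (t - r - x) * b x)" for x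
        using r by (auto simp: A_def B_def indicator_def)
      have "integrable lborel (\<lambda>x. A (t - r - x) * B x)"
      proof (rule Bochner_Integration.integrable_bound[of lborel "\<lambda>x. M * B x"])
        show "AE x in lborel. norm (A (t - r - x) * B x) \<le> norm (M * B x)"
          using AM M0 by (auto simp: abs_mult intro!: mult_right_mono)
      qed (use B in auto)
      then have "set_integrable lborel {0..t - r} (\<lambda>s. a (t - r - s) * b s)"
        by (simp add: set_integrable_def eq)
      from set_borel_integral_eq_integral(2)[OF this] show ?thesis
        by (simp add: set_lebesgue_integral_def eq)
    qed
    finally show ?thesis by (simp add: R_def)
  qed
  define I where "I = (\<integral>r. \<integral>s. H (r, s) \<partial>lborel \<partial>lborel)"
  have "((\<lambda>r. \<integral>s. H (r, s) \<partial>lborel) has_integral I) UNIV"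
    unfolding I_def by (rule has_integral_integral_lborel[OF lborel_pair.integrable_fst'[OF H_int]])
  moreover have "(\<lambda>r. \<integral>s. H (r, s) \<partial>lborel) = (\<lambda>r. if r \<in> {0..t} then R r else 0)"
    using right by (auto simp: H_def K_def)
  ultimately have RI: "(R has_integral I) {0..t}"
    unfolding has_integral_restrict_UNIV[of "{0..t}" R, symmetric] by (rule back_subst[of "\<lambda>f. (f has_integral I) UNIV"])
  have H': "integrable (lborel \<Otimes>\<^sub>M lborel) (\<lambda>(s, r). H (r, s))"
    using lborel_pair.integrable_product_swap[OF H_int] by simp
  have "((\<lambda>s. \<integral>r. H (r, s) \<partial>lborel) has_integral (\<integral>s. \<integral>r. H (r, s) \<partial>lborel \<partial>lborel)) UNIV"
    using has_integral_integral_lborel[OF lborel_pair.integrable_fst'[OF H']] by simp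
  moreover have "(\<integral>s. \<integral>r. H (r, s) \<partial>lborel \<partial>lborel) = I"
    unfolding I_def using lborel_pair.Fubini_integral[of "\<lambda>r s. H (r, s)"] H_int by simp
  ultimately have LI: "((\<lambda>s. \<integral>r. H (r, s) \<partial>lborel) has_integral integral {0..t} R) UNIV"
    unfolding integral_unique[OF RI] by simp
  have "AE s in lborel. s \<in> UNIV \<longrightarrow> (\<integral>r. H (r, s) \<partial>lborel) = (if s \<in> {0..t} then L s else 0)"
    using lborel_pair.AE_integrable_fst'[OF H']
  proof eventually_elim
    case (elim s)
    then show ?case using left[of s] by (auto simp: H_def A_def)
  qed
  from iffD1[OF has_integral_AE[OF this] LI]
  show ?thesis unfolding has_integral_restrict_UNIV L_def R_def .
qed

lemma times_diff_continuous:
  assumes "times_diff k S A f" "j < k" "A \<subseteq> S" shows "continuous_on A (deriv_in S j f)"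
  using assms unfolding times_diff_def continuous_on_eq_continuous_within
  by (meson differentiable_imp_continuous_within continuous_within_subset)

text \<open>On a compact interval the continuous exponent is bounded by its maximum \<open>\<alpha> s1 < 2\<close>, so the kernel is dominated by a multiple of the
  integrable power \<open>1 - \<alpha> s1\<close>.\<close>

lemma vo_kernel_integrable:
  assumes ex: "exponent_conditions T Q\<alpha> \<alpha>" and t: "0 \<le> t" "t \<le> T"
  shows "set_integrable lborel {0..t} (vo_kernel \<alpha>)"
proof -
  have \<alpha>: "1 < \<alpha> s \<and> \<alpha> s < 2" if "s \<in> {0..t}" for s
    using ex that t by (auto simp: exponent_conditions_def)
  have "continuous_on {0..T} (deriv_in {0..T} 0 \<alpha>)"
    using ex by (intro times_diff_continuous) (auto simp: exponent_conditions_def)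
  then have cont: "continuous_on {0..t} \<alpha>"
    using t by (auto simp: deriv_in_def elim: continuous_on_subset)
  have G: "continuous_on {0..t} (\<lambda>s. Gamma (2 - \<alpha> s))"
  proof (rule continuous_on_compose2[OF continuous_on_Gamma])
    show "{0<..} \<inter> \<int>\<^sub>\<le>\<^sub>0 = ({} :: real set)" by (auto elim!: nonpos_Ints_cases)
  qed (use \<alpha> cont in \<open>auto intro!: continuous_on_diff\<close>)
  obtain s1 where s1: "s1 \<in> {0..t}" "\<And>s. s \<in> {0..t} \<Longrightarrow> \<alpha> s \<le> \<alpha> s1"
    using continuous_attains_sup[OF compact_Icc _ cont] t by auto
  obtain s2 where s2: "s2 \<in> {0..t}" "\<And>s. s \<in> {0..t} \<Longrightarrow> Gamma (2 - \<alpha> s2) \<le> Gamma (2 - \<alpha> s)"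
    using continuous_attains_inf[OF compact_Icc _ G] t by auto
  have Gpos: "0 < Gamma (2 - \<alpha> s)" if "s \<in> {0..t}" for s using \<alpha>[OF that] by (intro Gamma_real_pos) auto
  have Gne: "Gamma (2 - \<alpha> s) \<noteq> 0" if "0 < s" "s \<le> t" for s using Gpos[of s] that by simp
  show ?thesis
  proof (rule powr_dominated_set_integrable[where q = "1 - \<alpha> s1" and C = "max 1 t / Gamma (2 - \<alpha> s2)"])
    show "- 1 < 1 - \<alpha> s1" using \<alpha>[OF s1(1)] by simp
    show "continuous_on {0<..t} (vo_kernel \<alpha>)"
      unfolding vo_kernel_def
      by (intro continuous_on_divide continuous_on_powr continuous_on_diff continuous_on_const continuous_on_id
          continuous_on_subset[OF G] continuous_on_subset[OF cont]) (auto simp: Gne)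
    fix s assume s: "0 < s" "s \<le> t"
    then have sI: "s \<in> {0..t}" by simp
    have "s powr (\<alpha> s1 - \<alpha> s) \<le> max 1 s powr (\<alpha> s1 - \<alpha> s)"
      using s s1(2)[OF sI] by (intro powr_mono2) auto
    also have "\<dots> \<le> max 1 s powr 1" using \<alpha>[OF sI] \<alpha>[OF s1(1)] by (intro powr_mono) auto
    also have "\<dots> \<le> max 1 t" using s by simp
    finally have "s powr (\<alpha> s1 - \<alpha> s) \<le> max 1 t" .
    then have "s powr (1 - \<alpha> s1) * s powr (\<alpha> s1 - \<alpha> s) \<le> s powr (1 - \<alpha> s1) * max 1 t"
      by (intro mult_left_mono) auto
    then have "s powr (1 - \<alpha> s) \<le> max 1 t * s powr (1 - \<alpha> s1)"
      by (simp add: powr_add[symmetric] mult.commute)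
    then have "s powr (1 - \<alpha> s) / Gamma (2 - \<alpha> s) \<le> (max 1 t * s powr (1 - \<alpha> s1)) / Gamma (2 - \<alpha> s2)"
      using s2(2)[OF sI] Gpos[OF s2(1)] by (intro frac_le) auto
    then show "\<bar>vo_kernel \<alpha> s\<bar> \<le> max 1 t / Gamma (2 - \<alpha> s2) * s powr (1 - \<alpha> s1)"
      using Gpos[OF sI] by (simp add: vo_kernel_def)
  qed (use t in auto)
qed

text \<open>With \<open>k\<close> for the variable-order kernel: \<open>1 * g = 1 * (\<beta> * k) = (1 * \<beta>) * k\<close>.\<close>

lemma g_primitive:
  assumes ex: "exponent_conditions T Q\<alpha> \<alpha>" and p: "p = \<alpha> 0 - 1" and t: "0 \<le> t" "t \<le> T"
  shows "integral {0..t} (\<lambda>s. beta_kernel (1+p) (t - s) * vo_kernel \<alpha> s) = integral {0..t} (g_fun \<alpha>)"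
proof -
  have p0: "0 < p" using ex t by (auto simp: exponent_conditions_def p)
  have "set_integrable lborel {0..t} (beta_kernel p)"
  proof (rule powr_dominated_set_integrable[where q = "p - 1" and C = "1 / Gamma p"])
    show "continuous_on {0<..t} (beta_kernel p)"
      unfolding beta_kernel_def divide_inverse
      by (intro continuous_on_mult continuous_on_powr continuous_on_const continuous_on_id) auto
    show "\<bar>beta_kernel p s\<bar> \<le> 1 / Gamma p * s powr (p - 1)" for s
      using beta_kernel_nonneg[OF p0, of s] by (simp add: beta_kernel_def)
  qed (use p0 t in auto)
  from convolution_associative[OF t(1) continuous_on_const[of _ 1] this vo_kernel_integrable[OF ex t]]
  have "((\<lambda>s. integral {0..s} (\<lambda>r. beta_kernel p (s - r) * vo_kernel \<alpha> r)) has_integral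
      integral {0..t} (\<lambda>r. integral {0..t - r} (beta_kernel p) * vo_kernel \<alpha> r)) {0..t}" by simp
  moreover have "integral {0..t} (\<lambda>r. integral {0..t - r} (beta_kernel p) * vo_kernel \<alpha> r)
      = integral {0..t} (\<lambda>r. beta_kernel (1+p) (t - r) * vo_kernel \<alpha> r)"
  proof (intro integral_cong arg_cong2[where f = "(*)"] refl)
    fix r assume "r \<in> {0..t}"
    then show "integral {0..t - r} (beta_kernel p) = beta_kernel (1+p) (t - r)"
      using beta_kernel_integral[of p 0 0 "t - r"] p0 by (simp add: integral_unique)
  qed
  ultimately have "((\<lambda>s. integral {0..s} (\<lambda>r. beta_kernel p (s - r) * vo_kernel \<alpha> r)) has_integral
      integral {0..t} (\<lambda>r. beta_kernel (1+p) (t - r) * vo_kernel \<alpha> r)) {0..t}" by simp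
  then have "(g_fun \<alpha> has_integral integral {0..t} (\<lambda>r. beta_kernel (1+p) (t - r) * vo_kernel \<alpha> r)) {0..t}"
    by (rule has_integral_spike[where S = "{0}", rotated 2]) (auto simp: g_fun_def p)
  then show ?thesis by (simp add: integral_unique)
qed

text \<open>With \<open>k\<close> for the variable-order kernel, \<open>B\<close> for the kernel of order \<open>1 + p\<close> and \<open>G\<close> for the primitive of \<open>g\<close>:
  \<open>B * F = B * (k * \<phi>2) = (B * k) * \<phi>2 = G * \<phi>2 = g * \<phi>1\<close>. The last step is an integration by parts whose boundary terms vanish, since
  \<open>G 0 = 0\<close> and \<open>\<phi>1 0 = 0\<close>.\<close>

lemma caputo_integrated:
  fixes \<phi>1 \<phi>2 F :: "real \<Rightarrow> real"
  assumes ex: "exponent_conditions T Q\<alpha> \<alpha>" and p: "p = \<alpha> 0 - 1"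
    and g: "continuous_on {0..T} (g_fun \<alpha>)"
    and \<phi>1: "continuous_on {0..T} \<phi>1" "\<phi>1 0 = 0"
    and der: "\<And>s. 0 < s \<Longrightarrow> s < T \<Longrightarrow> (\<phi>1 has_real_derivative \<phi>2 s) (at s)"
    and \<phi>2: "continuous_on {0<..T} \<phi>2" "\<And>s. 0 < s \<Longrightarrow> s \<le> T \<Longrightarrow> \<bar>\<phi>2 s\<bar> \<le> C * s powr (p - 1)"
    and F: "\<And>s. 0 < s \<Longrightarrow> s \<le> T \<Longrightarrow> integral {0..s} (\<lambda>r. vo_kernel \<alpha> (s - r) * \<phi>2 r) = F s"
    and t: "0 \<le> t" "t \<le> T"
  shows "integral {0..t} (\<lambda>s. g_fun \<alpha> (t - s) * \<phi>1 s) = integral {0..t} (\<lambda>s. beta_kernel (1+p) (t - s) * F s)"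
proof -
  have p0: "0 < p" using ex t by (auto simp: exponent_conditions_def p)
  define G where "G = (\<lambda>x. integral {0..x} (g_fun \<alpha>))"
  have \<phi>2_int: "set_integrable lborel {0..t} \<phi>2"
    by (rule powr_dominated_set_integrable[where q = "p - 1" and C = C])
       (use \<phi>2 p0 t in \<open>auto intro: continuous_on_subset\<close>)
  have "continuous_on {0..t} (beta_kernel (1+p))"
    using p0 beta_kernel_continuous[OF _ continuous_on_id, of "1+p" "{0..t}"] by simp
  from convolution_associative[OF t(1) this vo_kernel_integrable[OF ex t] \<phi>2_int]
  have conv: "((\<lambda>s. beta_kernel (1+p) (t - s) * integral {0..s} (\<lambda>r. vo_kernel \<alpha> (s - r) * \<phi>2 r)) has_integral
      integral {0..t} (\<lambda>r. integral {0..t - r} (\<lambda>s. beta_kernel (1+p) (t - r - s) * vo_kernel \<alpha> s) * \<phi>2 r)) {0..t}" .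
  have "integral {0..t} (\<lambda>r. integral {0..t - r} (\<lambda>s. beta_kernel (1+p) (t - r - s) * vo_kernel \<alpha> s) * \<phi>2 r)
      = integral {0..t} (\<lambda>r. G (t - r) * \<phi>2 r)"
  proof (intro integral_cong arg_cong2[where f = "(*)"] refl)
    fix r assume "r \<in> {0..t}"
    then show "integral {0..t - r} (\<lambda>s. beta_kernel (1+p) (t - r - s) * vo_kernel \<alpha> s) = G (t - r)"
      unfolding G_def using t by (intro g_primitive[OF ex p]) auto
  qed
  also have "\<dots> = integral {0..t} (\<lambda>r. g_fun \<alpha> (t - r) * \<phi>1 r)"
  proof -
    have cont_tr: "continuous_on {0..t} (\<lambda>r. h (t - r))" if "continuous_on {0..T} h" for h :: "real \<Rightarrow> real"
      using t by (intro continuous_on_compose2[OF that]) (auto intro!: continuous_intros)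
    have G_der: "(G has_real_derivative g_fun \<alpha> x) (at x)" if "0 < x" "x < T" for x
    proof -
      have "(G has_real_derivative g_fun \<alpha> x) (at x within {0..T})"
        unfolding G_def using that g by (intro integral_has_real_derivative) auto
      moreover have "at x within {0..T} = at x" using that by (rule at_within_Icc_at)
      ultimately show ?thesis by simp
    qed
    have G_cont: "continuous_on {0..T} G"
      unfolding G_def using g by (intro indefinite_integral_continuous_1 integrable_continuous_interval)
    have "((\<lambda>r. G (t - r) * \<phi>2 r - g_fun \<alpha> (t - r) * \<phi>1 r) has_integral G (t - t) * \<phi>1 t - G (t - 0) * \<phi>1 0) {0..t}"
    proof (rule fundamental_theorem_of_calculus_interior[OF t(1)])
      show "continuous_on {0..t} (\<lambda>r. G (t - r) * \<phi>1 r)"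
        using t by (intro continuous_intros cont_tr G_cont continuous_on_subset[OF \<phi>1(1)]) auto
      fix r assume r: "r \<in> {0<..<t}"
      have "((\<lambda>r. G (t - r)) has_real_derivative g_fun \<alpha> (t - r) * (-1)) (at r)"
        using r t by (intro DERIV_chain2[OF G_der]) (auto intro!: derivative_eq_intros)
      from DERIV_mult[OF this der] r t
      show "((\<lambda>r. G (t - r) * \<phi>1 r) has_vector_derivative G (t - r) * \<phi>2 r - g_fun \<alpha> (t - r) * \<phi>1 r) (at r)"
        by (simp add: has_real_derivative_iff_has_vector_derivative[symmetric] algebra_simps)
    qed
    moreover have "((\<lambda>r. g_fun \<alpha> (t - r) * \<phi>1 r) has_integral integral {0..t} (\<lambda>r. g_fun \<alpha> (t - r) * \<phi>1 r)) {0..t}"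
      using t by (intro integrable_integral integrable_continuous_interval continuous_intros
          cont_tr g continuous_on_subset[OF \<phi>1(1)]) auto
    ultimately have "((\<lambda>r. (G (t - r) * \<phi>2 r - g_fun \<alpha> (t - r) * \<phi>1 r) + g_fun \<alpha> (t - r) * \<phi>1 r) has_integral 0 + integral {0..t} (\<lambda>r. g_fun \<alpha> (t - r) * \<phi>1 r)) {0..t}"
      using \<phi>1(2) by (intro has_integral_add) (simp_all add: G_def)
    then show ?thesis by (simp add: integral_unique)
  qed
  finally have "((\<lambda>s. beta_kernel (1+p) (t - s) * integral {0..s} (\<lambda>r. vo_kernel \<alpha> (s - r) * \<phi>2 r)) has_integral
      integral {0..t} (\<lambda>r. g_fun \<alpha> (t - r) * \<phi>1 r)) {0..t}" using conv by simp
  then have "((\<lambda>s. beta_kernel (1+p) (t - s) * F s) has_integral integral {0..t} (\<lambda>r. g_fun \<alpha> (t - r) * \<phi>1 r)) {0..t}"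
    by (rule has_integral_spike[where S = "{0}", rotated 2]) (use F t in auto)
  then show ?thesis by (simp add: integral_unique)
qed

section \<open>Consistency of the time discretization\<close>

text \<open>A constant may be subtracted from the weight \<open>k\<close>, so only its oscillation counts.\<close>

lemma integral_mean_zero_bound:
  fixes k \<psi> :: "real \<Rightarrow> real"
  assumes ab: "a \<le> b" and cont: "continuous_on {a..b} k" "continuous_on {a..b} \<psi>"
    and zero: "integral {a..b} \<psi> = 0"
    and k: "\<And>s. s \<in> {a..b} \<Longrightarrow> \<bar>k s - c\<bar> \<le> \<kappa>" and v: "\<And>s. s \<in> {a..b} \<Longrightarrow> \<bar>\<psi> s\<bar> \<le> v"
  shows "\<bar>integral {a..b} (\<lambda>s. k s * \<psi> s)\<bar> \<le> \<kappa> * v * (b - a)"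
proof -
  have \<kappa>v: "0 \<le> \<kappa>" "0 \<le> v" using k[of a] v[of a] ab by auto
  have "integral {a..b} (\<lambda>s. k s * \<psi> s) = integral {a..b} (\<lambda>s. (k s - c) * \<psi> s + c * \<psi> s)"
    by (simp add: algebra_simps)
  also have "\<dots> = integral {a..b} (\<lambda>s. (k s - c) * \<psi> s) + integral {a..b} (\<lambda>s. c * \<psi> s)"
    using cont by (intro Henstock_Kurzweil_Integration.integral_add integrable_continuous_interval continuous_intros)
  also have "\<dots> = integral {a..b} (\<lambda>s. (k s - c) * \<psi> s)" using zero by simp
  also have "norm \<dots> \<le> \<kappa> * v * (b - a)"
    using ab cont k v \<kappa>v
    by (intro integral_bound) (auto intro!: continuous_intros mult_mono simp: abs_mult)
  finally show ?thesis by simp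
qed

lemma integral_weight_bound:
  fixes k \<psi> :: "real \<Rightarrow> real"
  assumes cont: "continuous_on {a..b} k" "continuous_on {a..b} \<psi>"
    and k: "\<And>s. s \<in> {a..b} \<Longrightarrow> 0 \<le> k s" and v: "\<And>s. s \<in> {a..b} \<Longrightarrow> \<bar>\<psi> s\<bar> \<le> v"
  shows "\<bar>integral {a..b} (\<lambda>s. k s * \<psi> s)\<bar> \<le> v * integral {a..b} k"
proof -
  have "norm (integral {a..b} (\<lambda>s. k s * \<psi> s)) \<le> integral {a..b} (\<lambda>s. v * k s)"
    using cont k v
    by (intro Henstock_Kurzweil_Integration.integral_norm_bound_integral integrable_continuous_interval continuous_intros)
       (auto simp: abs_mult mult.commute[of v] intro!: mult_left_mono)
  then show ?thesis by simp
qed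

text \<open>Both slopes, that of \<open>f\<close> on \<open>[a, s]\<close> and that of the chord, are values of the derivative inside the interval.
  Only the oscillation \<open>D\<close> of the derivative on the open interval enters, so the derivative may be irregular at the end points.\<close>

lemma linear_interpolation_error:
  fixes f f1 :: "real \<Rightarrow> real"
  assumes ab: "a < b" and cont: "continuous_on {a..b} f"
    and der: "\<And>s. a < s \<Longrightarrow> s < b \<Longrightarrow> (f has_real_derivative f1 s) (at s)"
    and osc: "\<And>r s. a < r \<Longrightarrow> r < b \<Longrightarrow> a < s \<Longrightarrow> s < b \<Longrightarrow> \<bar>f1 r - f1 s\<bar> \<le> D"
    and s: "s \<in> {a..b}"
  shows "\<bar>f s - (f a + (s - a) * ((f b - f a) / (b - a)))\<bar> \<le> (b - a) * D"
proof -
  obtain z where z: "a < z" "z < b" "f b - f a = (b - a) * f1 z"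
    using mean_value_real[OF ab cont der] by blast
  have D: "0 \<le> D" using osc[OF z(1,2) z(1,2)] by simp
  show ?thesis
  proof (cases "s = a")
    case False
    then have "a < s" using s by simp
    obtain y where y: "a < y" "y < s" "f s - f a = (s - a) * f1 y"
      using mean_value_real[OF \<open>a < s\<close>, of f f1] cont der s
      by (metis atLeastAtMost_iff atLeastatMost_subset_iff continuous_on_subset order_refl order_less_le_trans)
    have "(f b - f a) / (b - a) = f1 z" using z(3) ab by simp
    then have "f s - (f a + (s - a) * ((f b - f a) / (b - a))) = (s - a) * (f1 y - f1 z)"
      using y(3) by (simp add: algebra_simps)
    moreover have "\<bar>(s - a) * (f1 y - f1 z)\<bar> \<le> (b - a) * D"
      unfolding abs_mult using s y z ab osc[of y z] by (intro mult_mono) auto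
    ultimately show ?thesis by simp
  qed (use ab D in simp)
qed

lemma has_integral_linear:
  fixes a b c d :: real
  assumes "a \<le> b"
  shows "((\<lambda>s. c + (s - a) * d) has_integral (b - a) * (c + (c + (b - a) * d)) / 2) {a..b}"
proof -
  have "((\<lambda>s. c + (s - a) * d) has_integral (c * (b - a) + (b - a)\<^sup>2 / 2 * d) - (c * (a - a) + (a - a)\<^sup>2 / 2 * d)) {a..b}"
    using assms
    by (intro fundamental_theorem_of_calculus)
       (auto intro!: derivative_eq_intros simp: has_real_derivative_iff_has_vector_derivative[symmetric] field_simps)
  moreover have "(c * (b - a) + (b - a)\<^sup>2 / 2 * d) - (c * (a - a) + (a - a)\<^sup>2 / 2 * d) = (b - a) * (c + (c + (b - a) * d)) / 2"
    by (simp add: power2_eq_square field_simps)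
  ultimately show ?thesis by (simp only:)
qed

lemma trapezoid_error:
  fixes f f1 :: "real \<Rightarrow> real"
  assumes ab: "a < b" and cont: "continuous_on {a..b} f"
    and der: "\<And>s. a < s \<Longrightarrow> s < b \<Longrightarrow> (f has_real_derivative f1 s) (at s)"
    and osc: "\<And>r s. a < r \<Longrightarrow> r < b \<Longrightarrow> a < s \<Longrightarrow> s < b \<Longrightarrow> \<bar>f1 r - f1 s\<bar> \<le> D"
  shows "\<bar>integral {a..b} f - (b - a) * (f a + f b) / 2\<bar> \<le> (b - a)\<^sup>2 * D"
proof -
  let ?d = "(f b - f a) / (b - a)"
  have I: "((\<lambda>s. f a + (s - a) * ?d) has_integral (b - a) * (f a + f b) / 2) {a..b}"
    using has_integral_linear[of a b "f a" ?d] ab by simp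
  have "integral {a..b} f - (b - a) * (f a + f b) / 2 = integral {a..b} (\<lambda>s. f s - (f a + (s - a) * ?d))"
    using I cont by (subst Henstock_Kurzweil_Integration.integral_diff)
      (auto simp: integral_unique intro: integrable_continuous_interval has_integral_integrable)
  also have "norm \<dots> \<le> (b - a) * D * (b - a)"
    using ab by (intro integral_bound linear_interpolation_error[OF ab cont der osc, unfolded real_norm_def[symmetric]])
      (auto intro!: continuous_intros cont)
  finally show ?thesis by (simp add: power2_eq_square algebra_simps)
qed

text \<open>The errors \<open>\<epsilon>\<close> enter through their differences, which need not be smaller than \<open>\<epsilon>\<close> itself; the differences are moved to \<open>y\<close>, whose
  increments are small.\<close>

lemma sum_by_parts_bound:
  fixes \<epsilon> y E u :: "nat \<Rightarrow> real"
  assumes "\<epsilon> 0 = 0" "\<And>m. 1 \<le> m \<Longrightarrow> m \<le> n \<Longrightarrow> \<bar>\<epsilon> m\<bar> \<le> E m"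
    and "y 0 = 0" "\<And>k. 1 \<le> k \<Longrightarrow> k \<le> n \<Longrightarrow> \<bar>y k - y (k - 1)\<bar> \<le> u k"
  shows "\<bar>\<Sum>k=1..n. (\<epsilon> (n - k + 1) - \<epsilon> (n - k)) * y k\<bar> \<le> (\<Sum>k=1..n. E (n - k + 1) * u k)"
proof -
  have "(\<Sum>k=1..n. (\<epsilon> (n - k + 1) - \<epsilon> (n - k)) * y k)
      = (\<Sum>k=1..n. (if k = n then \<epsilon> (Suc 0) else \<epsilon> (Suc (n - k)) - \<epsilon> (Suc (n - k - 1))) * y k)"
    using assms(1) by (intro sum.cong refl) (auto simp: Suc_diff_Suc)
  also have "\<dots> = (\<Sum>k=1..n. \<epsilon> (Suc (n - k)) * (y k - y (k - 1)))"
    using convolution_summation_by_parts[of y "\<lambda>m. \<epsilon> (Suc m)" n] assms(3) by simp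
  also have "\<bar>\<dots>\<bar> \<le> (\<Sum>k=1..n. E (n - k + 1) * u k)"
  proof (rule order_trans[OF sum_abs], rule sum_mono)
    fix k assume "k \<in> {1..n}"
    then have "\<bar>\<epsilon> (Suc (n - k))\<bar> \<le> E (Suc (n - k))" "\<bar>y k - y (k - 1)\<bar> \<le> u k"
      using assms(2)[of "Suc (n - k)"] assms(4)[of k] by auto
    then show "\<bar>\<epsilon> (Suc (n - k)) * (y k - y (k - 1))\<bar> \<le> E (n - k + 1) * u k"
      unfolding abs_mult by (simp add: mult_mono order_trans[OF abs_ge_zero])
  qed
  finally show ?thesis .
qed

lemma integral_cells:
  fixes f :: "real \<Rightarrow> real"
  assumes "0 \<le> \<tau>" "continuous_on {0..real n * \<tau>} f"
  shows "integral {0..real n * \<tau>} f = (\<Sum>k=1..n. integral {real (k - 1) * \<tau>..real k * \<tau>} f)"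
  using assms(2)
proof (induction n)
  case (Suc n)
  have le: "0 \<le> real n * \<tau>" "real n * \<tau> \<le> real (Suc n) * \<tau>"
    using assms(1) by (auto intro: mult_right_mono)
  have "integral {0..real (Suc n) * \<tau>} f
      = integral {0..real n * \<tau>} f + integral {real n * \<tau>..real (Suc n) * \<tau>} f"
    using le Suc.prems by (intro Henstock_Kurzweil_Integration.integral_combine[symmetric] integrable_continuous_interval)
  moreover have "continuous_on {0..real n * \<tau>} f" using Suc.prems le by (auto elim: continuous_on_subset)
  ultimately show ?case using Suc.IH by simp
qed simp

text \<open>Because the kernel vanishes for nonpositive arguments, the convolution at the earlier level may be extended over
  the newest cell, and both are then split into the same cells.\<close>

lemma convolution_increment:
  fixes h \<psi> :: "real \<Rightarrow> real"
  assumes \<tau>: "0 < \<tau>" and n: "1 \<le> n" "real n * \<tau> \<le> T"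
    and h: "continuous_on {..T} h" "\<And>x. x \<le> 0 \<Longrightarrow> h x = 0" and \<psi>: "continuous_on {0..T} \<psi>"
  shows "integral {0..real n * \<tau>} (\<lambda>s. h (real n * \<tau> - s) * \<psi> s)
      - integral {0..real (n - 1) * \<tau>} (\<lambda>s. h (real (n - 1) * \<tau> - s) * \<psi> s)
    = (\<Sum>k=1..n. integral {real (k - 1) * \<tau>..real k * \<tau>}
        (\<lambda>s. (h (real n * \<tau> - s) - h (real (n - 1) * \<tau> - s)) * \<psi> s))"
proof -
  let ?t = "real n * \<tau>" and ?r = "real (n - 1) * \<tau>"
  have le: "0 \<le> ?r" "?r \<le> ?t" using \<tau> n by (auto intro: mult_right_mono)
  have cont: "continuous_on {0..?t} (\<lambda>s. h (c - s) * \<psi> s)" if "c \<le> T" for c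
    using that n by (intro continuous_on_mult continuous_on_compose2[OF h(1)] continuous_on_subset[OF \<psi>])
      (auto intro!: continuous_intros)
  have "integral {0..?r} (\<lambda>s. h (?r - s) * \<psi> s) + integral {?r..?t} (\<lambda>s. h (?r - s) * \<psi> s)
      = integral {0..?t} (\<lambda>s. h (?r - s) * \<psi> s)"
    using le n by (intro Henstock_Kurzweil_Integration.integral_combine integrable_continuous_interval cont) auto
  moreover have "integral {?r..?t} (\<lambda>s. h (?r - s) * \<psi> s) = integral {?r..?t} (\<lambda>s. 0)"
    by (intro integral_cong) (auto simp: h(2))
  ultimately have "integral {0..?t} (\<lambda>s. h (?t - s) * \<psi> s) - integral {0..?r} (\<lambda>s. h (?r - s) * \<psi> s)
      = integral {0..?t} (\<lambda>s. h (?t - s) * \<psi> s) - integral {0..?t} (\<lambda>s. h (?r - s) * \<psi> s)" by simp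
  also have "\<dots> = integral {0..?t} (\<lambda>s. (h (?t - s) - h (?r - s)) * \<psi> s)"
    using le n by (subst Henstock_Kurzweil_Integration.integral_diff[symmetric])
      (auto intro!: integrable_continuous_interval cont simp: left_diff_distrib)
  also have "\<dots> = (\<Sum>k=1..n. integral {real (k - 1) * \<tau>..real k * \<tau>} (\<lambda>s. (h (?t - s) - h (?r - s)) * \<psi> s))"
    using continuous_on_diff[OF cont[of ?t] cont[of ?r]] le n \<tau>
    by (intro integral_cells) (auto simp: left_diff_distrib)
  finally show ?thesis .
qed

text \<open>Over the cell number \<open>k\<close>, a convolution kernel at \<open>t\<^sub>n\<close> is seen at the arguments of the cell number \<open>n - k + 1\<close>.\<close>

lemma integral_cell_reflected:
  fixes f :: "real \<Rightarrow> real \<Rightarrow> real"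
  assumes "1 \<le> k" "k \<le> n"
  shows "integral {real (k - 1) * \<tau>..real k * \<tau>} (\<lambda>s. f (real n * \<tau> - s) (s - real (k - 1) * \<tau>))
    = integral {0..\<tau>} (\<lambda>r. f (real (n - k + 1) * \<tau> - r) r)"
proof -
  have "integral {0..\<tau>} ((\<lambda>s. f (real n * \<tau> - s) (s - real (k - 1) * \<tau>)) \<circ> (+) (real (k - 1) * \<tau>))
     = integral {0 + real (k - 1) * \<tau>..\<tau> + real (k - 1) * \<tau>} (\<lambda>s. f (real n * \<tau> - s) (s - real (k - 1) * \<tau>))"
    by (rule integral_shift_Icc_real)
  moreover have e: "\<tau> + real (k - 1) * \<tau> = real k * \<tau>" "real n * \<tau> - (real (k - 1) * \<tau> + r) = real (n - k + 1) * \<tau> - r" for r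
    using assms by (auto simp: of_nat_diff algebra_simps)
  ultimately show ?thesis by (simp only: o_def e add_0_left add_diff_cancel_left')
qed

context
  fixes T \<tau> :: real and N :: nat and V :: "real \<Rightarrow> real"
  assumes \<tau>: "0 < \<tau>" and N: "real N * \<tau> = T"
    and V_mono: "\<And>r s. 0 \<le> r \<Longrightarrow> r \<le> s \<Longrightarrow> s \<le> T \<Longrightarrow> V r \<le> V s"
begin

private abbreviation (input) t :: "nat \<Rightarrow> real" where "t n \<equiv> real n * \<tau>"

private lemma t_le: "m \<le> n \<Longrightarrow> t m \<le> t n"
  using \<tau> by (simp add: mult_right_mono)

private lemma t_bounds: "k \<le> N \<Longrightarrow> 0 \<le> t k \<and> t k \<le> T"
  using t_le[of k N] \<tau> N by simp

private lemma t_step: "1 \<le> k \<Longrightarrow> t k = t (k - 1) + \<tau>"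
  by (cases k) (auto simp: algebra_simps)

lemma difference_quotient_point:
  fixes \<phi> \<phi>1 :: "real \<Rightarrow> real"
  assumes "continuous_on {0..T} \<phi>" and der: "\<And>s. 0 < s \<Longrightarrow> s < T \<Longrightarrow> (\<phi> has_real_derivative \<phi>1 s) (at s)"
    and k: "1 \<le> k" "k \<le> N"
  obtains \<xi> where "t (k - 1) < \<xi>" "\<xi> < t k" "\<phi> (t k) - \<phi> (t (k - 1)) = \<tau> * \<phi>1 \<xi>"
proof -
  have b: "0 \<le> t (k - 1)" "t k \<le> T" using t_bounds[of k] t_bounds[of "k - 1"] k by auto
  obtain \<xi> where "t (k - 1) < \<xi>" "\<xi> < t k" "\<phi> (t k) - \<phi> (t (k - 1)) = (t k - t (k - 1)) * \<phi>1 \<xi>"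
  proof (rule mean_value_real[of "t (k - 1)" "t k" \<phi> \<phi>1])
    show "t (k - 1) < t k" using t_step[OF k(1)] \<tau> by simp
    show "continuous_on {t (k - 1)..t k} \<phi>" using assms(1) b by (auto elim: continuous_on_subset)
  qed (use der b in auto)
  then show thesis using that t_step[OF k(1)] by simp
qed

text \<open>Difference quotients are values of the derivative, so their increments are controlled by the variation of the derivative over two cells.\<close>

lemma difference_quotient_variation:
  fixes \<phi> \<phi>1 :: "real \<Rightarrow> real"
  assumes \<phi>: "continuous_on {0..T} \<phi>" "\<And>s. 0 < s \<Longrightarrow> s < T \<Longrightarrow> (\<phi> has_real_derivative \<phi>1 s) (at s)"
    and var: "\<And>r s. 0 \<le> r \<Longrightarrow> r \<le> s \<Longrightarrow> s \<le> T \<Longrightarrow> \<bar>\<phi>1 s - \<phi>1 r\<bar> \<le> V s - V r"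
    and k: "2 \<le> k" "k \<le> N"
  shows "\<bar>(\<phi> (t k) - \<phi> (t (k - 1))) / \<tau> - (\<phi> (t (k - 1)) - \<phi> (t (k - 1 - 1))) / \<tau>\<bar>
    \<le> (V (t k) - V (t (k - 1))) + (V (t (k - 1)) - V (t (k - 1 - 1)))"
proof -
  obtain x where x: "t (k - 1) < x" "x < t k" "\<phi> (t k) - \<phi> (t (k - 1)) = \<tau> * \<phi>1 x"
    by (rule difference_quotient_point[OF \<phi>, of k]) (use k in auto)
  obtain y where y: "t (k - 1 - 1) < y" "y < t (k - 1)" "\<phi> (t (k - 1)) - \<phi> (t (k - 1 - 1)) = \<tau> * \<phi>1 y"
    by (rule difference_quotient_point[OF \<phi>, of "k - 1"]) (use k in auto)
  have b: "0 \<le> t (k - 1 - 1)" "t k \<le> T" using t_bounds[of k] t_bounds[of "k - 1 - 1"] k by auto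
  have le: "t (k - 1 - 1) \<le> y" "0 \<le> y" "y \<le> x" "x \<le> T" "x \<le> t k" "0 \<le> x" "y \<le> T"
    using x(1,2) y(1,2) b by linarith+
  have "\<bar>\<phi>1 x - \<phi>1 y\<bar> \<le> V x - V y" using le by (intro var)
  also have "\<dots> \<le> V (t k) - V (t (k - 1 - 1))" using le b by (intro diff_mono V_mono)
  finally show ?thesis using x(3) y(3) \<tau> by simp
qed

lemma first_difference_quotient_bound:
  fixes \<phi> \<phi>1 :: "real \<Rightarrow> real"
  assumes \<phi>: "continuous_on {0..T} \<phi>" "\<And>s. 0 < s \<Longrightarrow> s < T \<Longrightarrow> (\<phi> has_real_derivative \<phi>1 s) (at s)"
    and var: "\<And>r s. 0 \<le> r \<Longrightarrow> r \<le> s \<Longrightarrow> s \<le> T \<Longrightarrow> \<bar>\<phi>1 s - \<phi>1 r\<bar> \<le> V s - V r"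
    and "\<phi>1 0 = 0" and k: "1 \<le> k" "k \<le> N"
  shows "\<bar>(\<phi> (t k) - \<phi> (t (k - 1))) / \<tau>\<bar> \<le> V (t k) - V 0"
proof -
  obtain x where x: "t (k - 1) < x" "x < t k" "\<phi> (t k) - \<phi> (t (k - 1)) = \<tau> * \<phi>1 x"
    by (rule difference_quotient_point[OF \<phi>, of k]) (use k in auto)
  have b: "0 \<le> t (k - 1)" "t k \<le> T" using t_bounds[of k] t_bounds[of "k - 1"] k by auto
  have "\<bar>\<phi>1 x - \<phi>1 0\<bar> \<le> V x - V 0" using x b by (intro var) auto
  also have "\<dots> \<le> V (t k) - V 0" using x b by (intro diff_mono V_mono) auto
  finally show ?thesis using x(3) assms(4) \<tau> by simp
qed

text \<open>The memory term without its instantaneous part has the kernel \<open>h = g - 1\<close>, which vanishes at \<open>0\<close> and is continued by \<open>0\<close>. On each cell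
  \<open>\<phi>1\<close> is its mean, the difference quotient \<open>\<delta>\<close>, plus a remainder of mean zero. The remainder is integrated against the increment \<open>\<Lambda>\<close> of the kernel over one
  time step, and only the oscillation of \<open>\<Lambda>\<close> counts, which is \<open>\<tau>\<close> times a variation of \<open>g'\<close>. For the mean, the scheme replaces the
  integral of \<open>h\<close> over a cell by the trapezoidal rule; these errors are summed by parts against the increments of the
  difference quotients.\<close>

lemma memory_consistency:
  fixes \<phi> \<phi>1 g g1 W :: "real \<Rightarrow> real"
  assumes \<phi>: "continuous_on {0..T} \<phi>" "\<And>s. 0 < s \<Longrightarrow> s < T \<Longrightarrow> (\<phi> has_real_derivative \<phi>1 s) (at s)"
    and \<phi>1: "continuous_on {0..T} \<phi>1" "\<phi>1 0 = 0"
    and var: "\<And>r s. 0 \<le> r \<Longrightarrow> r \<le> s \<Longrightarrow> s \<le> T \<Longrightarrow> \<bar>\<phi>1 s - \<phi>1 r\<bar> \<le> V s - V r"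
    and g: "continuous_on {0..T} g" "g 0 = 1" "\<And>s. 0 < s \<Longrightarrow> s < T \<Longrightarrow> (g has_real_derivative g1 s) (at s)"
    and g1: "\<And>s. 0 < s \<Longrightarrow> s < T \<Longrightarrow> \<bar>g1 s\<bar> \<le> Qg"
      "\<And>r s. 0 < r \<Longrightarrow> r \<le> s \<Longrightarrow> s < T \<Longrightarrow> \<bar>g1 s - g1 r\<bar> \<le> W s - W r"
    and W_mono: "\<And>r s. 0 \<le> r \<Longrightarrow> r \<le> s \<Longrightarrow> s \<le> T \<Longrightarrow> W r \<le> W s"
    and c: "c = (\<lambda>m. if m = 0 then (g \<tau> - g 0) / 2 else (g (t (m + 1)) - g (t (m - 1))) / 2)"
    and \<omega>: "\<omega> = (\<lambda>m. W (t m) - W (t (m - 1)))" and v: "v = (\<lambda>m. V (t m) - V (t (m - 1)))"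
    and n: "1 \<le> n" "n \<le> N"
  shows "\<bar>(integral {0..t n} (\<lambda>s. g (t n - s) * \<phi>1 s) - integral {0..t (n - 1)} (\<lambda>s. g (t (n - 1) - s) * \<phi>1 s))
      - ((\<phi> (t n) - \<phi> (t (n - 1))) + (\<Sum>k=1..n. c (n - k) * (\<phi> (t k) - \<phi> (t (k - 1)))))\<bar>
    \<le> \<tau>\<^sup>2 * (\<Sum>k=1..n. ((if n - k = 0 then Qg else \<omega> (n - k + 1) + \<omega> (n - k)) + \<omega> (n - k + 1)) * (v k + v (k - 1)))"
proof -
  have T: "0 \<le> T" using t_bounds[of 0] by simp
  have tn: "t n \<le> T" "0 \<le> t (n - 1)" "t (n - 1) \<le> T" using t_bounds[of n] t_bounds[of "n - 1"] n by auto
  have v0: "0 \<le> v k" if "k \<le> N" for k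
    unfolding v using t_bounds[of k] t_bounds[of "k - 1"] t_le[of "k - 1" k] V_mono that by auto
  have \<omega>0: "0 \<le> \<omega> k" if "k \<le> N" for k
    unfolding \<omega> using t_bounds[of k] t_bounds[of "k - 1"] t_le[of "k - 1" k] W_mono that by auto
  define h where "h = (\<lambda>x. g (max 0 x) - 1)"
  have h_pos: "h x = g x - 1" if "0 \<le> x" for x using that by (simp add: h_def)
  have h_neg: "h x = 0" if "x \<le> 0" for x using that g(2) by (simp add: h_def max_absorb1)
  have h_cont: "continuous_on {..T} h"
    unfolding h_def using T by (intro continuous_on_diff continuous_on_compose2[OF g(1)]) (auto intro!: continuous_intros)
  have h_der: "(h has_real_derivative g1 s) (at s)" if "0 < s" "s < T" for s
  proof -
    have "((\<lambda>x. g x - 1) has_real_derivative g1 s) (at s)" using g(3)[OF that] by (auto intro!: derivative_eq_intros)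
    then show ?thesis
      by (rule has_field_derivative_transform_within[where d = s]) (use that in \<open>auto simp: h_def dist_real_def\<close>)
  qed
  \<comment> \<open>The constant part \<open>1\<close> of \<open>g\<close> contributes the increment of \<open>\<phi>\<close> over the step.\<close>
  have split: "integral {0..x} (\<lambda>s. g (x - s) * \<phi>1 s) = integral {0..x} (\<lambda>s. h (x - s) * \<phi>1 s) + (\<phi> x - \<phi> 0)"
    if x: "0 \<le> x" "x \<le> T" for x
  proof -
    have "(\<phi>1 has_integral \<phi> x - \<phi> 0) {0..x}"
      using \<phi> x by (intro fundamental_theorem_of_calculus_interior)
        (auto simp: has_real_derivative_iff_has_vector_derivative[symmetric] elim: continuous_on_subset)
    moreover have "(\<lambda>s. h (x - s) * \<phi>1 s) integrable_on {0..x}"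
      using x by (intro integrable_continuous_interval continuous_on_mult continuous_on_compose2[OF h_cont]
          continuous_on_subset[OF \<phi>1(1)]) (auto intro!: continuous_intros)
    ultimately have "integral {0..x} (\<lambda>s. h (x - s) * \<phi>1 s + \<phi>1 s) = integral {0..x} (\<lambda>s. h (x - s) * \<phi>1 s) + (\<phi> x - \<phi> 0)"
      by (subst Henstock_Kurzweil_Integration.integral_add) (auto simp: integral_unique has_integral_integrable)
    moreover have "integral {0..x} (\<lambda>s. g (x - s) * \<phi>1 s) = integral {0..x} (\<lambda>s. h (x - s) * \<phi>1 s + \<phi>1 s)"
      by (intro integral_cong) (simp add: h_pos algebra_simps)
    ultimately show ?thesis by simp
  qed
  define \<Lambda> where "\<Lambda> = (\<lambda>s. h (t n - s) - h (t (n - 1) - s))"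
  \<comment> \<open>Level \<open>0\<close> gets the value \<open>0 = \<phi>1 0\<close>, so that the first increment is again a variation of \<open>\<phi>1\<close>.\<close>
  define \<delta> where "\<delta> = (\<lambda>k. if k = 0 then 0 else (\<phi> (t k) - \<phi> (t (k - 1))) / \<tau>)"
  have cell_bounds: "0 \<le> t (k - 1) \<and> t (k - 1) \<le> t k \<and> t k \<le> t n \<and> t k \<le> T" if "k \<le> n" for k
    using t_bounds[of "k - 1"] t_bounds[of k] t_le[of "k - 1" k] t_le[OF that] that n by simp
  have \<Lambda>_cont: "continuous_on {t (k - 1)..t k} \<Lambda>" if "k \<le> n" for k
    unfolding \<Lambda>_def using tn cell_bounds[OF that]
    by (intro continuous_on_diff continuous_on_compose2[OF h_cont]) (auto intro!: continuous_intros)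
  have \<phi>1_cont: "continuous_on {t (k - 1)..t k} \<phi>1" if "k \<le> n" for k
    using cell_bounds[OF that] by (intro continuous_on_subset[OF \<phi>1(1)]) auto
  have incr: "(integral {0..t n} (\<lambda>s. g (t n - s) * \<phi>1 s) - integral {0..t (n - 1)} (\<lambda>s. g (t (n - 1) - s) * \<phi>1 s))
      = (\<phi> (t n) - \<phi> (t (n - 1))) + (\<Sum>k=1..n. integral {t (k - 1)..t k} (\<lambda>s. \<Lambda> s * \<phi>1 s))"
    using convolution_increment[OF \<tau> n(1) tn(1) h_cont h_neg \<phi>1(1)] split[of "t n"] split[of "t (n - 1)"] tn t_bounds[of n] n
    by (simp add: \<Lambda>_def)
  have cell: "integral {t (k - 1)..t k} (\<lambda>s. \<Lambda> s * \<phi>1 s)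
      = integral {t (k - 1)..t k} (\<lambda>s. \<Lambda> s * (\<phi>1 s - \<delta> k)) + integral {t (k - 1)..t k} \<Lambda> * \<delta> k" if k: "1 \<le> k" "k \<le> n" for k
  proof -
    have "integral {t (k - 1)..t k} (\<lambda>s. \<Lambda> s * \<phi>1 s) = integral {t (k - 1)..t k} (\<lambda>s. \<Lambda> s * (\<phi>1 s - \<delta> k) + \<Lambda> s * \<delta> k)"
      by (simp add: algebra_simps)
    also have "\<dots> = integral {t (k - 1)..t k} (\<lambda>s. \<Lambda> s * (\<phi>1 s - \<delta> k)) + integral {t (k - 1)..t k} (\<lambda>s. \<Lambda> s * \<delta> k)"
      using k by (intro Henstock_Kurzweil_Integration.integral_add integrable_continuous_interval continuous_intros \<Lambda>_cont \<phi>1_cont)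
    finally show ?thesis by simp
  qed
  have fluct: "\<bar>integral {t (k - 1)..t k} (\<lambda>s. \<Lambda> s * (\<phi>1 s - \<delta> k))\<bar>
      \<le> \<tau>\<^sup>2 * ((if n - k = 0 then Qg else \<omega> (n - k + 1) + \<omega> (n - k)) * v k)" if k: "1 \<le> k" "k \<le> n" for k
  proof -
    have kb: "0 \<le> t (k - 1)" "t (k - 1) < t k" "t k \<le> T" "t k \<le> t n"
      using cell_bounds[OF k(2)] t_step[OF k(1)] \<tau> by linarith+
    have "(\<phi>1 has_integral \<phi> (t k) - \<phi> (t (k - 1))) {t (k - 1)..t k}"
      using \<phi> kb by (intro fundamental_theorem_of_calculus_interior)
        (auto simp: has_real_derivative_iff_has_vector_derivative[symmetric] elim: continuous_on_subset)
    then have "((\<lambda>s. \<phi>1 s - \<delta> k) has_integral (\<phi> (t k) - \<phi> (t (k - 1))) - (t k - t (k - 1)) *\<^sub>R \<delta> k) {t (k - 1)..t k}"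
      using kb by (intro has_integral_diff) (metis has_integral_const_real content_real less_imp_le)+
    then have mean: "integral {t (k - 1)..t k} (\<lambda>s. \<phi>1 s - \<delta> k) = 0"
      using t_step[OF k(1)] k \<tau> by (simp add: integral_unique \<delta>_def)
    obtain \<xi> where \<xi>: "t (k - 1) < \<xi>" "\<xi> < t k" "\<phi> (t k) - \<phi> (t (k - 1)) = \<tau> * \<phi>1 \<xi>"
      by (rule difference_quotient_point[OF \<phi>, of k]) (use k n in auto)
    have dev: "\<bar>\<phi>1 s - \<delta> k\<bar> \<le> v k" if s: "s \<in> {t (k - 1)..t k}" for s
    proof -
      have eq: "\<delta> k = \<phi>1 \<xi>" using \<xi>(3) k \<tau> by (simp add: \<delta>_def)
      have "V (t (k - 1)) \<le> V s" "V s \<le> V (t k)" "V (t (k - 1)) \<le> V \<xi>" "V \<xi> \<le> V (t k)"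
        using s \<xi> kb by (auto intro!: V_mono)
      then show ?thesis using var[of s \<xi>] var[of \<xi> s] s \<xi> kb unfolding eq v by (cases "s \<le> \<xi>") auto
    qed
    have osc: "\<bar>\<Lambda> s - \<Lambda> (t k)\<bar> \<le> \<tau> * (if n - k = 0 then Qg else \<omega> (n - k + 1) + \<omega> (n - k))" if s: "s \<in> {t (k - 1)..t k}" for s
    proof (cases "s = t k")
      case True
      have "0 \<le> Qg \<or> n - k \<noteq> 0"
      proof -
        have "0 < T" using kb by simp
        then show ?thesis using g1(1)[of "T/2"] by (auto intro: order_trans[OF abs_ge_zero])
      qed
      then show ?thesis using True \<omega>0[of "n - k + 1"] \<omega>0[of "n - k"] k n \<tau> by auto
    next
      case False
      then have s': "s < t k" "t (k - 1) \<le> s" using s by auto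
      show ?thesis
      proof (cases "k = n")
        case True
        have arg: "t (n - 1) \<le> s" "s < t n" using s' True by auto
        obtain z where z: "0 < z" "z < t n - s" "g (t n - s) - g 0 = (t n - s - 0) * g1 z"
          by (rule mean_value_real[of 0 "t n - s" g g1])
            (use arg tn in \<open>auto intro!: g(3) continuous_on_subset[OF g(1)]\<close>)
        have "\<Lambda> s - \<Lambda> (t k) = g (t n - s) - g 0"
          using arg True g(2) tn by (simp add: \<Lambda>_def h_neg h_pos)
        also have "\<bar>\<dots>\<bar> \<le> \<tau> * Qg"
        proof -
          have "z < T" "t n - s - 0 \<le> \<tau>" "0 \<le> t n - s - 0" using z arg tn t_step[OF n(1)] by linarith+
          with g1(1)[OF z(1)] \<tau> show ?thesis unfolding z(3) abs_mult by (intro mult_mono) auto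
        qed
        finally show ?thesis using True by simp
      next
        case False
        then have kn: "k < n" using k by simp
        have tk: "t k \<le> t (n - 1)" using kn by (intro t_le) auto
        obtain z where z: "s < z" "z < t k" "\<Lambda> (t k) - \<Lambda> s = (t k - s) * (- g1 (t n - z) + g1 (t (n - 1) - z))"
        proof (rule mean_value_real[of s "t k" \<Lambda> "\<lambda>z. - g1 (t n - z) + g1 (t (n - 1) - z)"])
          show "s < t k" by fact
          show "continuous_on {s..t k} \<Lambda>" using s' k by (intro continuous_on_subset[OF \<Lambda>_cont[of k]]) auto
          fix z assume z: "s < z" "z < t k"
          have b: "0 < t n - z" "t n - z < T" "0 < t (n - 1) - z" "t (n - 1) - z < T"
            using z tk tn kb s' t_step[OF n(1)] \<tau> by linarith+
          have "((\<lambda>z. h (t n - z)) has_real_derivative g1 (t n - z) * (-1)) (at z)"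
            by (rule DERIV_chain2[where f = h], rule h_der[OF b(1,2)], auto intro!: derivative_eq_intros)
          moreover have "((\<lambda>z. h (t (n - 1) - z)) has_real_derivative g1 (t (n - 1) - z) * (-1)) (at z)"
            by (rule DERIV_chain2[where f = h], rule h_der[OF b(3,4)], auto intro!: derivative_eq_intros)
          ultimately show "(\<Lambda> has_real_derivative - g1 (t n - z) + g1 (t (n - 1) - z)) (at z)"
            unfolding \<Lambda>_def by (auto dest: DERIV_diff)
        qed (rule that)
        have b: "0 < t (n - 1) - z" "t (n - 1) - z \<le> t n - z" "t n - z < T"
          using z tk tn kb s' t_step[OF n(1)] \<tau> by linarith+
        have e: "t (n - k + 1) = t n - t (k - 1)" "t (n - k - 1) = t (n - 1) - t k"
          using k kn by (auto simp: of_nat_diff algebra_simps)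
        have "\<bar>g1 (t n - z) - g1 (t (n - 1) - z)\<bar> \<le> W (t n - z) - W (t (n - 1) - z)"
          by (rule g1(2)[OF b])
        also have "\<dots> \<le> W (t (n - k + 1)) - W (t (n - k - 1))"
          unfolding e using z kb tn s' tk b by (intro diff_mono W_mono) linarith+
        also have "\<dots> = \<omega> (n - k + 1) + \<omega> (n - k)" unfolding \<omega> by simp
        finally have 1: "\<bar>g1 (t n - z) - g1 (t (n - 1) - z)\<bar> \<le> \<omega> (n - k + 1) + \<omega> (n - k)" .
        have "\<bar>\<Lambda> s - \<Lambda> (t k)\<bar> = \<bar>t k - s\<bar> * \<bar>g1 (t n - z) - g1 (t (n - 1) - z)\<bar>"
          using z(3) by (metis abs_minus_commute abs_mult minus_diff_eq uminus_add_conv_diff add.commute)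
        also have "\<dots> \<le> \<tau> * (\<omega> (n - k + 1) + \<omega> (n - k))"
          using 1 s' t_step[OF k(1)] by (intro mult_mono) auto
        finally show ?thesis using kn by simp
      qed
    qed
    have "\<bar>integral {t (k - 1)..t k} (\<lambda>s. \<Lambda> s * (\<phi>1 s - \<delta> k))\<bar>
      \<le> \<tau> * (if n - k = 0 then Qg else \<omega> (n - k + 1) + \<omega> (n - k)) * v k * (t k - t (k - 1))"
      using kb k osc dev mean
      by (intro integral_mean_zero_bound[where c = "\<Lambda> (t k)"] \<Lambda>_cont continuous_intros \<phi>1_cont) auto
    then show ?thesis using t_step[OF k(1)] by (simp add: power2_eq_square mult_ac)
  qed
  define J where "J = (\<lambda>m. integral {0..\<tau>} (\<lambda>r. h (t m - r)))"
  define tr where "tr = (\<lambda>m. \<tau> * (h (t m) + h (t (m - 1))) / 2)"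
  have J0: "J 0 = 0" unfolding J_def using h_neg by (subst integral_cong[where g = "\<lambda>_. 0"]) auto
  have tr0: "tr 0 = 0" by (simp add: tr_def h_neg)
  have J_cell: "integral {t (k - 1)..t k} \<Lambda> = J (n - k + 1) - J (n - k)" if k: "1 \<le> k" "k \<le> n" for k
  proof -
    have h_int: "(\<lambda>s. h (x - s)) integrable_on {t (k - 1)..t k}" if "x \<le> T" for x
      using that cell_bounds[OF k(2)]
      by (intro integrable_continuous_interval continuous_on_compose2[OF h_cont]) (auto intro!: continuous_intros)
    have "integral {t (k - 1)..t k} \<Lambda> = integral {t (k - 1)..t k} (\<lambda>s. h (t n - s)) - integral {t (k - 1)..t k} (\<lambda>s. h (t (n - 1) - s))"
      unfolding \<Lambda>_def using tn by (intro Henstock_Kurzweil_Integration.integral_diff h_int)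
    also have "integral {t (k - 1)..t k} (\<lambda>s. h (t n - s)) = J (n - k + 1)"
      unfolding J_def using k by (rule integral_cell_reflected)
    also have "integral {t (k - 1)..t k} (\<lambda>s. h (t (n - 1) - s)) = J (n - k)"
    proof (cases "k = n")
      case True
      then have "integral {t (k - 1)..t k} (\<lambda>s. h (t (n - 1) - s)) = integral {t (k - 1)..t k} (\<lambda>s. 0)"
        by (intro integral_cong h_neg) auto
      then show ?thesis using True J0 by simp
    next
      case False
      then show ?thesis using integral_cell_reflected[of k "n - 1" \<tau> "\<lambda>x r. h x"] k
        by (simp add: J_def Suc_diff_Suc)
    qed
    finally show ?thesis .
  qed
  have trap: "\<bar>J m - tr m\<bar> \<le> \<tau>\<^sup>2 * \<omega> m" if m: "1 \<le> m" "m \<le> n" for m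
  proof -
    have mb: "0 \<le> t (m - 1)" "t (m - 1) < t m" "t m \<le> T"
      using cell_bounds[OF m(2)] t_step[OF m(1)] \<tau> by linarith+
    have "J m = integral {t (m - 1)..t m} h"
    proof -
      have "integral {0..\<tau>} (\<lambda>r. h (t m - r)) = integral {-\<tau>..0} (\<lambda>r. h (t m + r))"
        using Henstock_Kurzweil_Integration.integral_reflect_real[where a = 0 and b = \<tau> and f = "\<lambda>r. h (t m - r)"] by simp
      also have "\<dots> = integral {t (m - 1)..t m} h"
        using integral_shift_Icc_real[of "-\<tau>" 0 h "t m"] t_step[OF m(1)] by (simp add: o_def)
      finally show ?thesis by (simp add: J_def)
    qed
    moreover have "\<bar>integral {t (m - 1)..t m} h - (t m - t (m - 1)) * (h (t (m - 1)) + h (t m)) / 2\<bar> \<le> (t m - t (m - 1))\<^sup>2 * \<omega> m"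
    proof (rule trapezoid_error[OF mb(2)])
      show "continuous_on {t (m - 1)..t m} h" using mb by (intro continuous_on_subset[OF h_cont]) auto
      show "(h has_real_derivative g1 s) (at s)" if "t (m - 1) < s" "s < t m" for s
        using that mb by (intro h_der) auto
      fix r s assume rs: "t (m - 1) < r" "r < t m" "t (m - 1) < s" "s < t m"
      have "W (t (m - 1)) \<le> W s" "W s \<le> W (t m)" "W (t (m - 1)) \<le> W r" "W r \<le> W (t m)"
        using rs mb by (auto intro!: W_mono)
      then show "\<bar>g1 r - g1 s\<bar> \<le> \<omega> m"
        using g1(2)[of r s] g1(2)[of s r] rs mb unfolding \<omega> by (cases "r \<le> s") auto
    qed
    ultimately show ?thesis using t_step[OF m(1)] by (simp add: tr_def add.commute)
  qed
  have c_tr: "\<tau> * c (n - k) = tr (n - k + 1) - tr (n - k)" if k: "1 \<le> k" "k \<le> n" for k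
  proof (cases "k = n")
    case True
    then show ?thesis using h_pos[of \<tau>] h_neg[of 0] \<tau> g(2) by (simp add: c tr_def)
  next
    case False
    have "h (t m) = g (t m) - 1" for m using \<tau> by (intro h_pos) simp
    then show ?thesis using False k by (simp add: c tr_def right_diff_distrib distrib_left diff_divide_distrib add_divide_distrib)
  qed
  have abel: "\<bar>\<Sum>k=1..n. ((J (n - k + 1) - tr (n - k + 1)) - (J (n - k) - tr (n - k))) * \<delta> k\<bar>
      \<le> (\<Sum>k=1..n. (\<tau>\<^sup>2 * \<omega> (n - k + 1)) * (v k + v (k - 1)))"
  proof (rule sum_by_parts_bound[where \<epsilon> = "\<lambda>m. J m - tr m"])
    fix k assume k: "1 \<le> k" "k \<le> n"
    show "\<bar>\<delta> k - \<delta> (k - 1)\<bar> \<le> v k + v (k - 1)"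
    proof (cases "k = 1")
      case True
      then show ?thesis using first_difference_quotient_bound[OF \<phi> var \<phi>1(2), of 1] k n
        by (simp add: \<delta>_def v)
    next
      case False
      then show ?thesis using difference_quotient_variation[OF \<phi> var, of k] k n
        by (simp add: \<delta>_def v)
    qed
  qed (use J0 tr0 trap in \<open>auto simp: \<delta>_def\<close>)
  have "(\<Sum>k=1..n. integral {t (k - 1)..t k} (\<lambda>s. \<Lambda> s * \<phi>1 s)) - (\<Sum>k=1..n. c (n - k) * (\<phi> (t k) - \<phi> (t (k - 1))))
      = (\<Sum>k=1..n. integral {t (k - 1)..t k} (\<lambda>s. \<Lambda> s * (\<phi>1 s - \<delta> k)))
        + (\<Sum>k=1..n. ((J (n - k + 1) - tr (n - k + 1)) - (J (n - k) - tr (n - k))) * \<delta> k)"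
    unfolding sum_subtractf[symmetric] sum.distrib[symmetric]
  proof (rule sum.cong[OF refl])
    fix k assume "k \<in> {1..n}"
    then have k: "1 \<le> k" "k \<le> n" by auto
    have "c (n - k) * (\<phi> (t k) - \<phi> (t (k - 1))) = (\<tau> * c (n - k)) * \<delta> k" using k \<tau> by (simp add: \<delta>_def)
    then show "integral {t (k - 1)..t k} (\<lambda>s. \<Lambda> s * \<phi>1 s) - c (n - k) * (\<phi> (t k) - \<phi> (t (k - 1)))
      = integral {t (k - 1)..t k} (\<lambda>s. \<Lambda> s * (\<phi>1 s - \<delta> k))
        + ((J (n - k + 1) - tr (n - k + 1)) - (J (n - k) - tr (n - k))) * \<delta> k"
      unfolding cell[OF k] J_cell[OF k] c_tr[OF k] by (simp add: algebra_simps)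
  qed
  moreover have "\<bar>\<Sum>k=1..n. integral {t (k - 1)..t k} (\<lambda>s. \<Lambda> s * (\<phi>1 s - \<delta> k))\<bar>
      \<le> (\<Sum>k=1..n. \<tau>\<^sup>2 * ((if n - k = 0 then Qg else \<omega> (n - k + 1) + \<omega> (n - k)) * (v k + v (k - 1))))"
  proof (rule order_trans[OF sum_abs], rule sum_mono)
    fix k assume "k \<in> {1..n}"
    then have k: "1 \<le> k" "k \<le> n" by auto
    have "0 < T" using t_bounds[of 1] k n \<tau> by auto
    then have "0 \<le> Qg" using g1(1)[of "T/2"] by (auto intro: order_trans[OF abs_ge_zero])
    then have "\<tau>\<^sup>2 * ((if n - k = 0 then Qg else \<omega> (n - k + 1) + \<omega> (n - k)) * v k)
       \<le> \<tau>\<^sup>2 * ((if n - k = 0 then Qg else \<omega> (n - k + 1) + \<omega> (n - k)) * (v k + v (k - 1)))"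
      using v0[of "k - 1"] \<omega>0[of "n - k + 1"] \<omega>0[of "n - k"] k n by (intro mult_left_mono) auto
    with fluct[OF k] show "\<bar>integral {t (k - 1)..t k} (\<lambda>s. \<Lambda> s * (\<phi>1 s - \<delta> k))\<bar>
       \<le> \<tau>\<^sup>2 * ((if n - k = 0 then Qg else \<omega> (n - k + 1) + \<omega> (n - k)) * (v k + v (k - 1)))" by linarith
  qed
  ultimately have "\<bar>(\<Sum>k=1..n. integral {t (k - 1)..t k} (\<lambda>s. \<Lambda> s * \<phi>1 s)) - (\<Sum>k=1..n. c (n - k) * (\<phi> (t k) - \<phi> (t (k - 1))))\<bar>
     \<le> (\<Sum>k=1..n. \<tau>\<^sup>2 * ((if n - k = 0 then Qg else \<omega> (n - k + 1) + \<omega> (n - k)) * (v k + v (k - 1))))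
      + (\<Sum>k=1..n. (\<tau>\<^sup>2 * \<omega> (n - k + 1)) * (v k + v (k - 1)))"
    using abel by linarith
  also have "\<dots> = \<tau>\<^sup>2 * (\<Sum>k=1..n. ((if n - k = 0 then Qg else \<omega> (n - k + 1) + \<omega> (n - k)) + \<omega> (n - k + 1)) * (v k + v (k - 1)))"
    unfolding sum_distrib_left sum.distrib[symmetric] by (intro sum.cong refl) (simp only: distrib_right distrib_left mult.assoc)
  finally show ?thesis unfolding incr by simp
qed

text \<open>On the cell number \<open>j\<close> the rule replaces \<open>F\<close> by the constant \<open>cv j\<close>. On the later cells the linear interpolant lies in between: the interpolation error is
  \<open>\<tau>\<close> times a variation of the derivative of \<open>F\<close>, and the interpolant minus its mean is a sawtooth of mean zero with slope \<open>\<delta> j\<close>. The sawtooth is only of size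
  \<open>\<tau>\<close>, but its integrals against the convolution kernel depend on \<open>n - j\<close>, so a summation by parts moves the time difference to the slopes. On the
  first cell the slope of the approximation is \<open>0\<close>, and the derivative of \<open>F\<close> is itself a variation because it vanishes at \<open>0\<close>.\<close>

lemma source_consistency:
  fixes F F1 :: "real \<Rightarrow> real"
  assumes p: "0 < p" "p < 1"
    and F: "continuous_on {0..T} F" "\<And>s. 0 < s \<Longrightarrow> s < T \<Longrightarrow> (F has_real_derivative F1 s) (at s)"
    and F1: "F1 0 = 0"
    and var: "\<And>r s. 0 \<le> r \<Longrightarrow> r \<le> s \<Longrightarrow> s \<le> T \<Longrightarrow> \<bar>F1 s - F1 r\<bar> \<le> V s - V r"
    and v: "v = (\<lambda>m. V (t m) - V (t (m - 1)))"
    and n: "1 \<le> n" "n \<le> N"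
  shows "\<bar>(integral {0..t n} (\<lambda>s. beta_kernel (1+p) (t n - s) * F s)
        - integral {0..t (n - 1)} (\<lambda>s. beta_kernel (1+p) (t (n - 1) - s) * F s))
      - (\<Sum>j=1..n. lag_weight p \<tau> (n - j) * (if j = 1 then F (t 1) else (F (t j) + F (t (j - 1))) / 2))\<bar>
    \<le> \<tau>\<^sup>2 * (\<Sum>j=1..n. (lag_weight p \<tau> (n - j) / \<tau>
        + (beta_kernel (1+p) (t (n - j + 1)) - beta_kernel (1+p) (t (n - j)))) * (v j + v (j - 1)))"
proof -
  let ?B = "beta_kernel (1+p)"
  have tn: "t n \<le> T" "0 \<le> t (n - 1)" "t (n - 1) \<le> T" using t_bounds[of n] t_bounds[of "n - 1"] n by auto
  have v0: "0 \<le> v k" if "k \<le> N" for k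
    unfolding v using t_bounds[of k] t_bounds[of "k - 1"] t_le[of "k - 1" k] V_mono that by auto
  have cell_bounds: "0 \<le> t (k - 1) \<and> t (k - 1) \<le> t k \<and> t k \<le> t n \<and> t k \<le> T" if "k \<le> n" for k
    using t_bounds[of "k - 1"] t_bounds[of k] t_le[of "k - 1" k] t_le[OF that] that n by simp
  \<comment> \<open>The kernel is continued by zero, so that the convolutions at two successive levels can be compared on the same cells.\<close>
  define h where "h = (\<lambda>x. ?B (max 0 x))"
  have h_pos: "h x = ?B x" if "0 \<le> x" for x using that by (simp add: h_def)
  have h_neg: "h x = 0" if "x \<le> 0" for x using that by (simp add: h_def max_absorb1)
  have h_cont: "continuous_on S h" for S
    unfolding h_def using p by (intro beta_kernel_continuous continuous_intros) auto
  have h_mono: "h x \<le> h y" if "x \<le> y" for x y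
    unfolding h_def using p that by (intro beta_kernel_mono) auto
  define \<kappa> where "\<kappa> = (\<lambda>s. h (t n - s) - h (t (n - 1) - s))"
  have h_cont': "continuous_on S (\<lambda>s. h (x - s))" for S x
    by (intro continuous_on_compose2[OF h_cont[of UNIV]]) (auto intro!: continuous_intros)
  have \<kappa>_cont: "continuous_on S \<kappa>" for S
    unfolding \<kappa>_def by (intro continuous_on_diff h_cont')
  have \<kappa>_nonneg: "0 \<le> \<kappa> s" for s
    unfolding \<kappa>_def using h_mono[of "t (n - 1) - s" "t n - s"] t_le[of "n - 1" n] by simp
  have F_cont: "continuous_on {t (k - 1)..t k} F" if "k \<le> n" for k
    using cell_bounds[OF that] by (intro continuous_on_subset[OF F(1)]) auto
  have incr: "integral {0..t n} (\<lambda>s. ?B (t n - s) * F s) - integral {0..t (n - 1)} (\<lambda>s. ?B (t (n - 1) - s) * F s)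
      = (\<Sum>k=1..n. integral {t (k - 1)..t k} (\<lambda>s. \<kappa> s * F s))"
  proof -
    have "integral {0..x} (\<lambda>s. ?B (x - s) * F s) = integral {0..x} (\<lambda>s. h (x - s) * F s)" for x
      by (intro integral_cong) (simp add: h_pos)
    then show ?thesis
      using convolution_increment[OF \<tau> n(1) tn(1) h_cont h_neg F(1)] by (simp add: \<kappa>_def)
  qed
  have \<kappa>_int: "integral {t (j - 1)..t j} \<kappa> = lag_weight p \<tau> (n - j)" if j: "1 \<le> j" "j \<le> n" for j
  proof -
    have two: "1 + (1 + p) = 2 + p" by simp
    have I: "integral {t (j - 1)..t j} (\<lambda>s. h (x - s)) = beta_kernel (2+p) (x - t (j - 1)) - beta_kernel (2+p) (x - t j)"
      if "t j \<le> x" for x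
    proof -
      have "integral {t (j - 1)..t j} (\<lambda>s. h (x - s)) = integral {t (j - 1)..t j} (\<lambda>s. ?B (x - s))"
        using that by (intro integral_cong h_pos) auto
      then show ?thesis
        using beta_kernel_integral_reflected[of "1+p" "t (j - 1)" "t j" x] that cell_bounds[OF j(2)] p
        unfolding two by (simp add: integral_unique)
    qed
    have "integral {t (j - 1)..t j} \<kappa>
        = integral {t (j - 1)..t j} (\<lambda>s. h (t n - s)) - integral {t (j - 1)..t j} (\<lambda>s. h (t (n - 1) - s))"
      unfolding \<kappa>_def by (intro Henstock_Kurzweil_Integration.integral_diff integrable_continuous_interval h_cont')
    also have "integral {t (j - 1)..t j} (\<lambda>s. h (t n - s)) = beta_kernel (2+p) (t (Suc (n - j))) - beta_kernel (2+p) (t (n - j))"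
      using I[of "t n"] t_le[OF j(2)] j by (simp add: of_nat_diff algebra_simps)
    also have "integral {t (j - 1)..t j} (\<lambda>s. h (t (n - 1) - s)) = beta_kernel (2+p) (t (n - j)) - beta_kernel (2+p) (t (n - j - 1))"
    proof (cases "j = n")
      case True
      then have "integral {t (j - 1)..t j} (\<lambda>s. h (t (n - 1) - s)) = integral {t (j - 1)..t j} (\<lambda>s. 0)"
        by (intro integral_cong h_neg) auto
      then show ?thesis using True by simp
    next
      case False
      then have "j \<le> n - 1" using j by simp
      then show ?thesis using I[of "t (n - 1)"] t_le[of j "n - 1"] j by (simp add: of_nat_diff algebra_simps)
    qed
    finally show ?thesis by (simp add: lag_weight_def)
  qed
  define cv where "cv = (\<lambda>j. if j = 1 then F (t 1) else (F (t j) + F (t (j - 1))) / 2)"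
  define \<delta> where "\<delta> = (\<lambda>j. if j \<le> 1 then 0 else (F (t j) - F (t (j - 1))) / \<tau>)"
  define P where "P = (\<lambda>j s. cv j + (s - t (j - 1) - \<tau> / 2) * \<delta> j)"
  define C where "C = (\<lambda>m. integral {0..\<tau>} (\<lambda>r. h (t m - r) * (r - \<tau> / 2)))"
  have approx: "\<bar>F s - P j s\<bar> \<le> \<tau> * v j" if j: "1 \<le> j" "j \<le> n" and s: "s \<in> {t (j - 1)..t j}" for j s
  proof (cases "j = 1")
    case True
    have b: "0 \<le> s" "s \<le> \<tau>" "\<tau> \<le> T" using s True cell_bounds[OF j(2)] by auto
    show ?thesis
    proof (cases "s = \<tau>")
      case True
      then show ?thesis using \<open>j = 1\<close> v0[of 1] \<tau> n by (simp add: P_def cv_def \<delta>_def)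
    next
      case False
      then have "s < \<tau>" using b by simp
      obtain z where z: "s < z" "z < \<tau>" "F \<tau> - F s = (\<tau> - s) * F1 z"
        by (rule mean_value_real[OF \<open>s < \<tau>\<close>, of F F1]) (use b in \<open>auto intro!: F(2) continuous_on_subset[OF F(1)]\<close>)
      have "\<bar>F1 z - F1 0\<bar> \<le> V z - V 0" using z b by (intro var) auto
      also have "\<dots> \<le> v j" using z b \<open>j = 1\<close> V_mono[of z \<tau>] by (simp add: v)
      finally have "\<bar>F1 z\<bar> \<le> v j" using F1 by simp
      moreover have "\<bar>F s - P j s\<bar> = (\<tau> - s) * \<bar>F1 z\<bar>"
        using z b \<open>j = 1\<close> by (simp add: P_def cv_def \<delta>_def abs_minus_commute[of "F s"] abs_mult)
      ultimately show ?thesis using b by (simp add: mult_mono)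
    qed
  next
    case False
    have b: "0 \<le> t (j - 1)" "t (j - 1) < t j" "t j \<le> T" "t j - t (j - 1) = \<tau>"
      using cell_bounds[OF j(2)] t_step[OF j(1)] \<tau> by linarith+
    have "\<bar>F s - (F (t (j - 1)) + (s - t (j - 1)) * ((F (t j) - F (t (j - 1))) / (t j - t (j - 1))))\<bar> \<le> (t j - t (j - 1)) * v j"
    proof (rule linear_interpolation_error[OF b(2) F_cont[OF j(2)] F(2) _ s])
      fix x y assume xy: "t (j - 1) < x" "x < t j" "t (j - 1) < y" "y < t j"
      have "V (t (j - 1)) \<le> V x" "V x \<le> V (t j)" "V (t (j - 1)) \<le> V y" "V y \<le> V (t j)"
        using b(1,3) xy by (intro V_mono; linarith)+
      moreover have "0 \<le> x" "x \<le> T" "0 \<le> y" "y \<le> T" using b(1,3) xy by linarith+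
      ultimately show "\<bar>F1 x - F1 y\<bar> \<le> v j" using var[of x y] var[of y x] unfolding v by (cases "x \<le> y") auto
    qed (use b in linarith)+
    moreover have "P j s = F (t (j - 1)) + (s - t (j - 1)) * ((F (t j) - F (t (j - 1))) / (t j - t (j - 1)))"
      unfolding b(4) P_def cv_def \<delta>_def using False j \<tau> by (simp add: field_simps)
    ultimately show ?thesis using b(4) by simp
  qed
  have P_cont: "continuous_on S (P j)" for S j
    unfolding P_def by (intro continuous_intros)
  have fluct: "\<bar>integral {t (j - 1)..t j} (\<lambda>s. \<kappa> s * (F s - P j s))\<bar> \<le> \<tau> * v j * lag_weight p \<tau> (n - j)"
    if j: "1 \<le> j" "j \<le> n" for j
    using integral_weight_bound[OF \<kappa>_cont continuous_on_diff[OF F_cont[OF j(2)] P_cont] \<kappa>_nonneg approx[OF j]]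
    unfolding \<kappa>_int[OF j] by simp
  have C0: "C 0 = 0" unfolding C_def using h_neg by (subst integral_cong[where g = "\<lambda>_. 0"]) auto
  have C_cell: "integral {t (j - 1)..t j} (\<lambda>s. \<kappa> s * (s - t (j - 1) - \<tau> / 2)) = C (n - j + 1) - C (n - j)"
    if j: "1 \<le> j" "j \<le> n" for j
  proof -
    have "integral {t (j - 1)..t j} (\<lambda>s. \<kappa> s * (s - t (j - 1) - \<tau> / 2))
      = integral {t (j - 1)..t j} (\<lambda>s. h (t n - s) * (s - t (j - 1) - \<tau> / 2) - h (t (n - 1) - s) * (s - t (j - 1) - \<tau> / 2))"
      unfolding \<kappa>_def left_diff_distrib ..
    also have "\<dots> = integral {t (j - 1)..t j} (\<lambda>s. h (t n - s) * (s - t (j - 1) - \<tau> / 2))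
        - integral {t (j - 1)..t j} (\<lambda>s. h (t (n - 1) - s) * (s - t (j - 1) - \<tau> / 2))"
      by (intro Henstock_Kurzweil_Integration.integral_diff integrable_continuous_interval continuous_on_mult h_cont')
        (intro continuous_intros)+
    also have "integral {t (j - 1)..t j} (\<lambda>s. h (t n - s) * (s - t (j - 1) - \<tau> / 2)) = C (n - j + 1)"
      unfolding C_def using integral_cell_reflected[of j n \<tau> "\<lambda>x r. h x * (r - \<tau> / 2)"] j by simp
    also have "integral {t (j - 1)..t j} (\<lambda>s. h (t (n - 1) - s) * (s - t (j - 1) - \<tau> / 2)) = C (n - j)"
    proof (cases "j = n")
      case True
      then have "integral {t (j - 1)..t j} (\<lambda>s. h (t (n - 1) - s) * (s - t (j - 1) - \<tau> / 2)) = integral {t (j - 1)..t j} (\<lambda>s. 0)"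
        by (intro integral_cong) (auto simp: h_neg)
      then show ?thesis using True C0 by simp
    next
      case False
      then show ?thesis using integral_cell_reflected[of j "n - 1" \<tau> "\<lambda>x r. h x * (r - \<tau> / 2)"] j
        by (simp add: C_def Suc_diff_Suc)
    qed
    finally show ?thesis .
  qed
  have C_bound: "\<bar>C m\<bar> \<le> \<tau>\<^sup>2 * (?B (t m) - ?B (t (m - 1)))" if m: "1 \<le> m" for m
  proof -
    have "((\<lambda>r. (- (\<tau> / 2)) + (r - 0) * 1) has_integral (\<tau> - 0) * (- (\<tau> / 2) + (- (\<tau> / 2) + (\<tau> - 0) * 1)) / 2) {0..\<tau>}"
      using \<tau> by (intro has_integral_linear) auto
    then have mean: "integral {0..\<tau>} (\<lambda>r. r - \<tau> / 2) = 0" by (simp add: integral_unique)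
    have "\<bar>C m\<bar> \<le> (h (t m) - h (t (m - 1))) * \<tau> * (\<tau> - 0)"
      unfolding C_def
    proof (rule integral_mean_zero_bound[where c = "h (t (m - 1))"])
      show "0 \<le> \<tau>" using \<tau> by simp
      show "continuous_on {0..\<tau>} (\<lambda>r. r - \<tau> / 2)" by (intro continuous_intros)
      fix s assume s: "s \<in> {0..\<tau>}"
      have "h (t (m - 1)) \<le> h (t m - s)" "h (t m - s) \<le> h (t m)"
        using s t_step[OF m] by (auto intro!: h_mono)
      then show "\<bar>h (t m - s) - h (t (m - 1))\<bar> \<le> h (t m) - h (t (m - 1))" by simp
      show "\<bar>s - \<tau> / 2\<bar> \<le> \<tau>" using s by auto
    qed (use mean h_cont' in auto)
    moreover have "h (t k) = ?B (t k)" for k using \<tau> by (intro h_pos) simp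
    ultimately show ?thesis by (simp add: power2_eq_square mult_ac)
  qed
  have abel: "\<bar>\<Sum>j=1..n. (C (n - j + 1) - C (n - j)) * \<delta> j\<bar>
      \<le> (\<Sum>j=1..n. (\<tau>\<^sup>2 * (?B (t (n - j + 1)) - ?B (t (n - j + 1 - 1)))) * (v j + v (j - 1)))"
  proof (rule sum_by_parts_bound)
    fix k assume k: "1 \<le> k" "k \<le> n"
    show "\<bar>\<delta> k - \<delta> (k - 1)\<bar> \<le> v k + v (k - 1)"
    proof -
      consider "k = 1" | "k = 2" | "3 \<le> k" using k by linarith
      then show ?thesis
      proof cases
        case 1
        then show ?thesis using v0[of 1] v0[of 0] n by (simp add: \<delta>_def)
      next
        case 2
        then show ?thesis using first_difference_quotient_bound[OF F var F1, of 2] k n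
          by (simp add: \<delta>_def v)
      next
        case 3
        then have "\<not> k \<le> 1" "\<not> k - 1 \<le> 1" by auto
        then show ?thesis using difference_quotient_variation[OF F var, of k] k n
          by (simp add: \<delta>_def v)
      qed
    qed
  qed (use C0 C_bound in \<open>auto simp: \<delta>_def\<close>)
  have "(\<Sum>j=1..n. integral {t (j - 1)..t j} (\<lambda>s. \<kappa> s * F s)) - (\<Sum>j=1..n. lag_weight p \<tau> (n - j) * cv j)
      = (\<Sum>j=1..n. integral {t (j - 1)..t j} (\<lambda>s. \<kappa> s * (F s - P j s))) + (\<Sum>j=1..n. (C (n - j + 1) - C (n - j)) * \<delta> j)"
    unfolding sum_subtractf[symmetric] sum.distrib[symmetric]
  proof (rule sum.cong[OF refl])
    fix j assume "j \<in> {1..n}"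
    then have j: "1 \<le> j" "j \<le> n" by auto
    let ?I = "{t (j - 1)..t j}"
    have "integral ?I (\<lambda>s. \<kappa> s * F s)
        = integral ?I (\<lambda>s. \<kappa> s * (F s - P j s) + (\<kappa> s * cv j + \<kappa> s * (s - t (j - 1) - \<tau> / 2) * \<delta> j))"
      by (simp add: P_def algebra_simps)
    also have "\<dots> = integral ?I (\<lambda>s. \<kappa> s * (F s - P j s)) + integral ?I (\<lambda>s. \<kappa> s * cv j + \<kappa> s * (s - t (j - 1) - \<tau> / 2) * \<delta> j)"
      using F_cont[OF j(2)] P_cont \<kappa>_cont
      by (intro Henstock_Kurzweil_Integration.integral_add integrable_continuous_interval continuous_on_mult
          continuous_on_diff continuous_on_add continuous_on_const continuous_on_id)
    also have "integral ?I (\<lambda>s. \<kappa> s * cv j + \<kappa> s * (s - t (j - 1) - \<tau> / 2) * \<delta> j)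
        = integral ?I (\<lambda>s. \<kappa> s * cv j) + integral ?I (\<lambda>s. \<kappa> s * (s - t (j - 1) - \<tau> / 2) * \<delta> j)"
      using \<kappa>_cont
      by (intro Henstock_Kurzweil_Integration.integral_add integrable_continuous_interval continuous_on_mult
          continuous_on_diff continuous_on_const continuous_on_id)
    finally show "integral ?I (\<lambda>s. \<kappa> s * F s) - lag_weight p \<tau> (n - j) * cv j
        = integral ?I (\<lambda>s. \<kappa> s * (F s - P j s)) + (C (n - j + 1) - C (n - j)) * \<delta> j"
      using \<kappa>_int[OF j] C_cell[OF j] by simp
  qed
  moreover have "\<bar>\<Sum>j=1..n. integral {t (j - 1)..t j} (\<lambda>s. \<kappa> s * (F s - P j s))\<bar>
      \<le> (\<Sum>j=1..n. \<tau>\<^sup>2 * (lag_weight p \<tau> (n - j) / \<tau> * (v j + v (j - 1))))"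
  proof (rule order_trans[OF sum_abs], rule sum_mono)
    fix j assume "j \<in> {1..n}"
    then have j: "1 \<le> j" "j \<le> n" by auto
    have "\<tau> * v j * lag_weight p \<tau> (n - j) \<le> \<tau> * (v j + v (j - 1)) * lag_weight p \<tau> (n - j)"
      using v0[of "j - 1"] lag_weight_nonneg[OF p \<tau>] j n \<tau> by (intro mult_right_mono mult_left_mono) auto
    also have "\<dots> = \<tau>\<^sup>2 * (lag_weight p \<tau> (n - j) / \<tau> * (v j + v (j - 1)))"
      using \<tau> by (simp add: power2_eq_square)
    finally show "\<bar>integral {t (j - 1)..t j} (\<lambda>s. \<kappa> s * (F s - P j s))\<bar>
      \<le> \<tau>\<^sup>2 * (lag_weight p \<tau> (n - j) / \<tau> * (v j + v (j - 1)))" using fluct[OF j] by linarith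
  qed
  ultimately have "\<bar>(\<Sum>j=1..n. integral {t (j - 1)..t j} (\<lambda>s. \<kappa> s * F s)) - (\<Sum>j=1..n. lag_weight p \<tau> (n - j) * cv j)\<bar>
     \<le> (\<Sum>j=1..n. \<tau>\<^sup>2 * (lag_weight p \<tau> (n - j) / \<tau> * (v j + v (j - 1))))
      + (\<Sum>j=1..n. (\<tau>\<^sup>2 * (?B (t (n - j + 1)) - ?B (t (n - j + 1 - 1)))) * (v j + v (j - 1)))"
    using abel by linarith
  also have "\<dots> = \<tau>\<^sup>2 * (\<Sum>j=1..n. (lag_weight p \<tau> (n - j) / \<tau> + (?B (t (n - j + 1)) - ?B (t (n - j)))) * (v j + v (j - 1)))"
    unfolding sum_distrib_left sum.distrib[symmetric]
    by (intro sum.cong refl) (simp only: distrib_right distrib_left mult.assoc add_diff_cancel_right')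
  finally show ?thesis unfolding incr cv_def .
qed

end

lemma discrete_convolution_sum_le:
  fixes K u :: "nat \<Rightarrow> real"
  assumes K: "\<And>m. m < N \<Longrightarrow> 0 \<le> K m" and u: "\<And>k. 1 \<le> k \<Longrightarrow> k \<le> N \<Longrightarrow> 0 \<le> u k"
  shows "(\<Sum>n=1..N. \<Sum>k=1..n. K (n - k) * u k) \<le> (\<Sum>m<N. K m) * (\<Sum>k=1..N. u k)"
proof -
  have "(\<Sum>n=1..N. \<Sum>k=1..n. K (n - k) * u k) = (\<Sum>n=1..N. \<Sum>k=1..N. if k \<le> n then K (n - k) * u k else 0)"
    by (intro sum.cong refl sum.mono_neutral_cong_left) auto
  also have "\<dots> = (\<Sum>k=1..N. \<Sum>n=1..N. if k \<le> n then K (n - k) * u k else 0)" by (rule sum.swap)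
  also have "\<dots> \<le> (\<Sum>k=1..N. (\<Sum>m<N. K m) * u k)"
  proof (rule sum_mono)
    fix k assume k: "k \<in> {1..N}"
    have "(\<Sum>n=1..N. if k \<le> n then K (n - k) * u k else 0) = (\<Sum>n=k..N. K (n - k) * u k)"
      using k by (intro sum.mono_neutral_cong_right) auto
    also have "\<dots> = (\<Sum>n=k..N. K (n - k)) * u k" by (simp add: sum_distrib_right)
    also have "(\<Sum>n=k..N. K (n - k)) = (\<Sum>m\<le>N - k. K m)"
      by (rule sum.reindex_bij_witness[of _ "\<lambda>m. m + k" "\<lambda>n. n - k"]) (use k in auto)
    also have "\<dots> * u k \<le> (\<Sum>m<N. K m) * u k"
      using k K u by (intro mult_right_mono sum_mono2) auto
    finally show "(\<Sum>n=1..N. if k \<le> n then K (n - k) * u k else 0) \<le> (\<Sum>m<N. K m) * u k" .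
  qed
  finally show ?thesis by (simp add: sum_distrib_left)
qed

section \<open>Consistency of the compact difference operator\<close>

lemma deriv_in_has_derivative:
  assumes "times_diff k S A f" "j < k" "x \<in> A"
  shows "(deriv_in S j f has_real_derivative deriv_in S (Suc j) f x) (at x within S)"
proof -
  have "deriv_in S j f differentiable (at x within S)" using assms by (auto simp: times_diff_def)
  then have "(deriv_in S j f has_vector_derivative vector_derivative (deriv_in S j f) (at x within S)) (at x within S)"
    by (simp add: vector_derivative_works)
  then show ?thesis by (simp add: has_real_derivative_iff_has_vector_derivative deriv_in_def)
qed

lemma deriv_in_0 [simp]: "deriv_in S 0 f = f"
  by (simp add: deriv_in_def)

lemma taylor_six:
  fixes v :: "real \<Rightarrow> real"
  assumes v: "times_diff 6 {a..b} {a..b} v" "\<And>x. x \<in> {a..b} \<Longrightarrow> \<bar>deriv_in {a..b} 6 v x\<bar> \<le> Q"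
    and w: "w \<in> {a..b}" and z: "z \<in> {a..b}"
  defines "d \<equiv> \<lambda>i. deriv_in {a..b} i v w" and "e \<equiv> z - w"
  shows "\<bar>v z - (d 0 + d 1 * e + d 2 * e^2 / 2 + d 3 * e^3 / 6 + d 4 * e^4 / 24 + d 5 * e^5 / 120)\<bar> \<le> Q * \<bar>e\<bar>^6 / 120"
    and "\<bar>deriv_in {a..b} 2 v z - (d 2 + d 3 * e + d 4 * e^2 / 2 + d 5 * e^3 / 6)\<bar> \<le> Q * \<bar>e\<bar>^4 / 6"
proof -
  have six: "Suc (5::nat) = 6" "Suc (3::nat) = 4" by simp_all
  have "norm (deriv_in {a..b} 0 v z - (\<Sum>i\<le>5. deriv_in {a..b} i v w * (z - w) ^ i / fact i)) \<le> Q * norm (z - w) ^ Suc 5 / fact 5"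
    by (rule field_Taylor[where S = "{a..b}"])
       (use v w z in \<open>auto intro!: deriv_in_has_derivative[OF v(1)] simp: six\<close>)
  moreover have "fact 5 = (120::real)" "{..5::nat} = {0,1,2,3,4,5}" by (auto simp: fact_numeral)
  ultimately show "\<bar>v z - (d 0 + d 1 * e + d 2 * e^2 / 2 + d 3 * e^3 / 6 + d 4 * e^4 / 24 + d 5 * e^5 / 120)\<bar> \<le> Q * \<bar>e\<bar>^6 / 120"
    by (simp add: d_def e_def fact_numeral six add.assoc)
  have "norm (deriv_in {a..b} (0 + 2) v z - (\<Sum>i\<le>3. deriv_in {a..b} (i + 2) v w * (z - w) ^ i / fact i)) \<le> Q * norm (z - w) ^ Suc 3 / fact 3"
  proof (rule field_Taylor[where S = "{a..b}" and f = "\<lambda>i. deriv_in {a..b} (i + 2) v"])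
    fix i :: nat and x assume "x \<in> {a..b}" "i \<le> 3"
    then show "(deriv_in {a..b} (i + 2) v has_real_derivative deriv_in {a..b} (Suc i + 2) v x) (at x within {a..b})"
      using deriv_in_has_derivative[OF v(1), of "i + 2" x] by simp
  qed (use v w z in auto)
  moreover have "fact 3 = (6::real)" "{..3::nat} = {0,1,2,3}" by (auto simp: fact_numeral)
  ultimately show "\<bar>deriv_in {a..b} 2 v z - (d 2 + d 3 * e + d 4 * e^2 / 2 + d 5 * e^3 / 6)\<bar> \<le> Q * \<bar>e\<bar>^4 / 6"
    by (simp add: d_def e_def fact_numeral six add.assoc numeral_eq_Suc)
qed

text \<open>Both the average of the second derivative and the second difference quotient equal, up to fourth order, the second derivative at \<open>x\<close> plus
  \<open>H\<^sup>2/12\<close> times the fourth derivative.\<close>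

lemma compact_difference_consistency:
  fixes v :: "real \<Rightarrow> real"
  assumes v: "times_diff 6 {a..b} {a..b} v" "\<And>x. x \<in> {a..b} \<Longrightarrow> \<bar>deriv_in {a..b} 6 v x\<bar> \<le> Q"
    and H: "0 < H" and x: "a \<le> x - H" "x + H \<le> b"
  defines "v2 \<equiv> deriv_in {a..b} 2 v"
  shows "\<bar>(v2 (x - H) + 10 * v2 x + v2 (x + H)) / 12 - (v (x + H) - 2 * v x + v (x - H)) / H\<^sup>2\<bar> \<le> Q * H ^ 4"
proof -
  have X: "x \<in> {a..b}" "x + H \<in> {a..b}" "x - H \<in> {a..b}" using H x by auto
  have Q: "0 \<le> Q" using v(2)[OF X(1)] by simp
  define d where "d = (\<lambda>i. deriv_in {a..b} i v x)"
  define r1 where "r1 = v (x + H) - (d 0 + d 1 * H + d 2 * H^2 / 2 + d 3 * H^3 / 6 + d 4 * H^4 / 24 + d 5 * H^5 / 120)"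
  define r2 where "r2 = v (x - H) - (d 0 - d 1 * H + d 2 * H^2 / 2 - d 3 * H^3 / 6 + d 4 * H^4 / 24 - d 5 * H^5 / 120)"
  define q1 where "q1 = v2 (x + H) - (d 2 + d 3 * H + d 4 * H^2 / 2 + d 5 * H^3 / 6)"
  define q2 where "q2 = v2 (x - H) - (d 2 - d 3 * H + d 4 * H^2 / 2 - d 5 * H^3 / 6)"
  have r: "\<bar>r1\<bar> \<le> Q * H^6 / 120" "\<bar>r2\<bar> \<le> Q * H^6 / 120"
    using taylor_six(1)[OF v X(1,2)] taylor_six(1)[OF v X(1,3)] H by (simp_all add: d_def r1_def r2_def)
  have q: "\<bar>q1\<bar> \<le> Q * H^4 / 6" "\<bar>q2\<bar> \<le> Q * H^4 / 6"
    using taylor_six(2)[OF v X(1,2)] taylor_six(2)[OF v X(1,3)] H by (simp_all add: d_def q1_def q2_def v2_def)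
  have d0: "v x = d 0" "v2 x = d 2" by (simp_all add: d_def v2_def)
  have rs: "v (x + H) = r1 + (d 0 + d 1 * H + d 2 * H^2 / 2 + d 3 * H^3 / 6 + d 4 * H^4 / 24 + d 5 * H^5 / 120)"
    "v (x - H) = r2 + (d 0 - d 1 * H + d 2 * H^2 / 2 - d 3 * H^3 / 6 + d 4 * H^4 / 24 - d 5 * H^5 / 120)"
    "v2 (x + H) = q1 + (d 2 + d 3 * H + d 4 * H^2 / 2 + d 5 * H^3 / 6)"
    "v2 (x - H) = q2 + (d 2 - d 3 * H + d 4 * H^2 / 2 - d 5 * H^3 / 6)"
    by (simp_all add: r1_def r2_def q1_def q2_def)
  have num: "v (x + H) - 2 * v x + v (x - H) = (r1 + r2) + (d 2 + d 4 * H^2 / 12) * H^2"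
    unfolding rs d0 by (simp add: algebra_simps power2_eq_square power4_eq_xxxx)
  have "(v (x + H) - 2 * v x + v (x - H)) / H\<^sup>2 = (r1 + r2) / H\<^sup>2 + (d 2 + d 4 * H^2 / 12)"
    unfolding num using H by (simp add: add_divide_distrib)
  moreover have "(v2 (x - H) + 10 * v2 x + v2 (x + H)) / 12 = (q1 + q2) / 12 + (d 2 + d 4 * H^2 / 12)"
    unfolding rs d0 by (simp add: field_simps)
  ultimately have "(v2 (x - H) + 10 * v2 x + v2 (x + H)) / 12 - (v (x + H) - 2 * v x + v (x - H)) / H\<^sup>2
      = (q1 + q2) / 12 - (r1 + r2) / H\<^sup>2" by (simp only: add_diff_cancel_right)
  also have "\<bar>\<dots>\<bar> \<le> (Q * H^4 / 6 + Q * H^4 / 6) / 12 + (Q * H^6 / 120 + Q * H^6 / 120) / H\<^sup>2"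
  proof -
    have "\<bar>(q1 + q2) / 12\<bar> \<le> (Q * H^4 / 6 + Q * H^4 / 6) / 12" using q abs_triangle_ineq[of q1 q2] by simp
    moreover have "\<bar>(r1 + r2) / H\<^sup>2\<bar> \<le> (Q * H^6 / 120 + Q * H^6 / 120) / H\<^sup>2"
      unfolding abs_divide abs_power2 using r abs_triangle_ineq[of r1 r2] by (intro divide_right_mono) auto
    ultimately show ?thesis by linarith
  qed
  also have "\<dots> = (1/36 + 1/60) * (Q * H^4)" using H by (simp add: field_simps power_add[symmetric] eval_nat_numeral)
  also have "\<dots> \<le> 1 * (Q * H^4)" using Q by (intro mult_right_mono) auto
  finally show ?thesis by simp
qed

text \<open>The six weights reproduce the second derivative of every polynomial of degree at most five. A one-sided formula also covers the end
  points of the interval.\<close>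

lemma one_sided_second_derivative_formula:
  fixes v :: "real \<Rightarrow> real"
  assumes v: "times_diff 6 {a..b} {a..b} v" "\<And>x. x \<in> {a..b} \<Longrightarrow> \<bar>deriv_in {a..b} 6 v x\<bar> \<le> Q"
    and h: "h \<noteq> 0" and x: "x \<in> {a..b}" "x + 5 * h \<in> {a..b}"
  shows "\<bar>deriv_in {a..b} 2 v x - (45 * v x - 154 * v (x + h) + 214 * v (x + 2 * h) - 156 * v (x + 3 * h)
      + 61 * v (x + 4 * h) - 10 * v (x + 5 * h)) / (12 * h\<^sup>2)\<bar> \<le> 400 * Q * h ^ 4"
proof -
  have X: "x + h \<in> {a..b}" "x + 2 * h \<in> {a..b}" "x + 3 * h \<in> {a..b}" "x + 4 * h \<in> {a..b}"
    using x by auto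
  have Q: "0 \<le> Q" using v(2)[OF x(1)] by simp
  define d where "d = (\<lambda>i. deriv_in {a..b} i v x)"
  define r where "r = (\<lambda>k. v (x + k * h) - (d 0 + d 1 * (k * h) + d 2 * (k * h)^2 / 2 + d 3 * (k * h)^3 / 6 + d 4 * (k * h)^4 / 24 + d 5 * (k * h)^5 / 120))"
  have r: "\<bar>r k\<bar> \<le> Q * (\<bar>k\<bar>^6 * h^6) / 120" if "x + k * h \<in> {a..b}" for k
    using taylor_six(1)[OF v x(1) that] by (simp add: d_def r_def abs_mult power_mult_distrib)
  have vr: "v (x + k * h) = r k + (d 0 + d 1 * (k * h) + d 2 * (k * h)^2 / 2 + d 3 * (k * h)^3 / 6 + d 4 * (k * h)^4 / 24 + d 5 * (k * h)^5 / 120)" for k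
    by (simp add: r_def)
  have d0: "v x = d 0" by (simp add: d_def)
  define \<rho> where "\<rho> = - 154 * r 1 + 214 * r 2 - 156 * r 3 + 61 * r 4 - 10 * r 5"
  have num: "45 * v x - 154 * v (x + h) + 214 * v (x + 2 * h) - 156 * v (x + 3 * h)
      + 61 * v (x + 4 * h) - 10 * v (x + 5 * h) = \<rho> + d 2 * (12 * h\<^sup>2)"
    using vr[of 1] vr[of 2] vr[of 3] vr[of 4] vr[of 5]
    by (simp add: d0 \<rho>_def power_mult_distrib algebra_simps)
  have "\<bar>\<rho>\<bar> \<le> 4800 * (Q * h^6)"
    using r[of 1] r[of 2] r[of 3] r[of 4] r[of 5] X x(2) Q unfolding \<rho>_def by (simp add: abs_if split: if_splits)
  then have "\<bar>\<rho> / (12 * h\<^sup>2)\<bar> \<le> 4800 * (Q * h^6) / (12 * h\<^sup>2)"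
    unfolding abs_divide abs_mult abs_power2 abs_numeral by (rule divide_right_mono) simp
  also have "\<dots> = 400 * Q * h^4" using h by (simp add: field_simps power_add[symmetric] eval_nat_numeral)
  finally have *: "\<bar>\<rho> / (12 * h\<^sup>2)\<bar> \<le> 400 * Q * h^4" .
  have "deriv_in {a..b} 2 v x - (\<rho> + d 2 * (12 * h\<^sup>2)) / (12 * h\<^sup>2) = - (\<rho> / (12 * h\<^sup>2))"
    using h by (simp add: d_def add_divide_distrib)
  then show ?thesis unfolding num using * by simp
qed

text \<open>The second derivative is a uniform limit of finite difference quotients: the error of the six-point formula depends only on the common bound
  for the sixth derivatives. So continuity in the parameter passes from the functions to their second derivatives.\<close>

lemma second_derivative_continuous_parameter:
  fixes \<phi> :: "'a::metric_space \<Rightarrow> real \<Rightarrow> real"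
  assumes ab: "a < b" and \<phi>: "\<And>y. y \<in> Y \<Longrightarrow> times_diff 6 {a..b} {a..b} (\<phi> y)"
    "\<And>y x. y \<in> Y \<Longrightarrow> x \<in> {a..b} \<Longrightarrow> \<bar>deriv_in {a..b} 6 (\<phi> y) x\<bar> \<le> Q"
    and cont: "\<And>x. x \<in> {a..b} \<Longrightarrow> continuous_on Y (\<lambda>y. \<phi> y x)" and x: "x \<in> {a..b}"
  shows "continuous_on Y (\<lambda>y. deriv_in {a..b} 2 (\<phi> y) x)"
proof -
  \<comment> \<open>The step points from \<open>x\<close> to the farther end point, so five steps of length at most \<open>(b - a) / 10\<close> stay in the interval.\<close>
  define s :: real where "s = (if x \<le> (a + b) / 2 then 1 else -1)"
  define h where "h = (\<lambda>n. s * ((b - a) / 10) / real (Suc n))"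
  define S where "S = (\<lambda>n y. (45 * \<phi> y x - 154 * \<phi> y (x + h n) + 214 * \<phi> y (x + 2 * h n) - 156 * \<phi> y (x + 3 * h n)
      + 61 * \<phi> y (x + 4 * h n) - 10 * \<phi> y (x + 5 * h n)) / (12 * (h n)\<^sup>2))"
  have h0: "h n \<noteq> 0" for n using ab by (simp add: h_def s_def)
  have hX: "x + c * h n \<in> {a..b}" if "0 \<le> c" "c \<le> 5" for c n
  proof -
    have "c * \<bar>h n\<bar> \<le> 5 * \<bar>h n\<bar>" using that by (intro mult_right_mono) auto
    also have "\<bar>h n\<bar> \<le> (b - a) / 10"
      using ab by (simp add: h_def s_def abs_mult divide_le_eq mult_le_cancel_left1)
    finally have "c * \<bar>h n\<bar> \<le> (b - a) / 2" by simp
    moreover have "a \<le> x" "x \<le> b" using x by auto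
    ultimately show ?thesis
    proof (cases "x \<le> (a + b) / 2")
      case True
      then have "0 \<le> h n" using ab by (simp add: h_def s_def)
      moreover from this have "0 \<le> c * h n" using that by simp
      ultimately show ?thesis using \<open>c * \<bar>h n\<bar> \<le> (b - a) / 2\<close> \<open>a \<le> x\<close> True by simp
    next
      case False
      then have "h n \<le> 0" using ab by (simp add: h_def s_def divide_nonpos_pos)
      moreover from this have "c * h n \<le> 0" using that by (simp add: mult_nonneg_nonpos)
      ultimately show ?thesis using \<open>c * \<bar>h n\<bar> \<le> (b - a) / 2\<close> \<open>x \<le> b\<close> False by simp
    qed
  qed
  have "uniform_limit Y S (\<lambda>y. deriv_in {a..b} 2 (\<phi> y) x) sequentially"
  proof (rule uniform_limitI)
    fix e :: real assume "0 < e"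
    have "(\<lambda>n. 400 * Q * (h n) ^ 4) \<longlonglongrightarrow> 400 * Q * 0 ^ 4"
      unfolding h_def by (intro tendsto_intros LIMSEQ_Suc lim_const_over_n)
    then have "\<forall>\<^sub>F n in sequentially. 400 * Q * (h n) ^ 4 < e"
      using \<open>0 < e\<close> by (intro order_tendstoD(2)[of _ 0]) auto
    then show "\<forall>\<^sub>F n in sequentially. \<forall>y\<in>Y. dist (S n y) (deriv_in {a..b} 2 (\<phi> y) x) < e"
    proof eventually_elim
      case (elim n)
      show ?case
      proof
        fix y assume y: "y \<in> Y"
        have "\<bar>deriv_in {a..b} 2 (\<phi> y) x - S n y\<bar> \<le> 400 * Q * h n ^ 4"
          unfolding S_def using hX[of 5 n] \<phi> y x h0
          by (intro one_sided_second_derivative_formula) auto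
        with elim show "dist (S n y) (deriv_in {a..b} 2 (\<phi> y) x) < e"
          by (simp add: dist_real_def abs_minus_commute)
      qed
    qed
  qed
  moreover have "continuous_on Y (S n)" for n
    unfolding S_def using hX[of 1 n] hX[of 2 n] hX[of 3 n] hX[of 4 n] hX[of 5 n] x h0[of n]
    by (intro continuous_intros cont) auto
  ultimately show ?thesis by (intro uniform_limit_theorem) auto
qed

lemma continuous_on_Times_lipschitz:
  fixes v :: "real \<Rightarrow> real \<Rightarrow> real"
  assumes cont: "\<And>s. s \<in> J \<Longrightarrow> continuous_on X (\<lambda>x. v x s)"
    and lip: "\<And>x s r. x \<in> X \<Longrightarrow> s \<in> J \<Longrightarrow> r \<in> J \<Longrightarrow> \<bar>v x s - v x r\<bar> \<le> L * \<bar>s - r\<bar>"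
  shows "continuous_on (X \<times> J) (\<lambda>(x, s). v x s)"
  unfolding continuous_on_def
proof
  fix z assume z: "z \<in> X \<times> J"
  obtain x s where [simp]: "z = (x, s)" by (cases z)
  have xs: "x \<in> X" "s \<in> J" using z by auto
  have ev: "\<forall>\<^sub>F w in at z within X \<times> J. w \<in> X \<times> J" by (simp add: eventually_at_filter)
  have "((\<lambda>w. v (fst w) (snd w) - v (fst w) s) \<longlongrightarrow> 0) (at z within X \<times> J)"
  proof (rule Lim_null_comparison)
    show "\<forall>\<^sub>F w in at z within X \<times> J. norm (v (fst w) (snd w) - v (fst w) s) \<le> L * \<bar>snd w - s\<bar>"
      using ev by eventually_elim (use lip xs in auto)
    have "((\<lambda>w. L * \<bar>snd w - s\<bar>) \<longlongrightarrow> L * \<bar>snd z - s\<bar>) (at z within X \<times> J)"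
      by (intro tendsto_intros)
    then show "((\<lambda>w. L * \<bar>snd w - s\<bar>) \<longlongrightarrow> 0) (at z within X \<times> J)" by simp
  qed
  moreover have "continuous_on (X \<times> J) (\<lambda>w. v (fst w) s)"
    by (rule continuous_on_compose2[OF cont[OF xs(2)]]) (auto intro: continuous_intros)
  then have "((\<lambda>w. v (fst w) s) \<longlongrightarrow> v (fst z) s) (at z within X \<times> J)"
    using z by (simp add: continuous_on_def)
  ultimately have "((\<lambda>w. (v (fst w) (snd w) - v (fst w) s) + v (fst w) s) \<longlongrightarrow> 0 + v (fst z) s) (at z within X \<times> J)"
    by (rule tendsto_add)
  then show "((\<lambda>(x, s). v x s) \<longlongrightarrow> (case z of (x, s) \<Rightarrow> v x s)) (at z within X \<times> J)"
    by (simp add: case_prod_unfold)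
qed

lemma variation_by_derivative_bound:
  fixes G G' V V' :: "real \<Rightarrow> real"
  assumes "r \<le> s" "continuous_on {r..s} G" "continuous_on {r..s} V"
    and "\<And>x. r < x \<Longrightarrow> x < s \<Longrightarrow> (G has_real_derivative G' x) (at x)"
    and "\<And>x. r < x \<Longrightarrow> x < s \<Longrightarrow> (V has_real_derivative V' x) (at x)"
    and "\<And>x. r < x \<Longrightarrow> x < s \<Longrightarrow> \<bar>G' x\<bar> \<le> V' x"
  shows "\<bar>G s - G r\<bar> \<le> V s - V r"
proof (cases "r = s")
  case False
  then have "norm (G s - G r) \<le> V s - V r"
    using assms by (intro differentiable_bound_general[of r s G V G' V'])
      (auto simp: has_real_derivative_iff_has_vector_derivative)
  then show ?thesis by simp
qed simp

section \<open>The exact solution at a grid node\<close>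

text \<open>The initial value of the derivative is zero because its bound tends to zero with \<open>t\<close>.\<close>

lemma time_regularity:
  fixes w :: "real \<Rightarrow> real"
  assumes T: "0 < T" and p: "0 < p"
    and w: "times_diff 1 {0..T} {0..T} w" "times_diff 2 {0..T} {0<..T} w"
    and cont: "continuous_on {0..T} (deriv_in {0..T} 1 w)"
    and bound: "\<And>t. 0 < t \<Longrightarrow> t \<le> T \<Longrightarrow> \<bar>deriv_in {0..T} 1 w t\<bar> \<le> Q * t powr p"
  shows "continuous_on {0..T} w"
    and "0 < s \<Longrightarrow> s < T \<Longrightarrow> (w has_real_derivative deriv_in {0..T} 1 w s) (at s)"
    and "0 < s \<Longrightarrow> s < T \<Longrightarrow> (deriv_in {0..T} 1 w has_real_derivative deriv_in {0..T} 2 w s) (at s)"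
    and "deriv_in {0..T} 1 w 0 = 0"
    and "s \<in> {0..T} \<Longrightarrow> r \<in> {0..T} \<Longrightarrow> \<bar>w s - w r\<bar> \<le> Q * T powr p * \<bar>s - r\<bar>"
proof -
  show wc: "continuous_on {0..T} w" using times_diff_continuous[OF w(1), of 0] by simp
  show d1: "(w has_real_derivative deriv_in {0..T} 1 w s) (at s)" if "0 < s" "s < T" for s
    using deriv_in_has_derivative[OF w(1), of 0 s] that by (simp add: at_within_Icc_at)
  show "(deriv_in {0..T} 1 w has_real_derivative deriv_in {0..T} 2 w s) (at s)" if "0 < s" "s < T"
    using deriv_in_has_derivative[OF w(2), of 1 s] that by (simp add: at_within_Icc_at numeral_2_eq_2)
  have "\<bar>deriv_in {0..T} 1 w 0\<bar> - Q * 0 powr p \<le> 0"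
  proof (rule continuous_le_on_closure[where f = "\<lambda>t. \<bar>deriv_in {0..T} 1 w t\<bar> - Q * t powr p" and S = "{0<..T}"])
    show "continuous_on (closure {0<..T}) (\<lambda>t. \<bar>deriv_in {0..T} 1 w t\<bar> - Q * t powr p)"
      using T p cont by (auto intro!: continuous_on_diff continuous_on_rabs continuous_on_mult continuous_on_powr_const continuous_on_const continuous_on_id)
  qed (use T bound in auto)
  then show "deriv_in {0..T} 1 w 0 = 0" using p by simp
  have Q: "0 \<le> Q"
  proof -
    have "0 \<le> Q * T powr p" using bound[of T] T by (auto intro: order_trans[OF abs_ge_zero])
    then show ?thesis using T by (simp add: zero_le_mult_iff)
  qed
  have lip: "\<bar>w s - w r\<bar> \<le> Q * T powr p * s - Q * T powr p * r" if "0 \<le> r" "r \<le> s" "s \<le> T" for r s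
  proof (rule variation_by_derivative_bound[where G' = "deriv_in {0..T} 1 w" and V' = "\<lambda>_. Q * T powr p"])
    show "r \<le> s" by fact
    show "continuous_on {r..s} w" using wc that by (auto elim: continuous_on_subset)
    show "continuous_on {r..s} (\<lambda>s. Q * T powr p * s)" by (intro continuous_intros)
    fix x assume x: "r < x" "x < s"
    show "(w has_real_derivative deriv_in {0..T} 1 w x) (at x)" using x that by (intro d1) auto
    show "((\<lambda>s. Q * T powr p * s) has_real_derivative Q * T powr p) (at x)" by (auto intro!: derivative_eq_intros)
    have "\<bar>deriv_in {0..T} 1 w x\<bar> \<le> Q * x powr p" using x that by (intro bound) auto
    also have "\<dots> \<le> Q * T powr p" using x that p Q by (intro mult_left_mono powr_mono2) auto
    finally show "\<bar>deriv_in {0..T} 1 w x\<bar> \<le> Q * T powr p" .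
  qed
  show "\<bar>w s - w r\<bar> \<le> Q * T powr p * \<bar>s - r\<bar>" if "s \<in> {0..T}" "r \<in> {0..T}"
    using lip[of r s] lip[of s r] that
    unfolding right_diff_distrib[symmetric] abs_minus_commute[of "w r"] by (cases "r \<le> s") auto
qed

lemma volterra_integral_continuous:
  fixes k :: "real \<Rightarrow> real" and v :: "real \<Rightarrow> real \<Rightarrow> real"
  assumes k: "continuous_on {0..T} k" and v: "continuous_on (Z \<times> {0..T}) (\<lambda>(z, s). v z s)"
    and t: "t \<in> {0..T}"
  shows "continuous_on Z (\<lambda>z. integral {0..t} (\<lambda>s. k (t - s) * v z s))"
proof -
  have "continuous_on (Z \<times> cbox 0 t) (\<lambda>(z, s). k (t - s) * v z s)"
    unfolding case_prod_unfold using t v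
    by (intro continuous_on_mult continuous_on_compose2[OF k] continuous_on_subset[OF v[unfolded case_prod_unfold]])
      (auto intro!: continuous_intros)
  then show ?thesis using integral_continuous_on_param[of Z 0 t "\<lambda>z s. k (t - s) * v z s"] by simp
qed

text \<open>The hypotheses on the exact solution, with \<open>p\<close> for \<open>\<alpha> 0 - 1\<close>.\<close>

locale regular_solution =
  fixes T p Qg Qf Qu Qff Q\<alpha> lx rx ly ry :: real and \<alpha> f :: "real \<Rightarrow> real"
    and u0 v0 :: "real \<Rightarrow> real \<Rightarrow> real" and u :: spacetime_fun
  assumes T: "0 < T" and p: "0 < p" "p < 1" and Qs: "0 < Qg" "0 < Qf" "0 < Qu" "0 < Qff"
    and lr: "lx < rx" "ly < ry"
    and ex: "exponent_conditions T Q\<alpha> \<alpha>" and p_eq: "p = \<alpha> 0 - 1" and gb: "g_bounds T \<alpha> Qg"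
    and nl: "nonlinearity_conditions Qf f"
    and sol: "exact_solution lx rx ly ry T \<alpha> f u0 v0 u"
    and A1: "regularity_A1 lx rx ly ry T (\<alpha> 0) Qu u" and A2: "regularity_A2 lx rx ly ry T (\<alpha> 0) Qu u"
    and ff: "\<And>x y t. x \<in> {lx..rx} \<Longrightarrow> y \<in> {ly..ry} \<Longrightarrow> t \<in> {0..T} \<Longrightarrow> \<bar>deriv (deriv f) (u x y t)\<bar> \<le> Qff"
begin

abbreviation X where "X \<equiv> {lx..rx}"
abbreviation Y where "Y \<equiv> {ly..ry}"
abbreviation J where "J \<equiv> {0..T}"
abbreviation uxx where "uxx \<equiv> Dx X 2 u"
abbreviation uyy where "uyy \<equiv> Dy Y 2 u"

lemma alpha_minus: "\<alpha> 0 - 1 = p" "\<alpha> 0 - 2 = p - 1"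
  using p_eq by auto

lemma x_regularity: "y \<in> Y \<Longrightarrow> t \<in> J \<Longrightarrow> times_diff 6 X X (\<lambda>x. u x y t)"
  and y_regularity: "x \<in> X \<Longrightarrow> t \<in> J \<Longrightarrow> times_diff 6 Y Y (\<lambda>y. u x y t)"
  using A1 by (auto simp: regularity_A1_def Let_def)

lemma uxx_eq: "uxx x y t = deriv_in X 2 (\<lambda>x. u x y t) x" and uyy_eq: "uyy x y t = deriv_in Y 2 (\<lambda>y. u x y t) y"
  by (simp_all add: Dx_def Dy_def)

lemma cont_on_section:
  assumes "cont_on (X \<times> Y \<times> J') v" "x \<in> X" "y \<in> Y"
  shows "continuous_on J' (v x y)" "continuous_on (X \<times> J') (\<lambda>(x, s). v x y s)" "continuous_on (Y \<times> J') (\<lambda>(y, s). v x y s)"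
proof -
  have c: "continuous_on (X \<times> Y \<times> J') (\<lambda>z. v (fst z) (fst (snd z)) (snd (snd z)))"
    using assms(1) by (simp add: cont_on_def case_prod_unfold)
  have "continuous_on J' (\<lambda>s. v (fst (x, y, s)) (fst (snd (x, y, s))) (snd (snd (x, y, s))))"
    by (rule continuous_on_compose2[OF c]) (use assms in \<open>auto intro!: continuous_intros\<close>)
  then show "continuous_on J' (v x y)" by simp
  have "continuous_on (X \<times> J') (\<lambda>z. v (fst (fst z, y, snd z)) (fst (snd (fst z, y, snd z))) (snd (snd (fst z, y, snd z))))"
    by (rule continuous_on_compose2[OF c]) (use assms in \<open>auto intro!: continuous_intros\<close>)
  then show "continuous_on (X \<times> J') (\<lambda>(x, s). v x y s)" by (simp add: case_prod_unfold)
  have "continuous_on (Y \<times> J') (\<lambda>z. v (fst (x, z)) (fst (snd (x, z))) (snd (snd (x, z))))"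
    by (rule continuous_on_compose2[OF c]) (use assms in \<open>auto intro!: continuous_intros\<close>)
  then show "continuous_on (Y \<times> J') (\<lambda>(y, s). v x y s)" by (simp add: case_prod_unfold)
qed

lemma sixth_derivative_bounds:
  assumes "x \<in> X" "y \<in> Y" "t \<in> J"
  shows "\<bar>deriv_in X 6 (\<lambda>x. u x y t) x\<bar> \<le> Qu" "\<bar>deriv_in Y 6 (\<lambda>y. u x y t) y\<bar> \<le> Qu"
proof -
  have c: "continuous_on J (Dx X 6 u x y)" "continuous_on J (Dy Y 6 u x y)"
    using A1 assms by (auto intro!: cont_on_section simp: regularity_A1_def Let_def)
  have b: "\<bar>Dx X 6 u x y s\<bar> \<le> Qu" "\<bar>Dy Y 6 u x y s\<bar> \<le> Qu" if "s \<in> {0<..T}" for s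
    using A1 assms that by (auto simp: regularity_A1_def Let_def)
  have "\<bar>Dx X 6 u x y t\<bar> \<le> Qu"
    by (rule continuous_le_on_closure[where f = "\<lambda>t. \<bar>Dx X 6 u x y t\<bar>" and S = "{0<..T}"])
      (use T assms b c in \<open>auto intro!: continuous_on_rabs\<close>)
  moreover have "\<bar>Dy Y 6 u x y t\<bar> \<le> Qu"
    by (rule continuous_le_on_closure[where f = "\<lambda>t. \<bar>Dy Y 6 u x y t\<bar>" and S = "{0<..T}"])
      (use T assms b c in \<open>auto intro!: continuous_on_rabs\<close>)
  ultimately show "\<bar>deriv_in X 6 (\<lambda>x. u x y t) x\<bar> \<le> Qu" "\<bar>deriv_in Y 6 (\<lambda>y. u x y t) y\<bar> \<le> Qu"
    by (simp_all add: Dx_def Dy_def)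
qed

lemma time_data:
  assumes xy: "x \<in> X" "y \<in> Y" and w: "w = u \<or> w = uxx \<or> w = uyy"
  shows "times_diff 1 J J (w x y)" "times_diff 2 J {0<..T} (w x y)"
    "cont_on (X \<times> Y \<times> J) (Dt T 1 w)" "continuous_on J (Dt T 1 w x y)"
    "0 < t \<Longrightarrow> t \<le> T \<Longrightarrow> \<bar>Dt T 1 w x y t\<bar> \<le> Qu * t powr p"
    "0 < t \<Longrightarrow> t \<le> T \<Longrightarrow> \<bar>Dt T 2 w x y t\<bar> \<le> Qu * t powr (p - 1)"
proof -
  show "times_diff 1 J J (w x y)" and c: "cont_on (X \<times> Y \<times> J) (Dt T 1 w)"
    and "0 < t \<Longrightarrow> t \<le> T \<Longrightarrow> \<bar>Dt T 1 w x y t\<bar> \<le> Qu * t powr p"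
    using A1 xy w by (auto simp: regularity_A1_def Let_def alpha_minus)
  show "continuous_on J (Dt T 1 w x y)" by (rule cont_on_section(1)[OF c xy])
  have "times_diff 3 J {0<..T} (u x y)" "times_diff 2 J {0<..T} (uxx x y)" "times_diff 2 J {0<..T} (uyy x y)"
    using A2 xy by (auto simp: regularity_A2_def Let_def)
  then show "times_diff 2 J {0<..T} (w x y)" using w by (auto simp: times_diff_def)
  show "0 < t \<Longrightarrow> t \<le> T \<Longrightarrow> \<bar>Dt T 2 w x y t\<bar> \<le> Qu * t powr (p - 1)"
    using A2 xy w by (auto simp: regularity_A2_def Let_def alpha_minus)
qed

lemma Dt_eq: "Dt T k w x y = deriv_in J k (w x y)"
  by (simp add: Dt_def)

lemma time_facts:
  assumes xy: "x \<in> X" "y \<in> Y" and w: "w = u \<or> w = uxx \<or> w = uyy"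
  shows "continuous_on J (w x y)"
    and "0 < s \<Longrightarrow> s < T \<Longrightarrow> (w x y has_real_derivative Dt T 1 w x y s) (at s)"
    and "0 < s \<Longrightarrow> s < T \<Longrightarrow> (Dt T 1 w x y has_real_derivative Dt T 2 w x y s) (at s)"
    and "Dt T 1 w x y 0 = 0"
    and "s \<in> J \<Longrightarrow> r \<in> J \<Longrightarrow> \<bar>w x y s - w x y r\<bar> \<le> Qu * T powr p * \<bar>s - r\<bar>"
  using time_regularity[OF T p(1) time_data(1,2)[OF assms] time_data(4)[OF assms, unfolded Dt_eq]
      time_data(5)[OF assms, unfolded Dt_eq]]
  unfolding Dt_eq by blast+

lemma f_derivative: "(f has_real_derivative deriv f x) (at x)"
  and f'_derivative: "(deriv f has_real_derivative deriv (deriv f) x) (at x)"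
  and f'_bound: "\<bar>deriv f x\<bar> \<le> Qf"
  using nl by (auto simp: nonlinearity_conditions_def DERIV_deriv_iff_real_differentiable)

lemma f_continuous: "continuous_on S f"
  using f_derivative by (meson DERIV_isCont continuous_at_imp_continuous_on)

lemma f_lipschitz: "\<bar>f a - f b\<bar> \<le> Qf * \<bar>a - b\<bar>"
proof -
  have "\<bar>f a - f b\<bar> \<le> Qf * a - Qf * b" if "b \<le> a" for a b
    by (rule variation_by_derivative_bound[where G' = "deriv f" and V' = "\<lambda>_. Qf"])
      (use that f_derivative f_continuous f'_bound in \<open>auto intro!: continuous_intros derivative_eq_intros\<close>)
  from this[of b a] this[of a b] show ?thesis
    unfolding right_diff_distrib[symmetric] abs_minus_commute[of "f b"] by (cases "b \<le> a") auto
qed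

definition source :: spacetime_fun where
  "source x y t = uxx x y t + uyy x y t + f (u x y t)"

text \<open>The first two time derivatives of the source along the solution.\<close>

definition source_t :: spacetime_fun where
  "source_t x y t = Dt T 1 uxx x y t + Dt T 1 uyy x y t + deriv f (u x y t) * Dt T 1 u x y t"

definition source_tt :: spacetime_fun where
  "source_tt x y t = Dt T 2 uxx x y t + Dt T 2 uyy x y t
     + (deriv (deriv f) (u x y t) * Dt T 1 u x y t * Dt T 1 u x y t + deriv f (u x y t) * Dt T 2 u x y t)"

text \<open>\<open>V\<close> is a majorant for the variation in time of \<open>\<partial>\<^sub>tu\<close> and of the time derivative of the source: its derivative \<open>Cv * t powr (p - 1)\<close> dominates
  both second derivatives. The three summands of \<open>Cv\<close> belong to the Laplacian, to the quadratic term of the chain rule for \<open>f(u)\<close>, and to the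
  linear one.\<close>

definition Cv where "Cv = (2 + Qff * Qu * T powr (1 + p) + Qf) * Qu"

definition V where "V t = Cv / p * t powr p"

lemma V_derivative: "0 < s \<Longrightarrow> (V has_real_derivative Cv * s powr (p - 1)) (at s)"
  unfolding V_def using p by (auto intro!: derivative_eq_intros)

lemma V_continuous: "continuous_on {0..a} V"
  unfolding V_def[abs_def] using p by (intro continuous_on_mult continuous_on_powr_const continuous_on_const continuous_on_id) auto

lemma Cv_ge: "Qu \<le> Cv" "0 \<le> Cv"
proof -
  have "1 * Qu \<le> Cv" unfolding Cv_def using Qs by (intro mult_right_mono) auto
  then show "Qu \<le> Cv" "0 \<le> Cv" using Qs by auto
qed

lemma V_mono: "0 \<le> r \<Longrightarrow> r \<le> s \<Longrightarrow> V r \<le> V s"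
  unfolding V_def using p Cv_ge by (intro mult_left_mono powr_mono2) auto

lemma V_0: "V 0 = 0"
  using p by (simp add: V_def)

lemma ut_variation:
  assumes xy: "x \<in> X" "y \<in> Y" and rs: "0 \<le> r" "r \<le> s" "s \<le> T"
  shows "\<bar>Dt T 1 u x y s - Dt T 1 u x y r\<bar> \<le> V s - V r"
proof (rule variation_by_derivative_bound[where G' = "Dt T 2 u x y" and V' = "\<lambda>s. Cv * s powr (p - 1)"])
  show "continuous_on {r..s} (Dt T 1 u x y)" using time_data(4)[OF xy, of u] rs by (auto elim: continuous_on_subset)
  show "continuous_on {r..s} V" using V_continuous[of T] rs by (auto elim: continuous_on_subset)
  fix z assume z: "r < z" "z < s"
  then have z0: "0 < z" "z < T" using rs by auto
  show "(Dt T 1 u x y has_real_derivative Dt T 2 u x y z) (at z)" using time_facts(3)[OF xy, of u] z0 by simp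
  show "(V has_real_derivative Cv * z powr (p - 1)) (at z)" using z0 by (intro V_derivative)
  have "\<bar>Dt T 2 u x y z\<bar> \<le> Qu * z powr (p - 1)" using time_data(6)[OF xy, of u] z0 by simp
  also have "\<dots> \<le> Cv * z powr (p - 1)" using Cv_ge by (intro mult_right_mono) auto
  finally show "\<bar>Dt T 2 u x y z\<bar> \<le> Cv * z powr (p - 1)" .
qed (use rs in auto)

lemma source_time:
  assumes xy: "x \<in> X" "y \<in> Y"
  shows "continuous_on J (source x y)"
    and "\<And>s. 0 < s \<Longrightarrow> s < T \<Longrightarrow> (source x y has_real_derivative source_t x y s) (at s)"
    and "source_t x y 0 = 0"
    and "\<And>r s. 0 \<le> r \<Longrightarrow> r \<le> s \<Longrightarrow> s \<le> T \<Longrightarrow> \<bar>source_t x y s - source_t x y r\<bar> \<le> V s - V r"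
proof -
  show "continuous_on J (source x y)"
    unfolding source_def[abs_def]
    by (intro continuous_on_add continuous_on_compose2[OF f_continuous[of UNIV]] time_facts(1)[OF xy]) auto
  show "(source x y has_real_derivative source_t x y s) (at s)" if s: "0 < s" "s < T" for s
    unfolding source_def[abs_def] source_t_def
    by (intro DERIV_add DERIV_chain2[OF f_derivative] time_facts(2)[OF xy _ s]) auto
  show "source_t x y 0 = 0" using time_facts(4)[OF xy] by (simp add: source_t_def)
  fix r s assume rs: "0 \<le> r" "r \<le> s" "s \<le> T"
  show "\<bar>source_t x y s - source_t x y r\<bar> \<le> V s - V r"
  proof (rule variation_by_derivative_bound[where G' = "source_tt x y" and V' = "\<lambda>s. Cv * s powr (p - 1)"])
    have "continuous_on J (source_t x y)"
      unfolding source_t_def[abs_def]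
      by (intro continuous_on_add continuous_on_mult time_data(4)[OF xy]
          continuous_on_compose2[of UNIV "deriv f", OF _ time_facts(1)[OF xy]])
        (auto intro!: continuous_at_imp_continuous_on DERIV_isCont[OF f'_derivative])
    then show "continuous_on {r..s} (source_t x y)" using rs by (auto elim: continuous_on_subset)
    show "continuous_on {r..s} V" using V_continuous[of T] rs by (auto elim: continuous_on_subset)
    fix z assume z: "r < z" "z < s"
    then have z0: "0 < z" "z < T" using rs by auto
    show "(source_t x y has_real_derivative source_tt x y z) (at z)"
    proof -
      have "((\<lambda>s. deriv f (u x y s)) has_real_derivative deriv (deriv f) (u x y z) * Dt T 1 u x y z) (at z)"
        by (rule DERIV_chain2[OF f'_derivative]) (rule time_facts(2)[OF xy _ z0], simp)
      from DERIV_mult[OF this time_facts(3)[OF xy _ z0, of u]]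
      have "((\<lambda>s. deriv f (u x y s) * Dt T 1 u x y s) has_real_derivative
          deriv (deriv f) (u x y z) * Dt T 1 u x y z * Dt T 1 u x y z + deriv f (u x y z) * Dt T 2 u x y z) (at z)"
        by (simp add: mult.commute)
      then show ?thesis
        unfolding source_t_def[abs_def] source_tt_def by (intro DERIV_add time_facts(3)[OF xy _ z0]) auto
    qed
    show "(V has_real_derivative Cv * z powr (p - 1)) (at z)" using z0 by (intro V_derivative)
    have zz: "z powr p * z powr p \<le> T powr (1 + p) * z powr (p - 1)"
    proof -
      have "z powr p * z powr p = z powr (1 + p) * z powr (p - 1)" by (simp add: powr_add[symmetric])
      also have "\<dots> \<le> T powr (1 + p) * z powr (p - 1)" using z0 p by (intro mult_right_mono powr_mono2) auto
      finally show ?thesis .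
    qed
    have b: "\<bar>Dt T 1 u x y z\<bar> \<le> Qu * z powr p" "\<bar>Dt T 2 w x y z\<bar> \<le> Qu * z powr (p - 1)"
      if "w = u \<or> w = uxx \<or> w = uyy" for w
      using time_data(5)[OF xy, of u z] time_data(6)[OF xy that, of z] z0 by auto
    have "\<bar>deriv (deriv f) (u x y z) * Dt T 1 u x y z * Dt T 1 u x y z\<bar> \<le> Qff * (Qu * z powr p) * (Qu * z powr p)"
      unfolding abs_mult using ff[OF xy, of z] b(1)[of u] z0 Qs by (intro mult_mono) auto
    also have "\<dots> = Qff * Qu * Qu * (z powr p * z powr p)" by simp
    also have "\<dots> \<le> Qff * Qu * Qu * (T powr (1 + p) * z powr (p - 1))" using zz Qs by (intro mult_left_mono) auto
    finally have 1: "\<bar>deriv (deriv f) (u x y z) * Dt T 1 u x y z * Dt T 1 u x y z\<bar> \<le> Qff * Qu * Qu * (T powr (1 + p) * z powr (p - 1))" .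
    have 2: "\<bar>deriv f (u x y z) * Dt T 2 u x y z\<bar> \<le> Qf * (Qu * z powr (p - 1))"
      unfolding abs_mult using f'_bound b(2)[of u] Qs by (intro mult_mono) auto
    have "Cv * z powr (p - 1) = Qu * z powr (p - 1) + Qu * z powr (p - 1)
        + (Qff * Qu * Qu * (T powr (1 + p) * z powr (p - 1)) + Qf * (Qu * z powr (p - 1)))"
      by (simp add: Cv_def algebra_simps)
    then show "\<bar>source_tt x y z\<bar> \<le> Cv * z powr (p - 1)"
      unfolding source_tt_def using 1 2 b(2)[of uxx] b(2)[of uyy] by simp
  qed (use rs in auto)
qed

lemma g_continuous: "continuous_on J (g_fun \<alpha>)"
  using gb times_diff_continuous[of 1 J J "g_fun \<alpha>" 0] by (simp add: g_bounds_def)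

text \<open>In one space variable, \<open>uxx\<close> is continuous along \<open>x\<close> by assumption and along \<open>y\<close> by \<open>second_derivative_continuous_parameter\<close>; in time it is Lipschitz
  continuous uniformly in space. The same holds with \<open>x\<close> and \<open>y\<close> exchanged.\<close>

lemma source_joint_continuity:
  "y \<in> Y \<Longrightarrow> continuous_on (X \<times> J) (\<lambda>(x, s). source x y s)"
  "x \<in> X \<Longrightarrow> continuous_on (Y \<times> J) (\<lambda>(y, s). source x y s)"
proof -
  have u_x: "continuous_on X (\<lambda>x. u x y s)" and uxx_x: "continuous_on X (\<lambda>x. uxx x y s)" if "y \<in> Y" "s \<in> J" for y s
    using times_diff_continuous[OF x_regularity[OF that], of 0] times_diff_continuous[OF x_regularity[OF that], of 2]
    by (simp_all add: Dx_def)
  have u_y: "continuous_on Y (\<lambda>y. u x y s)" and uyy_y: "continuous_on Y (\<lambda>y. uyy x y s)" if "x \<in> X" "s \<in> J" for x s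
    using times_diff_continuous[OF y_regularity[OF that], of 0] times_diff_continuous[OF y_regularity[OF that], of 2]
    by (simp_all add: Dy_def)
  have uyy_x: "continuous_on X (\<lambda>x. uyy x y s)" if "y \<in> Y" "s \<in> J" for y s
    unfolding uyy_eq using that sixth_derivative_bounds y_regularity u_x
    by (intro second_derivative_continuous_parameter[OF lr(2), where Q = Qu]) auto
  have uxx_y: "continuous_on Y (\<lambda>y. uxx x y s)" if "x \<in> X" "s \<in> J" for x s
    unfolding uxx_eq using that sixth_derivative_bounds x_regularity u_y
    by (intro second_derivative_continuous_parameter[OF lr(1), where \<phi> = "\<lambda>y x. u x y s" and Q = Qu]) auto
  show "continuous_on (X \<times> J) (\<lambda>(x, s). source x y s)" if y: "y \<in> Y"
  proof -
    have j: "continuous_on (X \<times> J) (\<lambda>(x, s). w x y s)" if "w = u \<or> w = uxx \<or> w = uyy" for w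
      by (rule continuous_on_Times_lipschitz[where L = "Qu * T powr p"])
        (use that y u_x uxx_x uyy_x time_facts(5)[OF _ y that] in auto)
    have "continuous_on (X \<times> J) (\<lambda>z. uxx (fst z) y (snd z) + uyy (fst z) y (snd z) + f (u (fst z) y (snd z)))"
      using j[of u] j[of uxx] j[of uyy] unfolding case_prod_unfold
      by (intro continuous_on_add continuous_on_compose2[OF f_continuous[of UNIV]]) auto
    then show ?thesis by (simp add: source_def case_prod_unfold)
  qed
  show "continuous_on (Y \<times> J) (\<lambda>(y, s). source x y s)" if x: "x \<in> X"
  proof -
    have j: "continuous_on (Y \<times> J) (\<lambda>(y, s). w x y s)" if "w = u \<or> w = uxx \<or> w = uyy" for w
      by (rule continuous_on_Times_lipschitz[where L = "Qu * T powr p"])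
        (use that x u_y uxx_y uyy_y time_facts(5)[OF x _ that] in auto)
    have "continuous_on (Y \<times> J) (\<lambda>z. uxx x (fst z) (snd z) + uyy x (fst z) (snd z) + f (u x (fst z) (snd z)))"
      using j[of u] j[of uxx] j[of uyy] unfolding case_prod_unfold
      by (intro continuous_on_add continuous_on_compose2[OF f_continuous[of UNIV]]) auto
    then show ?thesis by (simp add: source_def case_prod_unfold)
  qed
qed

text \<open>Inside the domain this is the equation convolved with the kernel of order \<open>1 + p\<close>. The difference \<open>D\<close> of both sides is continuous in each space variable
  separately, so it vanishes first up to the sides \<open>x = lx\<close> and \<open>x = rx\<close>, and then on the whole closed rectangle.\<close>

lemma integrated_equation:
  assumes xy: "x \<in> X" "y \<in> Y" and t: "t \<in> J"
  shows "integral {0..t} (\<lambda>s. g_fun \<alpha> (t - s) * Dt T 1 u x y s)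
       = integral {0..t} (\<lambda>s. beta_kernel (1+p) (t - s) * source x y s)"
proof -
  define D where "D = (\<lambda>x y. integral {0..t} (\<lambda>s. g_fun \<alpha> (t - s) * Dt T 1 u x y s)
      - integral {0..t} (\<lambda>s. beta_kernel (1+p) (t - s) * source x y s))"
  have B: "continuous_on J (beta_kernel (1+p))"
    using beta_kernel_continuous[OF _ continuous_on_id, of "1+p" J] p by simp
  have D_interior: "D x y = 0" if i: "x \<in> {lx<..<rx}" "y \<in> {ly<..<ry}" for x y
  proof -
    have ixy: "x \<in> X" "y \<in> Y" using i by auto
    have "cont_on (X \<times> Y \<times> {0<..T}) (Dt T 2 u)" using A2 by (auto simp: regularity_A2_def Let_def)
    then have c2: "continuous_on {0<..T} (Dt T 2 u x y)" by (rule cont_on_section(1)[OF _ ixy])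
    have eq: "integral {0..s} (\<lambda>r. vo_kernel \<alpha> (s - r) * Dt T 2 u x y r) = source x y s" if "0 < s" "s \<le> T" for s
    proof -
      have "caputo_vo T \<alpha> u x y s - (uxx x y s + uyy x y s) = f (u x y s)"
        using sol i that by (auto simp: exact_solution_def)
      then show ?thesis by (simp add: caputo_vo_def source_def)
    qed
    have "integral {0..t} (\<lambda>s. g_fun \<alpha> (t - s) * Dt T 1 u x y s) = integral {0..t} (\<lambda>s. beta_kernel (1+p) (t - s) * source x y s)"
      by (rule caputo_integrated[OF ex p_eq g_continuous time_data(4)[OF ixy] time_facts(4)[OF ixy]
          time_facts(3)[OF ixy] c2 time_data(6)[OF ixy] eq])
        (use t in auto)
    then show ?thesis by (simp add: D_def)
  qed
  have D_x: "continuous_on X (\<lambda>x. D x y)" if "y \<in> Y" for y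
    unfolding D_def using lr that
    by (intro continuous_on_diff volterra_integral_continuous[OF g_continuous _ t] volterra_integral_continuous[OF B _ t]
        source_joint_continuity cont_on_section(2)[OF time_data(3), of lx y]) auto
  have D_y: "continuous_on Y (\<lambda>y. D x y)" if "x \<in> X" for x
    unfolding D_def using lr that
    by (intro continuous_on_diff volterra_integral_continuous[OF g_continuous _ t] volterra_integral_continuous[OF B _ t]
        source_joint_continuity cont_on_section(3)[OF time_data(3), of x ly]) auto
  have strip: "D x y = 0" if "x \<in> X" "y \<in> {ly<..<ry}" for x y
    by (rule continuous_constant_on_closure[of "{lx<..<rx}" "\<lambda>x. D x y"])
      (use that lr D_x[of y] D_interior in auto)
  have "D x y = 0"
    by (rule continuous_constant_on_closure[of "{ly<..<ry}" "\<lambda>y. D x y"])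
      (use xy lr D_y[of x] strip in auto)
  then show ?thesis by (simp add: D_def)
qed

lemma initial_velocity_zero:
  assumes "x \<in> X" "y \<in> Y" shows "v0 x y = 0"
proof -
  have c: "continuous_on (closure ({lx<..<rx} \<times> {ly<..<ry})) (\<lambda>z. v0 (fst z) (snd z))"
    using sol lr by (simp add: exact_solution_def closure_Times case_prod_unfold)
  have z: "v0 (fst z) (snd z) = 0" if "z \<in> {lx<..<rx} \<times> {ly<..<ry}" for z
    using sol that time_facts(4)[of "fst z" "snd z" u] by (auto simp: exact_solution_def)
  show ?thesis
    using continuous_constant_on_closure[OF c z, of "(x, y)"] assms lr by (simp add: closure_Times)
qed

text \<open>\<open>W\<close> is a majorant for the variation of \<open>g'\<close>. Its derivative is obtained from \<open>\<bar>ln t\<bar> \<le> 2 t\<^sup>-\<^sup>1\<^sup>/\<^sup>2 + 2 t\<^sup>1\<^sup>/\<^sup>2\<close>, so that \<open>W\<close> is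
  explicit and depends on \<open>Qg\<close> only.\<close>

definition W where "W t = Qg * (4 * t powr (1/2) + 4/3 * t powr (3/2) + t)"

lemma W_mono: "0 \<le> r \<Longrightarrow> r \<le> s \<Longrightarrow> W r \<le> W s"
  unfolding W_def using Qs by (intro mult_left_mono add_mono powr_mono2) auto

lemma W_0: "W 0 = 0"
  by (simp add: W_def)

lemma g_first_derivative: "0 < s \<Longrightarrow> s < T \<Longrightarrow> (g_fun \<alpha> has_real_derivative deriv_in J 1 (g_fun \<alpha>) s) (at s)"
  using gb deriv_in_has_derivative[of 1 J J "g_fun \<alpha>" 0 s] by (simp add: g_bounds_def at_within_Icc_at)

lemma g_first_derivative_bound: "0 < s \<Longrightarrow> s < T \<Longrightarrow> \<bar>deriv_in J 1 (g_fun \<alpha>) s\<bar> \<le> Qg"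
  using gb by (simp add: g_bounds_def)

lemma g_variation:
  assumes rs: "0 < r" "r \<le> s" "s < T"
  shows "\<bar>deriv_in J 1 (g_fun \<alpha>) s - deriv_in J 1 (g_fun \<alpha>) r\<bar> \<le> W s - W r"
proof (rule variation_by_derivative_bound[where G' = "deriv_in J 2 (g_fun \<alpha>)"
      and V' = "\<lambda>t. Qg * (2 * t powr (- (1/2)) + 2 * t powr (1/2) + 1)"])
  have td: "times_diff 2 J {0<..T} (g_fun \<alpha>)" using gb by (simp add: g_bounds_def)
  show "continuous_on {r..s} (deriv_in J 1 (g_fun \<alpha>))"
    by (rule continuous_on_subset[OF times_diff_continuous[OF td]]) (use rs in auto)
  show "continuous_on {r..s} W"
    unfolding W_def[abs_def] using rs by (intro continuous_intros) auto
  fix z assume z: "r < z" "z < s"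
  then have z0: "0 < z" "z < T" using rs by auto
  show "(deriv_in J 1 (g_fun \<alpha>) has_real_derivative deriv_in J 2 (g_fun \<alpha>) z) (at z)"
    using deriv_in_has_derivative[OF td, of 1 z] z0 by (simp add: at_within_Icc_at numeral_2_eq_2)
  show "(W has_real_derivative Qg * (2 * z powr (- (1/2)) + 2 * z powr (1/2) + 1)) (at z)"
    unfolding W_def[abs_def] using z0 by (auto intro!: derivative_eq_intros)
  have "\<bar>ln z\<bar> \<le> 2 * z powr (- (1/2)) + 2 * z powr (1/2)"
  proof -
    have "0 \<le> z powr (1/2)" "0 \<le> z powr (- (1/2))" by simp_all
    moreover have "ln z \<le> 2 * z powr (1/2)" "- ln z \<le> 2 * z powr (- (1/2))"
      using ln_bound[of "z powr (1/2)"] ln_bound[of "z powr (- (1/2))"] z0 by (simp_all add: ln_powr)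
    ultimately show ?thesis by (intro abs_leI; linarith)
  qed
  then have "Qg * (\<bar>ln z\<bar> + 1) \<le> Qg * (2 * z powr (- (1/2)) + 2 * z powr (1/2) + 1)"
    using Qs by (intro mult_left_mono) auto
  moreover have "\<bar>deriv_in J 2 (g_fun \<alpha>) z\<bar> \<le> Qg * (\<bar>ln z\<bar> + 1)"
    using gb z0 by (auto simp: g_bounds_def)
  ultimately show "\<bar>deriv_in J 2 (g_fun \<alpha>) z\<bar> \<le> Qg * (2 * z powr (- (1/2)) + 2 * z powr (1/2) + 1)" by linarith
qed (use rs in auto)

end

section \<open>The error equation\<close>

lemma A_op_linear: "A_op Mx My (\<lambda>i j. c * v i j + d * w i j) i j = c * A_op Mx My v i j + d * A_op Mx My w i j"
  by (auto simp: A_op_def Ax_def Ay_def field_simps)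

lemma Lambda_op_linear:
  "Lambda_op Mx My Hx Hy (\<lambda>i j. c * v i j + d * w i j) i j = c * Lambda_op Mx My Hx Hy v i j + d * Lambda_op Mx My Hx Hy w i j"
  by (auto simp: Lambda_op_def Ax_def Ay_def delta2x_def delta2y_def add_divide_distrib diff_divide_distrib algebra_simps)

lemma A_op_add: "A_op Mx My (\<lambda>i j. v i j + w i j) i j = A_op Mx My v i j + A_op Mx My w i j"
  using A_op_linear[of Mx My 1 v 1 w] by simp

lemma A_op_diff: "A_op Mx My (\<lambda>i j. v i j - w i j) i j = A_op Mx My v i j - A_op Mx My w i j"
  using A_op_linear[of Mx My 1 v "-1" w] by simp

lemma A_op_sum: "A_op Mx My (\<lambda>i j. \<Sum>k\<in>I. c k * v k i j) i j = (\<Sum>k\<in>I. c k * A_op Mx My (v k) i j)"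
proof (induction I rule: infinite_finite_induct)
  case (insert x F)
  then show ?case using A_op_linear[of Mx My "c x" "v x" 1 "\<lambda>i j. \<Sum>k\<in>F. c k * v k i j"] by simp
qed (simp_all add: A_op_def Ax_def Ay_def)

lemma A_op_cell_value:
  "A_op Mx My (cell_value v n) i j = (if n = 1 then A_op Mx My (v 1) i j else (A_op Mx My (v n) i j + A_op Mx My (v (n - 1)) i j) / 2)"
  using A_op_linear[of Mx My "1/2" "v n" "1/2" "v (n - 1)"] by (simp add: cell_value_def add_divide_distrib)

lemma Lambda_op_cell_value:
  "Lambda_op Mx My Hx Hy (cell_value v n) i j
    = (if n = 1 then Lambda_op Mx My Hx Hy (v 1) i j else (Lambda_op Mx My Hx Hy (v n) i j + Lambda_op Mx My Hx Hy (v (n - 1)) i j) / 2)"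
  using Lambda_op_linear[of Mx My Hx Hy "1/2" "v n" "1/2" "v (n - 1)"] by (simp add: cell_value_def add_divide_distrib)

lemma A_op_bound:
  assumes "(i, j) \<in> grid_int Mx My" "\<And>i j. i \<le> Mx \<Longrightarrow> j \<le> My \<Longrightarrow> \<bar>v i j\<bar> \<le> b"
  shows "\<bar>A_op Mx My v i j\<bar> \<le> b"
proof -
  have ij: "0 < i" "i < Mx" "0 < j" "j < My" using assms(1) by (auto simp: grid_int_def)
  have avg: "\<bar>(a + 10 * c + d) / 12\<bar> \<le> b" if "\<bar>a\<bar> \<le> b" "\<bar>c\<bar> \<le> b" "\<bar>d\<bar> \<le> b" for a c d :: real
    using that by (simp add: abs_le_iff)
  have y: "\<bar>Ay My v i' j\<bar> \<le> b" if "i' \<le> Mx" for i'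
  proof -
    have "Ay My v i' j = (v i' (j - 1) + 10 * v i' j + v i' (j + 1)) / 12" using ij by (simp add: Ay_def)
    then show ?thesis using avg[of "v i' (j - 1)" "v i' j" "v i' (j + 1)"] ij assms(2) that by simp
  qed
  have "A_op Mx My v i j = (Ay My v (i - 1) j + 10 * Ay My v i j + Ay My v (i + 1) j) / 12"
    using ij by (simp add: A_op_def Ax_def)
  then show ?thesis using avg[of "Ay My v (i - 1) j" "Ay My v i j" "Ay My v (i + 1) j"] ij y by simp
qed

lemma A_op_eq_0:
  assumes "(i, j) \<in> grid_int Mx My" "\<And>i j. i \<le> Mx \<Longrightarrow> j \<le> My \<Longrightarrow> v i j = 0"
  shows "A_op Mx My v i j = 0"
  using A_op_bound[OF assms(1), of v 0] assms(2) by simp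

lemma PI_rule_lag:
  assumes "0 < p" "0 < \<tau>" "1 \<le> n"
  shows "\<tau> * PI_rule p \<tau> n v = (\<Sum>j=1..n. lag_weight p \<tau> (n - j) * (if j = 1 then v 1 else (v j + v (j - 1)) / 2))"
proof -
  have "(\<Sum>j=1..n. lag_weight p \<tau> (n - j) * (if j = 1 then v 1 else (v j + v (j - 1)) / 2))
      = (\<Sum>j=1..n. \<tau> * (lambda_coef p \<tau> n j * (if j = 1 then v 1 else (v j + v (j - 1)) / 2)))"
    using assms by (intro sum.cong refl) (auto simp: lambda_coef_eq_lag_weight[symmetric])
  also have "\<dots> = \<tau> * (lambda_coef p \<tau> n 1 * v 1 + (\<Sum>j=2..n. lambda_coef p \<tau> n j * ((v j + v (j - 1)) / 2)))"
    unfolding sum_distrib_left[symmetric] using assms(3)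
    by (subst sum.atLeast_Suc_atMost) (auto simp: numeral_2_eq_2 intro!: sum.cong)
  finally show ?thesis by (simp add: PI_rule_def)
qed

text \<open>Collecting the coefficients of the values at each time level in the product integration rule.\<close>

lemma source_weights_eq_PI_rule:
  assumes "2 \<le> n"
  shows "lambda_coef p \<tau> n n / 2 * \<phi> n + (\<Sum>k=1..n - 1. lambdat_coef p \<tau> n k * \<phi> k) = PI_rule p \<tau> n \<phi>"
proof -
  obtain m where n: "n = Suc m" "1 \<le> m" using assms by (cases n) auto
  let ?l = "lambda_coef p \<tau> n"
  have "(\<Sum>j=2..Suc m. ?l j * \<phi> (j - 1)) = (\<Sum>k=1..m. ?l (Suc k) * \<phi> k)"
    using sum.shift_bounds_cl_Suc_ivl[of "\<lambda>j. ?l j * \<phi> (j - 1)" 1 m] by (simp add: numeral_2_eq_2)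
  also have "\<dots> = ?l 2 * \<phi> 1 + (\<Sum>k=2..m. ?l (Suc k) * \<phi> k)"
    using n(2) by (subst sum.atLeast_Suc_atMost) (auto simp: numeral_2_eq_2)
  finally have shift: "(\<Sum>j=2..Suc m. ?l j * \<phi> (j - 1)) = ?l 2 * \<phi> 1 + (\<Sum>k=2..m. ?l (Suc k) * \<phi> k)" .
  have top: "(\<Sum>j=2..Suc m. ?l j * \<phi> j) = (\<Sum>j=2..m. ?l j * \<phi> j) + ?l (Suc m) * \<phi> (Suc m)"
    using n(2) by simp
  have "(\<Sum>k=1..m. lambdat_coef p \<tau> n k * \<phi> k) = (?l 1 + ?l 2 / 2) * \<phi> 1 + (\<Sum>k=2..m. (?l (Suc k) + ?l k) / 2 * \<phi> k)"
    using n(2) by (subst sum.atLeast_Suc_atMost) (auto simp: numeral_2_eq_2 lambdat_coef_def intro!: sum.cong)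
  moreover have "(\<Sum>k=2..m. (?l (Suc k) + ?l k) / 2 * \<phi> k) = ((\<Sum>k=2..m. ?l (Suc k) * \<phi> k) + (\<Sum>k=2..m. ?l k * \<phi> k)) / 2"
    unfolding sum.distrib[symmetric] sum_divide_distrib by (intro sum.cong refl) (simp add: field_simps)
  moreover have "PI_rule p \<tau> n \<phi> = ?l 1 * \<phi> 1 + ((\<Sum>j=2..Suc m. ?l j * \<phi> j) + (\<Sum>j=2..Suc m. ?l j * \<phi> (j - 1))) / 2"
    unfolding PI_rule_def n(1)[symmetric] sum.distrib[symmetric] sum_divide_distrib
    by (intro arg_cong2[where f = "(+)"] refl sum.cong) (simp add: field_simps)
  ultimately show ?thesis
    unfolding shift top using n(1) by (simp add: field_simps)
qed

lemma grid_l2_uniform_bound: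
  assumes "\<And>i j. (i, j) \<in> grid_int Mx My \<Longrightarrow> \<bar>v i j\<bar> \<le> b" "0 \<le> b"
  shows "grid_l2 Mx My v \<le> sqrt (real ((Mx - 1) * (My - 1))) * b"
proof -
  have "grid_l2 Mx My v \<le> grid_l2 Mx My (\<lambda>i j. b)" using assms by (intro grid_l2_mono) auto
  also have "\<dots> = sqrt (real ((Mx - 1) * (My - 1))) * b"
    using assms(2) by (simp add: grid_l2_def L2_set_def case_prod_unfold grid_int_def real_sqrt_mult)
  finally show ?thesis .
qed

lemma sum_increments:
  fixes h :: "nat \<Rightarrow> real"
  shows "(\<Sum>m<n. h m - h (m - 1)) = h (n - 1) - h 0"
    and "(\<Sum>m<n. h (m - 1) - h (m - 1 - 1)) = h (n - 1 - 1) - h 0"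
  by (induction n) auto

context regular_solution
begin

lemma W_nonneg: "0 \<le> t \<Longrightarrow> 0 \<le> W t"
  using W_mono[of 0 t] W_0 by simp

definition W_cell where "W_cell \<tau> m = W (real m * \<tau>) - W (real (m - 1) * \<tau>)"

lemma W_cell_nonneg: "0 < \<tau> \<Longrightarrow> 0 \<le> W_cell \<tau> m"
  unfolding W_cell_def using W_mono[of "real (m - 1) * \<tau>" "real m * \<tau>"] by (simp add: mult_right_mono)

text \<open>The first two increments of the memory weights involve \<open>g'\<close> only through its size; the later ones are second differences of \<open>g\<close>, controlled by the
  variation of \<open>g'\<close> over three cells.\<close>

definition memory_bound where
  "memory_bound \<tau> m = \<tau> * (if m \<le> 1 then Qg else W (real (m + 1) * \<tau>) - W (real (m - 2) * \<tau>))"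

lemma wt_coef_increments:
  assumes \<tau>: "0 < \<tau>" "real N * \<tau> = T"
  shows "1 \<le> N \<Longrightarrow> \<bar>wt_coef \<alpha> \<tau> 0\<bar> \<le> memory_bound \<tau> 0"
    and "Suc m < N \<Longrightarrow> \<bar>wt_coef \<alpha> \<tau> (Suc m) - wt_coef \<alpha> \<tau> m\<bar> \<le> memory_bound \<tau> (Suc m)"
    and "0 \<le> memory_bound \<tau> m"
    and "(\<Sum>m<N. memory_bound \<tau> m) \<le> \<tau> * (2 * Qg + 3 * W T)"
proof -
  have mv: "\<exists>z. real k * \<tau> < z \<and> z < real (Suc k) * \<tau> \<and> w_coef \<alpha> \<tau> k = \<tau> * deriv_in J 1 (g_fun \<alpha>) z" if k: "k < N" for k
  proof -
    obtain z where "real (Suc k - 1) * \<tau> < z" "z < real (Suc k) * \<tau>"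
      "g_fun \<alpha> (real (Suc k) * \<tau>) - g_fun \<alpha> (real (Suc k - 1) * \<tau>) = \<tau> * deriv_in J 1 (g_fun \<alpha>) z"
      by (rule difference_quotient_point[OF \<tau> _ g_continuous g_first_derivative, of V "Suc k"])
        (use V_mono k in auto)
    then show ?thesis by (auto simp: w_coef_def)
  qed
  have in_range: "0 < z \<and> z < T" if "real k * \<tau> < z" "z < real (Suc k) * \<tau>" "k < N" for k z
  proof -
    have "0 \<le> real k * \<tau>" "real (Suc k) * \<tau> \<le> real N * \<tau>" using \<tau> that(3) by (auto intro!: mult_right_mono)
    then show ?thesis using that \<tau>(2) by linarith
  qed
  have w_bound: "\<bar>w_coef \<alpha> \<tau> k\<bar> \<le> \<tau> * Qg" if k: "k < N" for k
  proof -
    obtain z where z: "real k * \<tau> < z" "z < real (Suc k) * \<tau>" "w_coef \<alpha> \<tau> k = \<tau> * deriv_in J 1 (g_fun \<alpha>) z"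
      using mv[OF k] by blast
    then show ?thesis
      using g_first_derivative_bound[of z] in_range[OF z(1,2) k] \<tau> by (simp add: abs_mult mult_left_mono)
  qed
  have half: "\<bar>x / 2\<bar> \<le> \<tau> * Qg" if "\<bar>x\<bar> \<le> \<tau> * Qg" for x using that by simp
  show "\<bar>wt_coef \<alpha> \<tau> 0\<bar> \<le> memory_bound \<tau> 0" if "1 \<le> N"
    using half[OF w_bound[of 0]] that by (simp add: wt_coef_def memory_bound_def)
  show nonneg: "0 \<le> memory_bound \<tau> m" for m
    unfolding memory_bound_def using \<tau> Qs W_mono[of "real (m - 2) * \<tau>" "real (m + 1) * \<tau>"]
    by (auto intro!: mult_nonneg_nonneg mult_right_mono)
  show "\<bar>wt_coef \<alpha> \<tau> (Suc m) - wt_coef \<alpha> \<tau> m\<bar> \<le> memory_bound \<tau> (Suc m)" if m: "Suc m < N"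
  proof (cases m)
    case 0
    have "wt_coef \<alpha> \<tau> (Suc m) - wt_coef \<alpha> \<tau> m = w_coef \<alpha> \<tau> 1 / 2" by (simp add: 0 wt_coef_def add_divide_distrib)
    then show ?thesis using half[OF w_bound[of 1]] m by (simp add: 0 memory_bound_def)
  next
    case (Suc l)
    obtain y where y: "real l * \<tau> < y" "y < real (Suc l) * \<tau>" "w_coef \<alpha> \<tau> l = \<tau> * deriv_in J 1 (g_fun \<alpha>) y"
      using mv[of l] m Suc by auto
    obtain z where z: "real (Suc m) * \<tau> < z" "z < real (Suc (Suc m)) * \<tau>" "w_coef \<alpha> \<tau> (Suc m) = \<tau> * deriv_in J 1 (g_fun \<alpha>) z"
      using mv[of "Suc m"] m by auto
    have le: "real (Suc l) * \<tau> \<le> real (Suc m) * \<tau>" "0 \<le> real l * \<tau>" using \<tau> Suc by (auto intro!: mult_right_mono)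
    have yz: "0 < y" "y \<le> z" "z < T" using in_range[OF y(1,2)] in_range[OF z(1,2) m] m Suc y z le by linarith+
    have "\<bar>deriv_in J 1 (g_fun \<alpha>) z - deriv_in J 1 (g_fun \<alpha>) y\<bar> \<le> W z - W y" by (rule g_variation[OF yz])
    also have "\<dots> \<le> W (real (Suc (Suc m)) * \<tau>) - W (real l * \<tau>)"
      using y z yz le by (intro diff_mono W_mono) linarith+
    finally have "\<bar>deriv_in J 1 (g_fun \<alpha>) z - deriv_in J 1 (g_fun \<alpha>) y\<bar> \<le> W (real (Suc (Suc m)) * \<tau>) - W (real l * \<tau>)" .
    moreover have "wt_coef \<alpha> \<tau> (Suc m) - wt_coef \<alpha> \<tau> m = \<tau> * (deriv_in J 1 (g_fun \<alpha>) z - deriv_in J 1 (g_fun \<alpha>) y) / 2"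
      using y(3) z(3) by (simp add: Suc wt_coef_def field_simps)
    ultimately have "\<bar>wt_coef \<alpha> \<tau> (Suc m) - wt_coef \<alpha> \<tau> m\<bar> \<le> \<tau> * (W (real (Suc (Suc m)) * \<tau>) - W (real l * \<tau>)) / 2"
      using \<tau> by (simp only: abs_divide abs_mult abs_of_pos abs_numeral) (intro divide_right_mono mult_left_mono, auto)
    also have "\<dots> \<le> memory_bound \<tau> (Suc m)"
      using nonneg[of "Suc m"] Suc by (simp add: memory_bound_def)
    finally show ?thesis .
  qed
  have WT: "W (real k * \<tau>) \<le> W T" if "k \<le> N" for k
    using \<tau> that by (intro W_mono) (auto simp: \<tau>(2)[symmetric] intro!: mult_right_mono)
  have "(\<Sum>m<N. memory_bound \<tau> m) \<le> (\<Sum>m<N. \<tau> * ((if m \<le> 1 then Qg else 0) + (W_cell \<tau> (Suc m) + W_cell \<tau> m + W_cell \<tau> (m - 1))))"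
  proof (rule sum_mono)
    fix m assume "m \<in> {..<N}"
    have "W (real (m + 1) * \<tau>) - W (real (m - 2) * \<tau>) = W_cell \<tau> (Suc m) + W_cell \<tau> m + W_cell \<tau> (m - 1)" by (simp add: W_cell_def numeral_2_eq_2)
    then show "memory_bound \<tau> m \<le> \<tau> * ((if m \<le> 1 then Qg else 0) + (W_cell \<tau> (Suc m) + W_cell \<tau> m + W_cell \<tau> (m - 1)))"
      unfolding memory_bound_def using \<tau> W_cell_nonneg[of \<tau> "Suc m"] W_cell_nonneg[of \<tau> m] W_cell_nonneg[of \<tau> "m - 1"] by (intro mult_left_mono) auto
  qed
  also have "\<dots> = \<tau> * ((\<Sum>m<N. if m \<le> 1 then Qg else 0) + ((\<Sum>m<N. W_cell \<tau> (Suc m)) + (\<Sum>m<N. W_cell \<tau> m) + (\<Sum>m<N. W_cell \<tau> (m - 1))))"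
    by (simp only: sum_distrib_left[symmetric] sum.distrib)
  also have "\<dots> \<le> \<tau> * (2 * Qg + 3 * W T)"
  proof (rule mult_left_mono)
    have "(\<Sum>m<N. if m \<le> 1 then Qg else 0) = (\<Sum>m\<in>{..<N} \<inter> {..1}. Qg)"
      by (rule sum.mono_neutral_cong_right) auto
    also have "\<dots> \<le> (\<Sum>m\<in>{..1::nat}. Qg)" using Qs by (intro sum_mono2) auto
    also have "\<dots> = 2 * Qg" by simp
    finally have 1: "(\<Sum>m<N. if m \<le> 1 then Qg else 0) \<le> 2 * Qg" .
    have "(\<Sum>m<N. W_cell \<tau> (Suc m)) = W (real N * \<tau>) - W (real 0 * \<tau>)"
      unfolding W_cell_def using sum_lessThan_telescope[of "\<lambda>m. W (real m * \<tau>)" N] by simp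
    moreover have "(\<Sum>m<N. W_cell \<tau> m) = W (real (N - 1) * \<tau>) - W (real 0 * \<tau>)"
      unfolding W_cell_def by (rule sum_increments)
    moreover have "(\<Sum>m<N. W_cell \<tau> (m - 1)) = W (real (N - 1 - 1) * \<tau>) - W (real 0 * \<tau>)"
      unfolding W_cell_def by (rule sum_increments)
    ultimately show "(\<Sum>m<N. if m \<le> 1 then Qg else 0) + ((\<Sum>m<N. W_cell \<tau> (Suc m)) + (\<Sum>m<N. W_cell \<tau> m) + (\<Sum>m<N. W_cell \<tau> (m - 1))) \<le> 2 * Qg + 3 * W T"
      using 1 WT[of N] WT[of "N - 1"] WT[of "N - 1 - 1"] W_0 by simp
  qed (use \<tau> in simp)
  finally show "(\<Sum>m<N. memory_bound \<tau> m) \<le> \<tau> * (2 * Qg + 3 * W T)" .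
qed

definition V_cell where "V_cell \<tau> m = V (real m * \<tau>) - V (real (m - 1) * \<tau>)"

text \<open>The four contributions are: oscillation of the memory kernel, trapezoidal error for the memory kernel, interpolation error of the source, sawtooth part
  of the source.\<close>

definition residual_kernel where
  "residual_kernel \<tau> m = ((if m = 0 then Qg else W_cell \<tau> (m + 1) + W_cell \<tau> m) + W_cell \<tau> (m + 1))
     + (lag_weight p \<tau> m / \<tau> + (beta_kernel (1+p) (real (m + 1) * \<tau>) - beta_kernel (1+p) (real m * \<tau>)))"

definition residual_bound where
  "residual_bound \<tau> n = \<tau>\<^sup>2 * (\<Sum>k=1..n. residual_kernel \<tau> (n - k) * (V_cell \<tau> k + V_cell \<tau> (k - 1)))"

text \<open>The residual of the exact solution at one node, before averaging by \<open>A\<close>; it is multiplied by \<open>\<tau>\<close>, as are all the equations below.\<close>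

definition node_residual where
  "node_residual \<tau> n x y = (u x y (real n * \<tau>) - u x y (real (n - 1) * \<tau>))
      + (\<Sum>k=1..n. wt_coef \<alpha> \<tau> (n - k) * (u x y (real k * \<tau>) - u x y (real (k - 1) * \<tau>)))
      - (\<Sum>k=1..n. lag_weight p \<tau> (n - k) * (if k = 1 then source x y (real 1 * \<tau>)
          else (source x y (real k * \<tau>) + source x y (real (k - 1) * \<tau>)) / 2))"

lemma node_residual_bound:
  assumes xy: "x \<in> X" "y \<in> Y" and \<tau>: "0 < \<tau>" "real N * \<tau> = T" and n: "1 \<le> n" "n \<le> N"
  shows "\<bar>node_residual \<tau> n x y\<bar> \<le> residual_bound \<tau> n"
proof -
  have tn: "real n * \<tau> \<in> J" "real (n - 1) * \<tau> \<in> J"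
    using \<tau> n by (auto simp: \<tau>(2)[symmetric] intro!: mult_right_mono)
  let ?G = "integral {0..real n * \<tau>} (\<lambda>s. g_fun \<alpha> (real n * \<tau> - s) * Dt T 1 u x y s)
      - integral {0..real (n - 1) * \<tau>} (\<lambda>s. g_fun \<alpha> (real (n - 1) * \<tau> - s) * Dt T 1 u x y s)"
  let ?S = "integral {0..real n * \<tau>} (\<lambda>s. beta_kernel (1+p) (real n * \<tau> - s) * source x y s)
      - integral {0..real (n - 1) * \<tau>} (\<lambda>s. beta_kernel (1+p) (real (n - 1) * \<tau> - s) * source x y s)"
  let ?M = "(u x y (real n * \<tau>) - u x y (real (n - 1) * \<tau>))
      + (\<Sum>k=1..n. wt_coef \<alpha> \<tau> (n - k) * (u x y (real k * \<tau>) - u x y (real (k - 1) * \<tau>)))"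
  let ?P = "\<Sum>k=1..n. lag_weight p \<tau> (n - k) * (if k = 1 then source x y (real 1 * \<tau>)
          else (source x y (real k * \<tau>) + source x y (real (k - 1) * \<tau>)) / 2)"
  have memory: "\<bar>?G - ?M\<bar> \<le> \<tau>\<^sup>2 * (\<Sum>k=1..n. ((if n - k = 0 then Qg else W_cell \<tau> (n - k + 1) + W_cell \<tau> (n - k))
      + W_cell \<tau> (n - k + 1)) * (V_cell \<tau> k + V_cell \<tau> (k - 1)))"
  proof (rule memory_consistency[where T = T and N = N and V = V and W = W and ?g1.0 = "deriv_in J 1 (g_fun \<alpha>)"])
    show "wt_coef \<alpha> \<tau> = (\<lambda>m. if m = 0 then (g_fun \<alpha> \<tau> - g_fun \<alpha> 0) / 2
      else (g_fun \<alpha> (real (m + 1) * \<tau>) - g_fun \<alpha> (real (m - 1) * \<tau>)) / 2)"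
      by (auto simp: fun_eq_iff wt_coef_def w_coef_def)
    show "(u x y has_real_derivative Dt T 1 u x y s) (at s)" if "0 < s" "s < T" for s
      using time_facts(2)[OF xy _ that, of u] by simp
    show "g_fun \<alpha> 0 = 1" by (simp add: g_fun_def)
  qed (use \<tau> n V_mono W_mono time_facts(1,4)[OF xy, of u] time_data(4)[OF xy, of u] ut_variation[OF xy] g_continuous
      g_first_derivative g_first_derivative_bound g_variation in \<open>auto simp: W_cell_def[abs_def] V_cell_def[abs_def]\<close>)
  have src: "\<bar>?S - ?P\<bar> \<le> \<tau>\<^sup>2 * (\<Sum>k=1..n. (lag_weight p \<tau> (n - k) / \<tau>
        + (beta_kernel (1+p) (real (n - k + 1) * \<tau>) - beta_kernel (1+p) (real (n - k) * \<tau>))) * (V_cell \<tau> k + V_cell \<tau> (k - 1)))"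
    by (rule source_consistency[where T = T and N = N and V = V and ?F1.0 = "source_t x y"])
      (use \<tau> n p V_mono source_time[OF xy] in \<open>auto simp: V_cell_def[abs_def]\<close>)
  have "?S = ?G" using integrated_equation[OF xy tn(1)] integrated_equation[OF xy tn(2)] by simp
  then have "\<bar>?M - ?P\<bar> \<le> \<bar>?G - ?M\<bar> + \<bar>?S - ?P\<bar>" by linarith
  also have "\<dots> \<le> residual_bound \<tau> n"
    using add_mono[OF memory src]
    unfolding residual_bound_def residual_kernel_def distrib_left[symmetric] sum.distrib[symmetric] distrib_right[symmetric] .
  finally show ?thesis unfolding node_residual_def .
qed

lemma V_cell_nonneg: "0 < \<tau> \<Longrightarrow> 0 \<le> V_cell \<tau> m"
  unfolding V_cell_def using V_mono[of "real (m - 1) * \<tau>" "real m * \<tau>"] by (simp add: mult_right_mono)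

lemma residual_kernel_nonneg: "0 < \<tau> \<Longrightarrow> 0 \<le> residual_kernel \<tau> m"
  unfolding residual_kernel_def
  using W_cell_nonneg[of \<tau> m] W_cell_nonneg[of \<tau> "m + 1"] lag_weight_nonneg[OF p, of \<tau> m] Qs p
    beta_kernel_mono[of "1+p" "real m * \<tau>" "real (m + 1) * \<tau>"]
  by (intro add_nonneg_nonneg) (auto simp: mult_right_mono)

lemma residual_bound_sum:
  assumes \<tau>: "0 < \<tau>" "real N * \<tau> = T"
  shows "(\<Sum>n=1..N. residual_bound \<tau> n) \<le> \<tau>\<^sup>2 * ((Qg + 3 * W T + 2 * beta_kernel (1+p) T) * (2 * V T))"
proof -
  have tT: "real k * \<tau> \<le> T" if "k \<le> N" for k using \<tau> that by (auto simp: \<tau>(2)[symmetric] intro!: mult_right_mono)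
  have t0: "0 \<le> real k * \<tau>" for k using \<tau> by simp
  have kernel: "(\<Sum>m<N. residual_kernel \<tau> m) \<le> Qg + 3 * W T + 2 * beta_kernel (1+p) T"
  proof -
    have "(\<Sum>m<N. residual_kernel \<tau> m) \<le> (\<Sum>m<N. ((if m = 0 then Qg else 0) + 2 * W_cell \<tau> (Suc m) + W_cell \<tau> m)
        + (lag_weight p \<tau> m / \<tau> + (beta_kernel (1+p) (real (Suc m) * \<tau>) - beta_kernel (1+p) (real m * \<tau>))))"
    proof (rule sum_mono)
      fix m
      show "residual_kernel \<tau> m \<le> ((if m = 0 then Qg else 0) + 2 * W_cell \<tau> (Suc m) + W_cell \<tau> m)
        + (lag_weight p \<tau> m / \<tau> + (beta_kernel (1+p) (real (Suc m) * \<tau>) - beta_kernel (1+p) (real m * \<tau>)))"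
        unfolding residual_kernel_def using W_cell_nonneg[OF \<tau>(1), of m] W_cell_nonneg[OF \<tau>(1), of "Suc m"] by auto
    qed
    also have "\<dots> = (\<Sum>m<N. if m = 0 then Qg else 0) + 2 * (\<Sum>m<N. W_cell \<tau> (Suc m)) + (\<Sum>m<N. W_cell \<tau> m)
        + ((\<Sum>m<N. lag_weight p \<tau> m) / \<tau> + (\<Sum>m<N. beta_kernel (1+p) (real (Suc m) * \<tau>) - beta_kernel (1+p) (real m * \<tau>)))"
      by (simp only: sum.distrib sum_distrib_left sum_divide_distrib)
    also have "\<dots> \<le> Qg + 2 * W T + W T + (beta_kernel (1+p) T + beta_kernel (1+p) T)"
    proof (intro add_mono)
      show "(\<Sum>m<N. if m = 0 then Qg else 0) \<le> Qg" using Qs by (simp add: sum.delta)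
      have "(\<Sum>m<N. W_cell \<tau> (Suc m)) = W (real N * \<tau>) - W (real 0 * \<tau>)"
        unfolding W_cell_def using sum_lessThan_telescope[of "\<lambda>m. W (real m * \<tau>)" N] by simp
      then show "2 * (\<Sum>m<N. W_cell \<tau> (Suc m)) \<le> 2 * W T" using \<tau> W_0 by simp
      have "(\<Sum>m<N. W_cell \<tau> m) = W (real (N - 1) * \<tau>) - W (real 0 * \<tau>)"
        unfolding W_cell_def by (rule sum_increments)
      then show "(\<Sum>m<N. W_cell \<tau> m) \<le> W T" using W_0 W_mono[OF t0 tT[of "N - 1"]] by simp
      show "(\<Sum>m<N. lag_weight p \<tau> m) / \<tau> \<le> beta_kernel (1+p) T"
        using lag_weight_sum_le[of p \<tau> N T] p \<tau> by (simp add: divide_le_eq mult.commute)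
      show "(\<Sum>m<N. beta_kernel (1+p) (real (Suc m) * \<tau>) - beta_kernel (1+p) (real m * \<tau>)) \<le> beta_kernel (1+p) T"
        using sum_lessThan_telescope[of "\<lambda>m. beta_kernel (1+p) (real m * \<tau>)" N] \<tau> by simp
    qed
    finally show ?thesis by simp
  qed
  have data: "(\<Sum>k=1..N. V_cell \<tau> k + V_cell \<tau> (k - 1)) \<le> 2 * V T"
  proof -
    have "(\<Sum>k=1..N. V_cell \<tau> k + V_cell \<tau> (k - 1)) = (\<Sum>m<N. V_cell \<tau> (Suc m)) + (\<Sum>m<N. V_cell \<tau> m)"
      by (simp add: sum.distrib sum.atLeast1_atMost_eq)
    also have "(\<Sum>m<N. V_cell \<tau> (Suc m)) = V (real N * \<tau>) - V (real 0 * \<tau>)"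
      unfolding V_cell_def using sum_lessThan_telescope[of "\<lambda>m. V (real m * \<tau>)" N] by simp
    also have "(\<Sum>m<N. V_cell \<tau> m) = V (real (N - 1) * \<tau>) - V (real 0 * \<tau>)"
      unfolding V_cell_def by (rule sum_increments)
    finally show ?thesis using \<tau> V_0 V_mono[OF t0 tT[of "N - 1"]] by simp
  qed
  have "(\<Sum>n=1..N. residual_bound \<tau> n) = \<tau>\<^sup>2 * (\<Sum>n=1..N. \<Sum>k=1..n. residual_kernel \<tau> (n - k) * (V_cell \<tau> k + V_cell \<tau> (k - 1)))"
    by (simp add: residual_bound_def sum_distrib_left)
  also have "\<dots> \<le> \<tau>\<^sup>2 * ((\<Sum>m<N. residual_kernel \<tau> m) * (\<Sum>k=1..N. V_cell \<tau> k + V_cell \<tau> (k - 1)))"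
    using residual_kernel_nonneg V_cell_nonneg \<tau>
    by (intro mult_left_mono discrete_convolution_sum_le) (auto intro!: add_nonneg_nonneg)
  also have "\<dots> \<le> \<tau>\<^sup>2 * ((Qg + 3 * W T + 2 * beta_kernel (1+p) T) * (2 * V T))"
    using kernel data residual_kernel_nonneg V_cell_nonneg \<tau>
    by (intro mult_left_mono mult_mono order_trans[OF _ kernel]) (auto intro!: sum_nonneg add_nonneg_nonneg)
  finally show ?thesis .
qed

lemma residual_bound_nonneg: "0 < \<tau> \<Longrightarrow> 0 \<le> residual_bound \<tau> n"
  unfolding residual_bound_def using residual_kernel_nonneg V_cell_nonneg
  by (intro mult_nonneg_nonneg sum_nonneg add_nonneg_nonneg) auto

end

context regular_solution
begin

lemma grid_points_inside:
  assumes "0 < Mx" "0 < My" "i \<le> Mx" "j \<le> My"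
  shows "lx + real i * ((rx - lx) / real Mx) \<in> X" "ly + real j * ((ry - ly) / real My) \<in> Y"
proof -
  have "real i * ((rx - lx) / real Mx) \<le> real Mx * ((rx - lx) / real Mx)"
    by (rule mult_right_mono) (use assms lr in auto)
  moreover have "real j * ((ry - ly) / real My) \<le> real My * ((ry - ly) / real My)"
    by (rule mult_right_mono) (use assms lr in auto)
  moreover have "0 \<le> real i * ((rx - lx) / real Mx)" "0 \<le> real j * ((ry - ly) / real My)"
    using assms lr by simp_all
  moreover have "real Mx * ((rx - lx) / real Mx) = rx - lx" "real My * ((ry - ly) / real My) = ry - ly"
    using assms by auto
  ultimately show "lx + real i * ((rx - lx) / real Mx) \<in> X" "ly + real j * ((ry - ly) / real My) \<in> Y"
    unfolding atLeastAtMost_iff by linarith+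
qed

text \<open>\<open>A \<Delta>u - \<Lambda>u\<close> is the average in \<open>y\<close> of one-dimensional errors in \<open>x\<close> plus the average in \<open>x\<close> of one-dimensional errors in \<open>y\<close>. These
  averages reach the boundary nodes.\<close>

lemma compact_operator_consistency:
  fixes Mx My :: nat
  assumes M: "0 < Mx" "0 < My" and t: "t \<in> J"
    and Hx: "Hx = (rx - lx) / real Mx" and Hy: "Hy = (ry - ly) / real My"
    and ij: "(i, j) \<in> grid_int Mx My"
  defines "v \<equiv> \<lambda>i j. u (lx + real i * Hx) (ly + real j * Hy) t"
    and "w \<equiv> \<lambda>i j. uxx (lx + real i * Hx) (ly + real j * Hy) t + uyy (lx + real i * Hx) (ly + real j * Hy) t"
  shows "\<bar>A_op Mx My w i j - Lambda_op Mx My Hx Hy v i j\<bar> \<le> Qu * (Hx ^ 4 + Hy ^ 4)"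
proof -
  have i: "0 < i" "i < Mx" and j: "0 < j" "j < My" using ij by (auto simp: grid_int_def)
  have H: "0 < Hx" "0 < Hy" using M lr by (auto simp: Hx Hy)
  define x where "x = (\<lambda>i. lx + real i * Hx)"
  define y where "y = (\<lambda>j. ly + real j * Hy)"
  have xX: "x k \<in> X" if "k \<le> Mx" for k
    using grid_points_inside(1)[OF M that, of 0] by (simp add: x_def Hx)
  have yY: "y k \<in> Y" if "k \<le> My" for k
    using grid_points_inside(2)[OF M _ that, of 0] by (simp add: y_def Hy)
  have xs: "x (i - 1) = x i - Hx" "x (i + 1) = x i + Hx" using i by (auto simp: x_def of_nat_diff algebra_simps)
  have ys: "y (j - 1) = y j - Hy" "y (j + 1) = y j + Hy" using j by (auto simp: y_def of_nat_diff algebra_simps)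
  define a where "a = (\<lambda>i j. uxx (x i) (y j) t)"
  define b where "b = (\<lambda>i j. uyy (x i) (y j) t)"
  have v: "v = (\<lambda>i j. u (x i) (y j) t)" by (simp add: v_def x_def y_def)
  define Ex where "Ex = (\<lambda>k. (a (i - 1) k + 10 * a i k + a (i + 1) k) / 12 - delta2x Hx v i k)"
  define Ey where "Ey = (\<lambda>k. (b k (j - 1) + 10 * b k j + b k (j + 1)) / 12 - delta2y Hy v k j)"
  have Ex: "\<bar>Ex k\<bar> \<le> Qu * Hx ^ 4" if k: "k \<le> My" for k
  proof -
    have "\<bar>(deriv_in X 2 (\<lambda>x. u x (y k) t) (x i - Hx) + 10 * deriv_in X 2 (\<lambda>x. u x (y k) t) (x i)
        + deriv_in X 2 (\<lambda>x. u x (y k) t) (x i + Hx)) / 12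
        - (u (x i + Hx) (y k) t - 2 * u (x i) (y k) t + u (x i - Hx) (y k) t) / Hx\<^sup>2\<bar> \<le> Qu * Hx ^ 4"
    proof (rule compact_difference_consistency)
      show "lx \<le> x i - Hx" using xX[of "i - 1"] i xs by auto
      show "x i + Hx \<le> rx" using xX[of "i + 1"] i xs by auto
    qed (use x_regularity sixth_derivative_bounds t yY[OF k] H in auto)
    then show ?thesis
      unfolding Ex_def a_def uxx_eq delta2x_def v xs .
  qed
  have Ey: "\<bar>Ey k\<bar> \<le> Qu * Hy ^ 4" if k: "k \<le> Mx" for k
  proof -
    have "\<bar>(deriv_in Y 2 (\<lambda>y. u (x k) y t) (y j - Hy) + 10 * deriv_in Y 2 (\<lambda>y. u (x k) y t) (y j)
        + deriv_in Y 2 (\<lambda>y. u (x k) y t) (y j + Hy)) / 12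
        - (u (x k) (y j + Hy) t - 2 * u (x k) (y j) t + u (x k) (y j - Hy) t) / Hy\<^sup>2\<bar> \<le> Qu * Hy ^ 4"
    proof (rule compact_difference_consistency)
      show "ly \<le> y j - Hy" using yY[of "j - 1"] j ys by auto
      show "y j + Hy \<le> ry" using yY[of "j + 1"] j ys by auto
    qed (use y_regularity sixth_derivative_bounds t xX[OF k] H in auto)
    then show ?thesis
      unfolding Ey_def b_def uyy_eq delta2y_def v ys .
  qed
  have avg: "\<bar>(p + 10 * q + r) / 12\<bar> \<le> B" if "\<bar>p\<bar> \<le> B" "\<bar>q\<bar> \<le> B" "\<bar>r\<bar> \<le> B" for p q r B :: real
    using that by (simp add: abs_le_iff)
  have "A_op Mx My w i j = A_op Mx My a i j + A_op Mx My b i j"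
    using A_op_add[of Mx My a b i j] by (simp add: w_def a_def b_def x_def y_def)
  moreover have "A_op Mx My a i j - Ay My (delta2x Hx v) i j = (Ex (j - 1) + 10 * Ex j + Ex (j + 1)) / 12"
    using i j by (simp add: A_op_def Ax_def Ay_def Ex_def) (simp add: field_simps)
  moreover have "A_op Mx My b i j - Ax Mx (delta2y Hy v) i j = (Ey (i - 1) + 10 * Ey i + Ey (i + 1)) / 12"
    using i j by (simp add: A_op_def Ax_def Ay_def Ey_def) (simp add: field_simps)
  ultimately have "A_op Mx My w i j - Lambda_op Mx My Hx Hy v i j
      = (Ex (j - 1) + 10 * Ex j + Ex (j + 1)) / 12 + (Ey (i - 1) + 10 * Ey i + Ey (i + 1)) / 12"
    unfolding Lambda_op_def by linarith
  moreover have "\<bar>(Ex (j - 1) + 10 * Ex j + Ex (j + 1)) / 12\<bar> \<le> Qu * Hx ^ 4" using j by (intro avg Ex) auto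
  moreover have "\<bar>(Ey (i - 1) + 10 * Ey i + Ey (i + 1)) / 12\<bar> \<le> Qu * Hy ^ 4" using i by (intro avg Ey) auto
  ultimately show ?thesis unfolding distrib_left by linarith
qed

text \<open>The first equation of the scheme and the later ones take the same form when the weights are written as \<open>lag_weight\<close>; the terms \<open>b\<^sup>n\<close> vanish
  with the initial velocity.\<close>

lemma coarse_scheme_weights:
  assumes cs: "coarse_solution lx rx ly ry T \<alpha> f u0 v0 N Mx My U dU0"
    and M: "0 < N" "0 < Mx" "0 < My" and \<tau>: "\<tau> = T / real N"
    and Hx: "Hx = (rx - lx) / real Mx" and Hy: "Hy = (ry - ly) / real My"
    and n: "1 \<le> n" "n \<le> N" and ij: "(i, j) \<in> grid_int Mx My"
  shows "(A_op Mx My (U n) i j - A_op Mx My (U (n - 1)) i j)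
      + (\<Sum>k=1..n. wt_coef \<alpha> \<tau> (n - k) * (A_op Mx My (U k) i j - A_op Mx My (U (k - 1)) i j))
      = (\<Sum>k=1..n. lag_weight p \<tau> (n - k) * Lambda_op Mx My Hx Hy (cell_value U k) i j)
      + (\<Sum>k=1..n. lag_weight p \<tau> (n - k) * A_op Mx My (cell_value (\<lambda>n i j. f (U n i j)) k) i j)"
proof -
  let ?A = "A_op Mx My" and ?L = "Lambda_op Mx My Hx Hy" and ?fU = "\<lambda>n i j. f (U n i j)"
  have \<tau>0: "0 < \<tau>" using T M by (simp add: \<tau>)
  define b where "b = (\<lambda>n i j. 1 / \<tau> * integral {real (n - 1) * \<tau>..real n * \<tau>}
      (\<lambda>t. g_fun \<alpha> t * v0 (lx + real i * Hx) (ly + real j * Hy)))"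
  have b0: "?A (b n) i j = 0"
    by (rule A_op_eq_0[OF ij])
      (use grid_points_inside[OF M(2,3)] in \<open>simp add: b_def Hx Hy initial_velocity_zero\<close>)
  have eq1: "c0_coef \<alpha> \<tau> * ?A (delta_t \<tau> U 1) i j - lambda_coef p \<tau> 1 1 * ?L (U 1) i j
      = lambda_coef p \<tau> 1 1 * ?A (?fU 1) i j + ?A (b 1) i j"
    using cs ij unfolding coarse_solution_def Let_def b_def \<tau> Hx Hy alpha_minus by fast
  have eqn: "c0_coef \<alpha> \<tau> * ?A (delta_t \<tau> U n) i j
        + (\<Sum>k=1..n - 1. wt_coef \<alpha> \<tau> (n - k) * ?A (delta_t \<tau> U k) i j)
        - PI_rule p \<tau> n (\<lambda>m. ?L (U m) i j)
      = lambda_coef p \<tau> n n / 2 * ?A (?fU n) i j + (\<Sum>k=1..n - 1. lambdat_coef p \<tau> n k * ?A (?fU k) i j) + ?A (b n) i j"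
    if "2 \<le> n"
  proof -
    have "n \<in> {2..N}" using that n by simp
    then show ?thesis using cs ij unfolding coarse_solution_def Let_def b_def \<tau> Hx Hy alpha_minus by fast
  qed
  have PI: "c0_coef \<alpha> \<tau> * ?A (delta_t \<tau> U n) i j
        + (\<Sum>k=1..n - 1. wt_coef \<alpha> \<tau> (n - k) * ?A (delta_t \<tau> U k) i j)
      = PI_rule p \<tau> n (\<lambda>m. ?L (U m) i j) + PI_rule p \<tau> n (\<lambda>m. ?A (?fU m) i j)"
  proof (cases "n = 1")
    case True
    then show ?thesis using eq1 b0 by (simp add: PI_rule_def)
  next
    case False
    then have "2 \<le> n" using n by simp
    from eqn[OF this] b0 source_weights_eq_PI_rule[OF this, of p \<tau> "\<lambda>k. ?A (?fU k) i j"]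
    show ?thesis by linarith
  qed
  have c0: "c0_coef \<alpha> \<tau> * ?A (delta_t \<tau> U n) i j + (\<Sum>k=1..n - 1. wt_coef \<alpha> \<tau> (n - k) * ?A (delta_t \<tau> U k) i j)
      = ?A (delta_t \<tau> U n) i j + (\<Sum>k=1..n. wt_coef \<alpha> \<tau> (n - k) * ?A (delta_t \<tau> U k) i j)"
  proof -
    obtain m where m: "n = Suc m" using n by (cases n) auto
    have "c0_coef \<alpha> \<tau> = 1 + wt_coef \<alpha> \<tau> 0" by (simp add: c0_coef_def wt_coef_def)
    then show ?thesis by (simp add: m distrib_right)
  qed
  have d: "\<tau> * ?A (delta_t \<tau> U k) i j = ?A (U k) i j - ?A (U (k - 1)) i j" for k
  proof -
    have "delta_t \<tau> U k = (\<lambda>i j. 1 / \<tau> * U k i j + (- 1 / \<tau>) * U (k - 1) i j)"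
      by (simp add: delta_t_def fun_eq_iff diff_divide_distrib)
    then show ?thesis using A_op_linear[of Mx My "1 / \<tau>" "U k" "- 1 / \<tau>" "U (k - 1)"] \<tau>0 by (simp add: field_simps)
  qed
  have "\<tau> * ?A (delta_t \<tau> U n) i j + \<tau> * (\<Sum>k=1..n. wt_coef \<alpha> \<tau> (n - k) * ?A (delta_t \<tau> U k) i j)
      = \<tau> * PI_rule p \<tau> n (\<lambda>m. ?L (U m) i j) + \<tau> * PI_rule p \<tau> n (\<lambda>m. ?A (?fU m) i j)"
    using PI unfolding c0 distrib_left[symmetric] by (rule arg_cong[where f = "(*) \<tau>"])
  moreover have "\<tau> * (\<Sum>k=1..n. wt_coef \<alpha> \<tau> (n - k) * ?A (delta_t \<tau> U k) i j)
      = (\<Sum>k=1..n. wt_coef \<alpha> \<tau> (n - k) * (?A (U k) i j - ?A (U (k - 1)) i j))"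
    unfolding sum_distrib_left d[symmetric] by (intro sum.cong refl) simp
  ultimately show ?thesis
    unfolding PI_rule_lag[OF p(1) \<tau>0 n(1)] d by (simp add: A_op_cell_value Lambda_op_cell_value)
qed

lemma exact_solution_scheme:
  fixes n Mx My :: nat and Hx Hy \<tau> :: real
  defines "ug \<equiv> \<lambda>n i j. u (lx + real i * Hx) (ly + real j * Hy) (real n * \<tau>)"
    and "lap \<equiv> \<lambda>n i j. uxx (lx + real i * Hx) (ly + real j * Hy) (real n * \<tau>) + uyy (lx + real i * Hx) (ly + real j * Hy) (real n * \<tau>)"
    and "r \<equiv> \<lambda>i j. node_residual \<tau> n (lx + real i * Hx) (ly + real j * Hy)"
  shows "(A_op Mx My (ug n) i j - A_op Mx My (ug (n - 1)) i j)
      + (\<Sum>k=1..n. wt_coef \<alpha> \<tau> (n - k) * (A_op Mx My (ug k) i j - A_op Mx My (ug (k - 1)) i j))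
      = (\<Sum>k=1..n. lag_weight p \<tau> (n - k) * A_op Mx My (cell_value lap k) i j)
      + (\<Sum>k=1..n. lag_weight p \<tau> (n - k) * A_op Mx My (cell_value (\<lambda>n i j. f (ug n i j)) k) i j)
      + A_op Mx My r i j"
proof -
  define S where "S = (\<lambda>n i j. source (lx + real i * Hx) (ly + real j * Hy) (real n * \<tau>))"
  have r: "r = (\<lambda>i j. ((ug n i j - ug (n - 1) i j) + (\<Sum>k=1..n. wt_coef \<alpha> \<tau> (n - k) * (ug k i j - ug (k - 1) i j)))
      - (\<Sum>k=1..n. lag_weight p \<tau> (n - k) * cell_value S k i j))"
    unfolding r_def node_residual_def ug_def S_def cell_value_def ..
  have "cell_value S k = (\<lambda>i j. cell_value lap k i j + cell_value (\<lambda>n i j. f (ug n i j)) k i j)" for k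
    by (auto simp: fun_eq_iff cell_value_def S_def lap_def ug_def source_def field_simps)
  then have S: "A_op Mx My (cell_value S k) i j
      = A_op Mx My (cell_value lap k) i j + A_op Mx My (cell_value (\<lambda>n i j. f (ug n i j)) k) i j" for k
    by (simp add: A_op_add)
  have "A_op Mx My r i j = (A_op Mx My (ug n) i j - A_op Mx My (ug (n - 1)) i j)
      + (\<Sum>k=1..n. wt_coef \<alpha> \<tau> (n - k) * (A_op Mx My (ug k) i j - A_op Mx My (ug (k - 1)) i j))
      - (\<Sum>k=1..n. lag_weight p \<tau> (n - k) * A_op Mx My (cell_value S k) i j)"
    unfolding r A_op_diff A_op_add
    by (simp only: A_op_sum[where v = "\<lambda>k i j. ug k i j - ug (k - 1) i j"] A_op_sum[where v = "cell_value S"] A_op_diff)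
  then show ?thesis by (simp add: S distrib_left sum.distrib)
qed

lemma abs_average_le:
  fixes a b E :: real
  assumes "\<bar>a\<bar> \<le> E" "\<bar>b\<bar> \<le> E" shows "\<bar>(a + b) / 2\<bar> \<le> E"
proof -
  have "\<bar>a + b\<bar> \<le> E + E" using assms by linarith
  then show ?thesis by simp
qed

text \<open>The error and the difference of the nonlinear terms are set to zero at level \<open>0\<close>, where they vanish on the closed grid, and beyond level \<open>N\<close>; this makes them
  grid functions to which \<open>discrete_stability\<close> applies. The residual consists of the averaged node residuals and of the space errors weighted by the
  product integration rule.\<close>

lemma coarse_error_estimate:
  assumes cs: "coarse_solution lx rx ly ry T \<alpha> f u0 v0 N Mx My U dU0"
    and M: "0 < N" "0 < Mx" "0 < My" and \<tau>: "\<tau> = T / real N"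
    and Hx: "Hx = (rx - lx) / real Mx" and Hy: "Hy = (ry - ly) / real My"
    and C: "C = 2 * Qg + 3 * W T + Qf * beta_kernel (1+p) T" and small: "9 * C * \<tau> \<le> 1"
    and m: "1 \<le> m" "m \<le> N"
  shows "grid_norm Mx My Hx Hy (\<lambda>i j. u (lx + real i * Hx) (ly + real j * Hy) (real m * \<tau>) - U m i j)
    \<le> 9 * sqrt ((rx - lx) * (ry - ly)) * exp (9 * C * T)
      * ((Qg + 3 * W T + 2 * beta_kernel (1+p) T) * (2 * V T) * \<tau>\<^sup>2 + T * beta_kernel (1+p) T * Qu * (Hx ^ 4 + Hy ^ 4))"
proof -
  let ?A = "A_op Mx My" and ?L = "Lambda_op Mx My Hx Hy" and ?B = "beta_kernel (1+p) T"
  have \<tau>0: "0 < \<tau>" and N\<tau>: "real N * \<tau> = T" using T M by (auto simp: \<tau>)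
  have H: "0 < Hx" "0 < Hy" using M lr by (auto simp: Hx Hy)
  have B: "0 \<le> ?B" using p by (intro beta_kernel_nonneg) auto
  have C0: "0 \<le> C" using B Qs W_nonneg[of T] T by (simp add: C)
  have grid: "lx + real i * Hx \<in> X" "ly + real j * Hy \<in> Y" if "i \<le> Mx" "j \<le> My" for i j
    using grid_points_inside[OF M(2,3) that] by (auto simp: Hx Hy)
  have time: "real n * \<tau> \<in> J" if "n \<le> N" for n
    using that \<tau>0 by (auto simp: N\<tau>[symmetric] intro!: mult_right_mono)
  define ug where "ug = (\<lambda>n i j. u (lx + real i * Hx) (ly + real j * Hy) (real n * \<tau>))"
  define lap where "lap = (\<lambda>n i j. uxx (lx + real i * Hx) (ly + real j * Hy) (real n * \<tau>) + uyy (lx + real i * Hx) (ly + real j * Hy) (real n * \<tau>))"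
  define r where "r = (\<lambda>n i j. node_residual \<tau> n (lx + real i * Hx) (ly + real j * Hy))"
  define e where "e = (\<lambda>n i j. if n = 0 \<or> N < n then 0 else ug n i j - U n i j)"
  define d where "d = (\<lambda>n i j. if n = 0 \<or> N < n then 0 else f (ug n i j) - f (U n i j))"
  define R where "R = (\<lambda>n i j. ?A (r n) i j + (\<Sum>k=1..n. lag_weight p \<tau> (n - k) * (?A (cell_value lap k) i j - ?L (cell_value ug k) i j)))"
  have bd: "ug n i j = 0 \<and> U n i j = 0" if "n \<le> N" "(i, j) \<in> grid_bd Mx My" for n i j
  proof
    have "i \<le> Mx" "j \<le> My" "i = 0 \<or> i = Mx \<or> j = 0 \<or> j = My"
      using that(2) by (auto simp: grid_bd_def grid_int_def)
    moreover have "lx + real Mx * Hx = rx" "ly + real My * Hy = ry" using M by (auto simp: Hx Hy)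
    ultimately have "(lx + real i * Hx, ly + real j * Hy) \<in> (X \<times> Y) - ({lx<..<rx} \<times> {ly<..<ry})"
      using grid[of i j] by auto
    then show "ug n i j = 0" using sol time[OF that(1)] unfolding ug_def exact_solution_def by blast
    show "U n i j = 0" using cs that by (auto simp: coarse_solution_def Let_def)
  qed
  have initial: "ug 0 i j - U 0 i j = 0" if "i \<le> Mx" "j \<le> My" for i j
  proof (cases "(i, j) \<in> grid_int Mx My")
    case True
    then have i: "0 < i" "i < Mx" "0 < j" "j < My" by (auto simp: grid_int_def)
    have "real i * Hx < real Mx * Hx" "real j * Hy < real My * Hy" using i H by auto
    moreover have "real Mx * Hx = rx - lx" "real My * Hy = ry - ly" using M by (auto simp: Hx Hy)
    ultimately have "lx + real i * Hx \<in> {lx<..<rx}" "ly + real j * Hy \<in> {ly<..<ry}" using i H by auto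
    then have "ug 0 i j = u0 (lx + real i * Hx) (ly + real j * Hy)"
      using sol unfolding ug_def exact_solution_def by simp
    moreover have "U 0 i j = u0 (lx + real i * Hx) (ly + real j * Hy)"
      using cs True unfolding coarse_solution_def Let_def Hx Hy by fast
    ultimately show ?thesis by simp
  next
    case False
    then have "(i, j) \<in> grid_bd Mx My" using that by (auto simp: grid_bd_def)
    then show ?thesis using bd[of 0] by simp
  qed
  have A_e: "?A (e k) i j = ?A (ug k) i j - ?A (U k) i j" if "k \<le> N" "(i, j) \<in> grid_int Mx My" for k i j
  proof (cases "k = 0")
    case True
    have "?A (\<lambda>i j. ug 0 i j - U 0 i j) i j = 0" using initial by (intro A_op_eq_0[OF that(2)])
    moreover have "?A (e 0) i j = 0" by (intro A_op_eq_0[OF that(2)]) (simp add: e_def)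
    ultimately show ?thesis using True by (simp add: A_op_diff)
  next
    case False
    then have "e k = (\<lambda>i j. ug k i j - U k i j)" using that by (simp add: e_def)
    then show ?thesis by (simp add: A_op_diff)
  qed
  have A_d: "?A (cell_value d k) i j = ?A (cell_value (\<lambda>n i j. f (ug n i j)) k) i j - ?A (cell_value (\<lambda>n i j. f (U n i j)) k) i j"
    if "1 \<le> k" "k \<le> N" for k i j
  proof -
    have "cell_value d k = (\<lambda>i j. cell_value (\<lambda>n i j. f (ug n i j)) k i j - cell_value (\<lambda>n i j. f (U n i j)) k i j)"
      using that by (auto simp: fun_eq_iff cell_value_def d_def field_simps)
    then show ?thesis by (simp add: A_op_diff)
  qed
  have L_e: "?L (cell_value e k) i j = ?L (cell_value ug k) i j - ?L (cell_value U k) i j"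
    if "1 \<le> k" "k \<le> N" for k i j
  proof -
    have "cell_value e k = (\<lambda>i j. 1 * cell_value ug k i j + (-1) * cell_value U k i j)"
      using that by (auto simp: fun_eq_iff cell_value_def e_def field_simps)
    then show ?thesis using Lambda_op_linear[of Mx My Hx Hy 1 "cell_value ug k" "-1" "cell_value U k"] by simp
  qed
  have stable: "grid_l2 Mx My (e m) \<le> 9 * (sqrt (real ((Mx - 1) * (My - 1)))
        * (\<Sum>n=1..N. residual_bound \<tau> n + \<tau> * ?B * (Qu * (Hx ^ 4 + Hy ^ 4)))) * (1 + 9 * C * \<tau>) ^ m"
    unfolding C
  proof (rule discrete_stability[where d = d and R = R and c = "wt_coef \<alpha> \<tau>" and \<gamma> = "memory_bound \<tau>" and N = N
        and \<rho> = "\<lambda>n. sqrt (real ((Mx - 1) * (My - 1))) * (residual_bound \<tau> n + \<tau> * ?B * (Qu * (Hx ^ 4 + Hy ^ 4)))"])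
    show "0 < p" "p < 1" "0 < \<tau>" "m \<le> N" "0 \<le> Qf" using p \<tau>0 m Qs by auto
    show "e 0 = (\<lambda>i j. 0)" by (simp add: e_def)
    show "vanishes_on_bd Mx My (e n)" for n using bd[of n] by (auto simp: vanishes_on_bd_def e_def)
    show "vanishes_on_bd Mx My (d n)" for n using bd[of n] by (auto simp: vanishes_on_bd_def d_def)
    show "\<bar>d n i j\<bar> \<le> Qf * \<bar>e n i j\<bar>" for n i j using f_lipschitz by (simp add: d_def e_def)
    show "\<bar>wt_coef \<alpha> \<tau> 0\<bar> \<le> memory_bound \<tau> 0" using wt_coef_increments(1)[OF \<tau>0 N\<tau>] M by simp
    show "\<bar>wt_coef \<alpha> \<tau> (Suc m) - wt_coef \<alpha> \<tau> m\<bar> \<le> memory_bound \<tau> (Suc m)" if "Suc m < N" for m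
      by (rule wt_coef_increments(2)[OF \<tau>0 N\<tau> that])
    show "0 \<le> memory_bound \<tau> m" for m by (rule wt_coef_increments(3)[OF \<tau>0 N\<tau>])
    show "(\<Sum>m<N. memory_bound \<tau> m) \<le> \<tau> * (2 * Qg + 3 * W T)" by (rule wt_coef_increments(4)[OF \<tau>0 N\<tau>])
    show "(\<Sum>m<N. lag_weight p \<tau> m) \<le> \<tau> * ?B" using lag_weight_sum_le[of p \<tau> N T] p \<tau>0 N\<tau> by simp
    show "9 * (2 * Qg + 3 * W T + Qf * ?B) * \<tau> \<le> 1" "0 \<le> 2 * Qg + 3 * W T + Qf * ?B" using small C0 by (auto simp: C)
    show "0 \<le> sqrt (real ((Mx - 1) * (My - 1))) * (residual_bound \<tau> n + \<tau> * ?B * (Qu * (Hx ^ 4 + Hy ^ 4)))" for n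
      using residual_bound_nonneg[OF \<tau>0] \<tau>0 B Qs by simp
    show "(\<Sum>n=1..N. sqrt (real ((Mx - 1) * (My - 1))) * (residual_bound \<tau> n + \<tau> * ?B * (Qu * (Hx ^ 4 + Hy ^ 4))))
        \<le> sqrt (real ((Mx - 1) * (My - 1))) * (\<Sum>n=1..N. residual_bound \<tau> n + \<tau> * ?B * (Qu * (Hx ^ 4 + Hy ^ 4)))"
      by (simp only: sum_distrib_left order_refl)
  next
    fix n assume n: "1 \<le> n" "n \<le> N"
    show "grid_l2 Mx My (R n) \<le> sqrt (real ((Mx - 1) * (My - 1))) * (residual_bound \<tau> n + \<tau> * ?B * (Qu * (Hx ^ 4 + Hy ^ 4)))"
    proof (rule grid_l2_uniform_bound)
      show "0 \<le> residual_bound \<tau> n + \<tau> * ?B * (Qu * (Hx ^ 4 + Hy ^ 4))"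
        using residual_bound_nonneg[OF \<tau>0] \<tau>0 B Qs by simp
      fix i j assume ij: "(i, j) \<in> grid_int Mx My"
      have 1: "\<bar>?A (r n) i j\<bar> \<le> residual_bound \<tau> n"
        by (rule A_op_bound[OF ij]) (use grid in \<open>auto simp: r_def intro!: node_residual_bound[OF _ _ \<tau>0 N\<tau> n]\<close>)
      have space: "\<bar>?A (lap k) i j - ?L (ug k) i j\<bar> \<le> Qu * (Hx ^ 4 + Hy ^ 4)" if "k \<le> N" for k
        unfolding lap_def ug_def by (rule compact_operator_consistency[OF M(2,3) time[OF that] Hx Hy ij])
      have cell: "\<bar>?A (cell_value lap k) i j - ?L (cell_value ug k) i j\<bar> \<le> Qu * (Hx ^ 4 + Hy ^ 4)" if "k \<in> {1..n}" for k
      proof (cases "k = 1")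
        case True
        then show ?thesis using space[of 1] M by (simp add: A_op_cell_value Lambda_op_cell_value)
      next
        case False
        have kN: "k \<le> N" "k - 1 \<le> N" using that n by auto
        have eq: "?A (cell_value lap k) i j - ?L (cell_value ug k) i j
            = ((?A (lap k) i j - ?L (ug k) i j) + (?A (lap (k - 1)) i j - ?L (ug (k - 1)) i j)) / 2"
          using False by (simp add: A_op_cell_value Lambda_op_cell_value field_simps)
        show ?thesis unfolding eq by (rule abs_average_le[OF space[OF kN(1)] space[OF kN(2)]])
      qed
      have "\<bar>\<Sum>k=1..n. lag_weight p \<tau> (n - k) * (?A (cell_value lap k) i j - ?L (cell_value ug k) i j)\<bar>
          \<le> (\<Sum>k=1..n. lag_weight p \<tau> (n - k) * (Qu * (Hx ^ 4 + Hy ^ 4)))"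
        using lag_weight_nonneg[OF p \<tau>0] cell
        by (intro order_trans[OF sum_abs] sum_mono) (auto simp: abs_mult intro!: mult_left_mono)
      also have "\<dots> = (\<Sum>l<n. lag_weight p \<tau> l) * (Qu * (Hx ^ 4 + Hy ^ 4))"
        unfolding sum_distrib_right by (rule sum.reindex_bij_witness[of _ "\<lambda>l. n - l" "\<lambda>k. n - k"]) auto
      also have "\<dots> \<le> \<tau> * ?B * (Qu * (Hx ^ 4 + Hy ^ 4))"
        using lag_weight_sum_le[of p \<tau> n T] p \<tau>0 time[OF n(2)] Qs by (intro mult_right_mono) auto
      finally show "\<bar>R n i j\<bar> \<le> residual_bound \<tau> n + \<tau> * ?B * (Qu * (Hx ^ 4 + Hy ^ 4))"
        unfolding R_def using 1 by linarith
    qed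
    fix i j assume ij: "(i, j) \<in> grid_int Mx My"
    have U_eq: "(?A (U n) i j - ?A (U (n - 1)) i j)
      + (\<Sum>k=1..n. wt_coef \<alpha> \<tau> (n - k) * (?A (U k) i j - ?A (U (k - 1)) i j))
      = (\<Sum>k=1..n. lag_weight p \<tau> (n - k) * ?L (cell_value U k) i j)
      + (\<Sum>k=1..n. lag_weight p \<tau> (n - k) * ?A (cell_value (\<lambda>n i j. f (U n i j)) k) i j)"
      by (rule coarse_scheme_weights[OF cs M \<tau> Hx Hy n ij])
    have u_eq: "(?A (ug n) i j - ?A (ug (n - 1)) i j)
      + (\<Sum>k=1..n. wt_coef \<alpha> \<tau> (n - k) * (?A (ug k) i j - ?A (ug (k - 1)) i j))
      = (\<Sum>k=1..n. lag_weight p \<tau> (n - k) * ?A (cell_value lap k) i j)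
      + (\<Sum>k=1..n. lag_weight p \<tau> (n - k) * ?A (cell_value (\<lambda>n i j. f (ug n i j)) k) i j)
      + ?A (r n) i j"
      unfolding ug_def lap_def r_def by (rule exact_solution_scheme)
    have "(?A (e n) i j - ?A (e (n - 1)) i j) + (\<Sum>k=1..n. wt_coef \<alpha> \<tau> (n - k) * (?A (e k) i j - ?A (e (k - 1)) i j))
      = ((?A (ug n) i j - ?A (ug (n - 1)) i j) + (\<Sum>k=1..n. wt_coef \<alpha> \<tau> (n - k) * (?A (ug k) i j - ?A (ug (k - 1)) i j)))
      - ((?A (U n) i j - ?A (U (n - 1)) i j) + (\<Sum>k=1..n. wt_coef \<alpha> \<tau> (n - k) * (?A (U k) i j - ?A (U (k - 1)) i j)))"
    proof -
      have "(\<Sum>k=1..n. wt_coef \<alpha> \<tau> (n - k) * (?A (e k) i j - ?A (e (k - 1)) i j))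
        = (\<Sum>k=1..n. wt_coef \<alpha> \<tau> (n - k) * (?A (ug k) i j - ?A (ug (k - 1)) i j)
            - wt_coef \<alpha> \<tau> (n - k) * (?A (U k) i j - ?A (U (k - 1)) i j))"
      proof (rule sum.cong[OF refl])
        fix k assume "k \<in> {1..n}"
        then have "k \<le> N" "k - 1 \<le> N" using n by auto
        then show "wt_coef \<alpha> \<tau> (n - k) * (?A (e k) i j - ?A (e (k - 1)) i j)
          = wt_coef \<alpha> \<tau> (n - k) * (?A (ug k) i j - ?A (ug (k - 1)) i j)
            - wt_coef \<alpha> \<tau> (n - k) * (?A (U k) i j - ?A (U (k - 1)) i j)"
          using ij by (simp only: A_e) (simp add: algebra_simps)
      qed
      moreover have "n - 1 \<le> N" using n by simp
      ultimately show ?thesis using n ij by (simp only: A_e sum_subtractf)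
    qed
    also have "\<dots> = (\<Sum>k=1..n. lag_weight p \<tau> (n - k) * ?L (cell_value e k) i j)
      + (\<Sum>k=1..n. lag_weight p \<tau> (n - k) * ?A (cell_value d k) i j) + R n i j"
    proof -
      have "(\<Sum>k=1..n. lag_weight p \<tau> (n - k) * ?L (cell_value e k) i j)
        = (\<Sum>k=1..n. lag_weight p \<tau> (n - k) * ?L (cell_value ug k) i j) - (\<Sum>k=1..n. lag_weight p \<tau> (n - k) * ?L (cell_value U k) i j)"
        unfolding sum_subtractf[symmetric] using n by (intro sum.cong refl) (simp add: L_e right_diff_distrib)
      moreover have "(\<Sum>k=1..n. lag_weight p \<tau> (n - k) * ?A (cell_value d k) i j)
        = (\<Sum>k=1..n. lag_weight p \<tau> (n - k) * ?A (cell_value (\<lambda>n i j. f (ug n i j)) k) i j)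
          - (\<Sum>k=1..n. lag_weight p \<tau> (n - k) * ?A (cell_value (\<lambda>n i j. f (U n i j)) k) i j)"
        unfolding sum_subtractf[symmetric] using n by (intro sum.cong refl) (simp add: A_d right_diff_distrib)
      moreover have "R n i j = ?A (r n) i j + ((\<Sum>k=1..n. lag_weight p \<tau> (n - k) * ?A (cell_value lap k) i j)
          - (\<Sum>k=1..n. lag_weight p \<tau> (n - k) * ?L (cell_value ug k) i j))"
        by (simp add: R_def right_diff_distrib sum_subtractf)
      ultimately show ?thesis unfolding U_eq u_eq by linarith
    qed
    finally show "(?A (e n) i j - ?A (e (n - 1)) i j) + (\<Sum>k=1..n. wt_coef \<alpha> \<tau> (n - k) * (?A (e k) i j - ?A (e (k - 1)) i j))
      = (\<Sum>k=1..n. lag_weight p \<tau> (n - k) * ?L (cell_value e k) i j)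
      + (\<Sum>k=1..n. lag_weight p \<tau> (n - k) * ?A (cell_value d k) i j) + R n i j" .
  qed
  have total: "(\<Sum>n=1..N. residual_bound \<tau> n + \<tau> * ?B * (Qu * (Hx ^ 4 + Hy ^ 4)))
      \<le> (Qg + 3 * W T + 2 * ?B) * (2 * V T) * \<tau>\<^sup>2 + T * ?B * Qu * (Hx ^ 4 + Hy ^ 4)" (is "_ \<le> ?E")
  proof -
    have "(\<Sum>n=1..N. residual_bound \<tau> n + \<tau> * ?B * (Qu * (Hx ^ 4 + Hy ^ 4)))
        = (\<Sum>n=1..N. residual_bound \<tau> n) + real N * \<tau> * (?B * (Qu * (Hx ^ 4 + Hy ^ 4)))"
      by (simp add: sum.distrib)
    then show ?thesis using residual_bound_sum[OF \<tau>0 N\<tau>] unfolding N\<tau> by (simp add: mult_ac)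
  qed
  have E0: "0 \<le> ?E"
    using Qs B T W_nonneg[of T] V_mono[of 0 T] V_0 by (intro add_nonneg_nonneg mult_nonneg_nonneg) auto
  have growth: "(1 + 9 * C * \<tau>) ^ m \<le> exp (9 * C * T)"
  proof -
    have "(1 + 9 * C * \<tau>) ^ m \<le> exp (9 * C * \<tau>) ^ m" using C0 \<tau>0 by (intro power_mono exp_ge_add_one_self) auto
    also have "\<dots> = exp (9 * C * (real m * \<tau>))" by (simp add: exp_of_nat_mult[symmetric] mult_ac)
    also have "\<dots> \<le> exp (9 * C * T)" using time[OF m(2)] C0 by (auto intro!: mult_left_mono)
    finally show ?thesis .
  qed
  have area: "sqrt (Hx * Hy) * sqrt (real ((Mx - 1) * (My - 1))) \<le> sqrt ((rx - lx) * (ry - ly))"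
  proof -
    have "(Hx * real (Mx - 1)) * (Hy * real (My - 1)) \<le> (Hx * real Mx) * (Hy * real My)"
      using H by (intro mult_mono) auto
    also have "\<dots> = (rx - lx) * (ry - ly)" using M by (simp add: Hx Hy)
    finally show ?thesis by (simp add: real_sqrt_mult[symmetric] mult_ac)
  qed
  have "grid_norm Mx My Hx Hy (\<lambda>i j. u (lx + real i * Hx) (ly + real j * Hy) (real m * \<tau>) - U m i j)
      = sqrt (Hx * Hy) * grid_l2 Mx My (e m)"
    using H m by (simp add: grid_norm_eq_l2 e_def ug_def)
  also have "\<dots> \<le> sqrt (Hx * Hy) * (9 * (sqrt (real ((Mx - 1) * (My - 1))) * ?E) * exp (9 * C * T))"
  proof (rule mult_left_mono[OF order_trans[OF stable]])
    show "9 * (sqrt (real ((Mx - 1) * (My - 1))) * (\<Sum>n=1..N. residual_bound \<tau> n + \<tau> * ?B * (Qu * (Hx ^ 4 + Hy ^ 4)))) * (1 + 9 * C * \<tau>) ^ m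
        \<le> 9 * (sqrt (real ((Mx - 1) * (My - 1))) * ?E) * exp (9 * C * T)"
    proof (rule mult_mono[OF mult_left_mono[OF mult_left_mono[OF total]] growth])
      show "0 \<le> 9 * (sqrt (real ((Mx - 1) * (My - 1))) * ?E)" using E0 by (intro mult_nonneg_nonneg) simp_all
      show "0 \<le> (1 + 9 * C * \<tau>) ^ m" using C0 \<tau>0 by simp
    qed simp_all
  qed (use H in simp)
  also have "\<dots> = (sqrt (Hx * Hy) * sqrt (real ((Mx - 1) * (My - 1)))) * (9 * exp (9 * C * T) * ?E)" by (simp only: mult_ac)
  also have "\<dots> \<le> sqrt ((rx - lx) * (ry - ly)) * (9 * exp (9 * C * T) * ?E)"
    using area E0 by (intro mult_right_mono) auto
  finally show ?thesis by (simp only: mult_ac)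
qed

end

theorem theorem4p3:
  fixes T abar Qg Qf QL Qu Qff :: real
  assumes "0 < T" and "0 < abar" and "abar < 1"
    and "0 < Qg" and "0 < Qf" and "0 < QL" and "0 < Qu" and "0 < Qff"
  shows "\<exists>Q>0. \<exists>\<tau>0>0. \<exists>H0>0.
    \<forall>(lx::real) rx ly ry Q\<alpha> \<alpha> f u0 v0 u.
      lx < rx \<and> ly < ry \<and> QL = sqrt ((rx - lx) * (ry - ly)) \<and>
      exponent_conditions T Q\<alpha> \<alpha> \<and> abar = \<alpha> 0 - 1 \<and> g_bounds T \<alpha> Qg \<and>
      nonlinearity_conditions Qf f \<and>
      exact_solution lx rx ly ry T \<alpha> f u0 v0 u \<and>
      regularity_A1 lx rx ly ry T (\<alpha> 0) Qu u \<and>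
      regularity_A2 lx rx ly ry T (\<alpha> 0) Qu u \<and>
      (\<forall>x\<in>{lx..rx}. \<forall>y\<in>{ly..ry}. \<forall>t\<in>{0..T}. \<bar>deriv (deriv f) (u x y t)\<bar> \<le> Qff)
      \<longrightarrow>
      (\<forall>N Mx My U dU0.
        let \<tau> = T / real N; Hx = (rx - lx) / real Mx; Hy = (ry - ly) / real My in
        0 < N \<and> 0 < Mx \<and> 0 < My \<and> \<tau> \<le> \<tau>0 \<and> Hx \<le> H0 \<and> Hy \<le> H0 \<and>
        coarse_solution lx rx ly ry T \<alpha> f u0 v0 N Mx My U dU0
        \<longrightarrow>
        (\<forall>n\<in>{1..N}.
          grid_norm Mx My Hx Hy
            (\<lambda>i j. u (lx + real i * Hx) (ly + real j * Hy) (real n * \<tau>) - U n i j)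
          \<le> Q * (\<tau>\<^sup>2 + Hx ^ 4 + Hy ^ 4)))"
proof -
  define B where "B = beta_kernel (1 + abar) T"
  define w where "w = Qg * (4 * T powr (1/2) + 4/3 * T powr (3/2) + T)"
  define v where "v = (2 + Qff * Qu * T powr (1 + abar) + Qf) * Qu / abar * T powr abar"
  \<comment> \<open>\<open>C\<close> is the growth constant of Gronwall's argument; for \<open>\<tau> \<le> 1 / (9 * C)\<close> the term at the current level can be absorbed.\<close>
  define C where "C = 2 * Qg + 3 * w + Qf * B"
  define K where "K = (Qg + 3 * w + 2 * B) * (2 * v) + T * B * Qu + 1"
  define Q where "Q = 9 * QL * exp (9 * C * T) * K"
  have pos: "0 \<le> B" "0 \<le> w" "0 \<le> v"
    using assms beta_kernel_nonneg[of "1 + abar" T] by (auto simp: B_def w_def v_def)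
  have Cpos: "0 < C" using assms pos unfolding C_def by (intro add_pos_nonneg mult_nonneg_nonneg) auto
  have Kge: "(Qg + 3 * w + 2 * B) * (2 * v) \<le> K" "T * B * Qu \<le> K" "0 < K"
    using assms pos by (simp_all add: K_def add_nonneg_pos)
  have Qpos: "0 < Q" using assms Kge(3) by (simp add: Q_def)
  have bound: "grid_norm Mx My Hx Hy (\<lambda>i j. u (lx + real i * Hx) (ly + real j * Hy) (real n * \<tau>) - U n i j)
      \<le> Q * (\<tau>\<^sup>2 + Hx ^ 4 + Hy ^ 4)"
    if h: "lx < rx" "ly < ry" "QL = sqrt ((rx - lx) * (ry - ly))" "exponent_conditions T Q\<alpha> \<alpha>" "abar = \<alpha> 0 - 1"
      "g_bounds T \<alpha> Qg" "nonlinearity_conditions Qf f" "exact_solution lx rx ly ry T \<alpha> f u0 v0 u"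
      "regularity_A1 lx rx ly ry T (\<alpha> 0) Qu u" "regularity_A2 lx rx ly ry T (\<alpha> 0) Qu u"
      "\<forall>x\<in>{lx..rx}. \<forall>y\<in>{ly..ry}. \<forall>t\<in>{0..T}. \<bar>deriv (deriv f) (u x y t)\<bar> \<le> Qff"
      and d: "\<tau> = T / real N" "Hx = (rx - lx) / real Mx" "Hy = (ry - ly) / real My"
      "0 < N" "0 < Mx" "0 < My" "\<tau> \<le> 1 / (9 * C)"
      "coarse_solution lx rx ly ry T \<alpha> f u0 v0 N Mx My U dU0" "n \<in> {1..N}"
    for lx rx ly ry Q\<alpha> \<alpha> f u0 v0 u N Mx My U dU0 \<tau> Hx Hy n
  proof -
    interpret regular_solution T abar Qg Qf Qu Qff Q\<alpha> lx rx ly ry \<alpha> f u0 v0 u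
      by unfold_locales (use assms h in auto)
    have WV: "W T = w" "V T = v" by (simp_all add: W_def w_def V_def v_def Cv_def)
    have "grid_norm Mx My Hx Hy (\<lambda>i j. u (lx + real i * Hx) (ly + real j * Hy) (real n * \<tau>) - U n i j)
      \<le> 9 * QL * exp (9 * C * T) * ((Qg + 3 * w + 2 * B) * (2 * v) * \<tau>\<^sup>2 + T * B * Qu * (Hx ^ 4 + Hy ^ 4))"
      unfolding h(3) B_def WV[symmetric]
    proof (rule coarse_error_estimate[OF d(8,4-6,1-3)])
      show "9 * C * \<tau> \<le> 1" using d(7) Cpos by (simp add: field_simps)
    qed (use d in \<open>auto simp: C_def B_def WV\<close>)
    also have "\<dots> \<le> 9 * QL * exp (9 * C * T) * (K * \<tau>\<^sup>2 + K * (Hx ^ 4 + Hy ^ 4))"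
      using assms Kge by (intro mult_left_mono add_mono mult_right_mono) auto
    also have "\<dots> = Q * (\<tau>\<^sup>2 + Hx ^ 4 + Hy ^ 4)" by (simp add: Q_def algebra_simps)
    finally show ?thesis .
  qed
  show ?thesis
  proof (rule exI[of _ Q], rule conjI[OF Qpos], rule exI[of _ "1 / (9 * C)"], rule conjI, use Cpos in simp,
      rule exI[of _ 1], rule conjI, simp, unfold Let_def, intro allI impI ballI)
    fix lx rx ly ry Q\<alpha> \<alpha> f u0 v0 u N Mx My U dU0 n
    assume "lx < rx \<and> ly < ry \<and> QL = sqrt ((rx - lx) * (ry - ly)) \<and>
      exponent_conditions T Q\<alpha> \<alpha> \<and> abar = \<alpha> 0 - 1 \<and> g_bounds T \<alpha> Qg \<and>
      nonlinearity_conditions Qf f \<and> exact_solution lx rx ly ry T \<alpha> f u0 v0 u \<and>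
      regularity_A1 lx rx ly ry T (\<alpha> 0) Qu u \<and> regularity_A2 lx rx ly ry T (\<alpha> 0) Qu u \<and>
      (\<forall>x\<in>{lx..rx}. \<forall>y\<in>{ly..ry}. \<forall>t\<in>{0..T}. \<bar>deriv (deriv f) (u x y t)\<bar> \<le> Qff)"
      and "0 < N \<and> 0 < Mx \<and> 0 < My \<and> T / real N \<le> 1 / (9 * C) \<and> (rx - lx) / real Mx \<le> 1 \<and> (ry - ly) / real My \<le> 1 \<and>
        coarse_solution lx rx ly ry T \<alpha> f u0 v0 N Mx My U dU0"
      and "n \<in> {1..N}"
    then show "grid_norm Mx My ((rx - lx) / real Mx) ((ry - ly) / real My)
        (\<lambda>i j. u (lx + real i * ((rx - lx) / real Mx)) (ly + real j * ((ry - ly) / real My)) (real n * (T / real N)) - U n i j)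
      \<le> Q * ((T / real N)\<^sup>2 + ((rx - lx) / real Mx) ^ 4 + ((ry - ly) / real My) ^ 4)"
      by (intro bound[where Q\<alpha> = Q\<alpha> and \<alpha> = \<alpha> and f = f and ?u0.0 = u0 and ?v0.0 = v0 and u = u and ?dU0.0 = dU0 and N = N
            and lx = lx and rx = rx and ly = ly and ry = ry and Mx = Mx and My = My and U = U and n = n]) (elim conjE, assumption | rule refl)+
  qed
qed

end
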